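(* Let $g\in L^2(\mathbb{R}^{2d},\mathbb{H})$ be a quaternion window function and $f\in L^2(\mathbb{R}^{2d},\mathbb{H})$, with $f\neq0$ and $g\neq0$. Then $$E\big(|\mathcal{G}_g(f)|^2\big)\ge\|f\|_{2,2d}^2\|g\|_{2,2d}^2\Big(2d\ln2-\ln\big(\|f\|_{2,2d}^2\|g\|_{2,2d}^2\big)\Big).$$
   Context: $d\ge 1$ is an integer and $\mathbb{H}$ is the algebra of quaternions with units $i,j,k$. On $\mathbb{R}^n$, $d\mu_n(x)=dx/(2\pi)^{n/2}$, $\|f\|_{2,n}=\big(\int_{\mathbb{R}^n}|f|^2d\mu_n\big)^{1/2}$, and $\mathbb{R}^{2d}\times\mathbb{R}^{2d}$ is identified with $\mathbb{R}^{4d}$. The two sided quaternion windowed Fourier transform is $$\mathcal{G}_g(f)(x,w)=\int_{\mathbb{R}^{2d}}e^{-i\,s\cdot u}f(y)\overline{g(y-x)}e^{-j\,t\cdot v}\,d\mu_{2d}(y),\quad x\in\mathbb{R}^{2d},\ w=(u,v),\ y=(s,t)\in\mathbb{R}^d\times\mathbb{R}^d.$$ The entropy of a non-negative integrable function $P$ on $\mathbb{R}^{2d}\times\mathbb{R}^{2d}$ is $E(P)=-\iint_{\mathbb{R}^{2d}\times\mathbb{R}^{2d}}\ln(P(x,w))\,P(x,w)\,d\mu_{4d}(x,w)$ (with $0\ln0=0$), which is allowed to be $+\infty$. *)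

theory Defs
  imports "HOL-Analysis.Analysis"
begin

section \<open>Quaternions\<close>

datatype quat = Quat (qre: real) (qim1: real) (qim2: real) (qim3: real)

lemma quat_eq_iff: "p = q \<longleftrightarrow> qre p = qre q \<and> qim1 p = qim1 q \<and> qim2 p = qim2 q \<and> qim3 p = qim3 q"
  by (cases p; cases q) simp

instantiation quat :: ring_1
begin

definition "0 = Quat 0 0 0 0"

definition "1 = Quat 1 0 0 0"

definition "p + q = Quat (qre p + qre q) (qim1 p + qim1 q) (qim2 p + qim2 q) (qim3 p + qim3 q)"

definition "p - q = Quat (qre p - qre q) (qim1 p - qim1 q) (qim2 p - qim2 q) (qim3 p - qim3 q)"

definition "- q = Quat (- qre q) (- qim1 q) (- qim2 q) (- qim3 q)"

definition "p * q = Quat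
  (qre p * qre q - qim1 p * qim1 q - qim2 p * qim2 q - qim3 p * qim3 q)
  (qre p * qim1 q + qim1 p * qre q + qim2 p * qim3 q - qim3 p * qim2 q)
  (qre p * qim2 q - qim1 p * qim3 q + qim2 p * qre q + qim3 p * qim1 q)
  (qre p * qim3 q + qim1 p * qim2 q - qim2 p * qim1 q + qim3 p * qre q)"

instance
proof
  fix a b c :: quat
  note d =
    quat_eq_iff zero_quat_def one_quat_def plus_quat_def minus_quat_def uminus_quat_def
    times_quat_def
  show "a * b * c = a * (b * c)" unfolding d quat.sel by (intro conjI; algebra)
  show "(a + b) * c = a * c + b * c" "a * (b + c) = a * b + a * c"
    unfolding d quat.sel by (intro conjI; algebra)+
  show "a + b + c = a + (b + c)" "a + b = b + a" "0 + a = a" "1 * a = a"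
    "a * 1 = a" "- a + a = 0" "a - b = a + - b" "(0::quat) \<noteq> 1"
    by (simp_all add: d)
qed

end

instantiation quat :: real_vector
begin

definition "r *\<^sub>R q = Quat (r * qre q) (r * qim1 q) (r * qim2 q) (r * qim3 q)"

instance
  by standard (simp_all add: scaleR_quat_def plus_quat_def quat_eq_iff algebra_simps)

end

instantiation quat :: real_inner
begin

definition "p \<bullet> q = qre p * qre q + qim1 p * qim1 q + qim2 p * qim2 q + qim3 p * qim3 q"

definition "norm (q::quat) = sqrt ((qre q)\<^sup>2 + (qim1 q)\<^sup>2 + (qim2 q)\<^sup>2 + (qim3 q)\<^sup>2)"

definition "sgn (q::quat) = q /\<^sub>R norm q"

definition "dist p q = norm (p - q :: quat)"

definition [code del]:
  "(uniformity :: (quat \<times> quat) filter) = (INF e\<in>{0<..}. principal {(x, y). dist x y < e})"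

definition [code del]:
  "open (U :: quat set) \<longleftrightarrow> (\<forall>x\<in>U. eventually (\<lambda>(x', y). x' = x \<longrightarrow> y \<in> U) uniformity)"

instance
proof
  fix p q r :: quat and a b :: real
  show "dist p q = norm (p - q)" by (simp add: dist_quat_def)
  show "sgn p = p /\<^sub>R norm p" by (simp add: sgn_quat_def)
  show "(uniformity :: (quat \<times> quat) filter) = (INF e\<in>{0<..}. principal {(x, y). dist x y < e})"
    by (rule uniformity_quat_def)
  show "open U \<longleftrightarrow> (\<forall>x\<in>U. eventually (\<lambda>(x', y). x' = x \<longrightarrow> y \<in> U) uniformity)" for U :: "quat set"
    by (rule open_quat_def)
  show "p \<bullet> q = q \<bullet> p" by (simp add: inner_quat_def mult.commute)
  show "(p + q) \<bullet> r = p \<bullet> r + q \<bullet> r" "(a *\<^sub>R p) \<bullet> q = a * (p \<bullet> q)"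
    by (simp_all add: inner_quat_def scaleR_quat_def plus_quat_def algebra_simps)
  show "0 \<le> p \<bullet> p" by (simp add: inner_quat_def)
  have "p \<bullet> p = 0 \<longleftrightarrow> qre p = 0 \<and> qim1 p = 0 \<and> qim2 p = 0 \<and> qim3 p = 0"
    by (simp add: inner_quat_def add_nonneg_eq_0_iff)
  then show "p \<bullet> p = 0 \<longleftrightarrow> p = 0"
    by (simp add: zero_quat_def quat_eq_iff)
  show "norm p = sqrt (p \<bullet> p)"
    by (simp add: norm_quat_def inner_quat_def power2_eq_square)
qed

end

definition quat_i :: quat where "quat_i = Quat 0 1 0 0"

definition quat_j :: quat where "quat_j = Quat 0 0 1 0"

definition quat_k :: quat where "quat_k = Quat 0 0 0 1"

definition quat_cnj :: "quat \<Rightarrow> quat"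
  where "quat_cnj q = Quat (qre q) (- qim1 q) (- qim2 q) (- qim3 q)"

lemma quat_units:
  "quat_i * quat_i = - 1" "quat_j * quat_j = - 1" "quat_k * quat_k = - 1"
  "quat_i * quat_j = quat_k" "quat_j * quat_k = quat_i" "quat_k * quat_i = quat_j"
  "quat_j * quat_i = - quat_k" "quat_k * quat_j = - quat_i" "quat_i * quat_k = - quat_j"
  by (simp_all add: quat_i_def quat_j_def quat_k_def times_quat_def uminus_quat_def one_quat_def)

instantiation quat :: inverse
begin

definition inverse_quat where "inverse_quat (q::quat) = quat_cnj q /\<^sub>R (norm q)\<^sup>2"

definition divide_quat where "divide_quat p q = p * inverse (q::quat)"

instance ..

end

instance quat :: real_normed_div_algebra
proof
  fix p q :: quat and a :: real
  show "a *\<^sub>R p * q = a *\<^sub>R (p * q)" "p * a *\<^sub>R q = a *\<^sub>R (p * q)"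
    unfolding scaleR_quat_def times_quat_def quat_eq_iff quat.sel
    by (intro conjI; algebra)+
  show "p / q = p * inverse q" by (simp add: divide_quat_def)
  show "inverse (0::quat) = 0"
    by (simp add: inverse_quat_def norm_quat_def scaleR_quat_def zero_quat_def)
  have sq: "(norm q)\<^sup>2 = (qre q)\<^sup>2 + (qim1 q)\<^sup>2 + (qim2 q)\<^sup>2 + (qim3 q)\<^sup>2" for q :: quat
    by (simp add: norm_quat_def)
  have cnj: "q * quat_cnj q = (norm q)\<^sup>2 *\<^sub>R 1" "quat_cnj q * q = (norm q)\<^sup>2 *\<^sub>R 1" for q :: quat
    unfolding sq quat_cnj_def times_quat_def scaleR_quat_def one_quat_def quat_eq_iff quat.sel
    by (intro conjI; algebra)+
  have scR: "p * (a *\<^sub>R q) = a *\<^sub>R (p * q)" "(a *\<^sub>R p) * q = a *\<^sub>R (p * q)" for a and p q :: quat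
    unfolding scaleR_quat_def times_quat_def quat_eq_iff quat.sel
    by (intro conjI; algebra)+
  show "inverse q * q = 1" "q * inverse q = 1" if "q \<noteq> 0"
    using that by (simp_all add: inverse_quat_def scR cnj)
  have "(norm (p * q))\<^sup>2 = (norm p * norm q)\<^sup>2"
    unfolding power_mult_distrib sq times_quat_def quat.sel by algebra
  then show "norm (p * q) = norm p * norm q"
    by simp
qed

instantiation quat :: euclidean_space
begin

definition "Basis = {1, quat_i, quat_j, quat_k}"

instance
proof
  fix u v q :: quat
  show "(Basis :: quat set) \<noteq> {}" "finite (Basis :: quat set)"
    by (simp_all add: Basis_quat_def)
  note d = Basis_quat_def one_quat_def quat_i_def quat_j_def quat_k_def
  show "u \<bullet> v = (if u = v then 1 else 0)" if "u \<in> Basis" "v \<in> Basis"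
  proof -
    have "u = Quat 1 0 0 0 \<or> u = Quat 0 1 0 0 \<or> u = Quat 0 0 1 0 \<or> u = Quat 0 0 0 1"
      "v = Quat 1 0 0 0 \<or> v = Quat 0 1 0 0 \<or> v = Quat 0 0 1 0 \<or> v = Quat 0 0 0 1"
      using that unfolding d by blast+
    then show ?thesis
      by (elim disjE) (simp_all add: inner_quat_def)
  qed
  show "(\<forall>u\<in>Basis. q \<bullet> u = 0) \<longleftrightarrow> q = 0"
    unfolding d ball_simps zero_quat_def quat_eq_iff inner_quat_def quat.sel by simp
qed

end


section \<open>Normalized Lebesgue measure and square integrable functions\<close>

definition lebesgue_2pi :: "'a::euclidean_space measure"
  where "lebesgue_2pi = scale_measure (ennreal (1 / (2 * pi) powr (real DIM('a) / 2))) lebesgue"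

definition quat_L2 :: "('a::euclidean_space \<Rightarrow> quat) set"
  where "quat_L2 = {f \<in> borel_measurable lebesgue_2pi. integrable lebesgue_2pi (\<lambda>x. (norm (f x))\<^sup>2)}"

definition quat_L2_norm :: "('a::euclidean_space \<Rightarrow> quat) \<Rightarrow> real"
  where "quat_L2_norm f = sqrt (\<integral>x. (norm (f x))\<^sup>2 \<partial>lebesgue_2pi)"


section \<open>Two-sided quaternion windowed Fourier transform\<close>

text \<open>
  With \<open>d = CARD('d)\<close>, the type \<open>(real^'d) \<times> (real^'d)\<close> is the Euclidean space of dimension \<open>2 d\<close>
  with its splitting \<open>y = (s, t)\<close>. The exponentials are those of the Banach algebra of quaternions.
\<close>

definition qwft ::
  "((real^'d) \<times> (real^'d) \<Rightarrow> quat) \<Rightarrow> ((real^'d) \<times> (real^'d) \<Rightarrow> quat) \<Rightarrow>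
    ((real^'d) \<times> (real^'d)) \<times> ((real^'d) \<times> (real^'d)) \<Rightarrow> quat"
  where "qwft g f = (\<lambda>(x, (u, v)).
    \<integral>y. (case y of (s, t) \<Rightarrow>
      exp (- ((s \<bullet> u) *\<^sub>R quat_i)) * f y * quat_cnj (g (y - x)) * exp (- ((t \<bullet> v) *\<^sub>R quat_j)))
    \<partial>lebesgue_2pi)"


section \<open>Entropy\<close>

text \<open>
  The integral of \<open>P ln P\<close> is taken in the extended sense, as the integral of the positive part
  minus that of the negative part. Since \<open>\<infinity> - \<infinity> = \<infinity>\<close> in \<^typ>\<open>ereal\<close>, the entropy is \<open>-\<infinity>\<close> should both
  be infinite, so that a lower bound never holds merely because the integral is undefined.
  Note that \<open>ln 0 * 0 = 0\<close>.
\<close>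

definition entropy_2pi :: "('a::euclidean_space \<Rightarrow> real) \<Rightarrow> ereal"
  where "entropy_2pi P =
    - (enn2ereal (\<integral>\<^sup>+z. ennreal (ln (P z) * P z) \<partial>lebesgue_2pi)
       - enn2ereal (\<integral>\<^sup>+z. ennreal (- (ln (P z) * P z)) \<partial>lebesgue_2pi))"

end

theory Submission
  imports Defs "HOL-Probability.Probability"
begin

text \<open>
  Since \<open>-P ln P \<ge> P (1 - ln c) - P\<^sup>2 / c\<close>, it suffices to compute the mass of
  \<open>P = |G\<^sub>g f|\<^sup>2\<close>, which is \<open>N = |f|\<^sup>2 |g|\<^sup>2\<close> by Plancherel, and to bound the integral of
  \<open>P\<^sup>2\<close> by \<open>2\<^bsup>-2d\<^esup> N\<^sup>2\<close>; the choice \<open>c = 2\<^bsup>-2d\<^esup> N\<close> then gives the claim.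
  The second bound is Lieb's inequality for the exponent \<open>4\<close>, where it needs no sharp Young or
  Hausdorff-Young inequality. For a one-sided transform, the fourth moment of the Fourier transform
  of \<open>h\<close> is, up to normalization, at most the squared \<open>L\<^sup>2\<close> norm of \<open>|h| * |h|\<close>, and for
  \<open>h(s) = f(s) g(s - x)\<close> the Cauchy-Schwarz inequality separates \<open>f\<close> from \<open>g\<close>.
  The two exponentials do not commute past the quaternion values, so the two-sided transform is
  treated as a left transform in \<open>s\<close>, with values in kernels \<open>W(t,t')\<close>, followed by a right
  transform in \<open>t\<close>: the bound for the latter is a multilinear form in \<open>|W|\<close> with positive
  coefficients, to which Hoelder's inequality applies in the variables of the former.
\<close>

subsection \<open>Quaternions\<close>

text \<open>For complex h the fourth moment is Plancherel applied to h * h, because the square of a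
  transform is the transform of a convolution square. Quaternion exponentials do not commute with
  the values, so squares of transforms are avoided. Only the real number |h^(u)|^2 is expanded, as a
  double integral of inner products in which the phases enter through the cosine and sine of one
  phase difference. Multiplying two such expansions and integrating against a Gaussian in u removes
  the sines and leaves the transform of the Gaussian at the sum and at the difference of the two
  phase differences. That transform is nonnegative, so h may be replaced by |h|, and its mass does
  not depend on the width, so the Gaussian can be removed at the end. The same Gaussian gives the
  second moment without a prior L^2 theory of the transform. The factor 2^(-2d) is a product of two
  Jacobians 2^(-d), one for each one-sided transform.\<close>

lemmas quat_component_simps = quat_eq_iff zero_quat_def one_quat_def plus_quat_def minus_quat_def
  uminus_quat_def times_quat_def scaleR_quat_def inner_quat_def quat_cnj_def quat_i_def quat_j_def

lemma norm_quat_power2: "(norm q)\<^sup>2 = (qre q)\<^sup>2 + (qim1 q)\<^sup>2 + (qim2 q)\<^sup>2 + (qim3 q)\<^sup>2" for q :: quat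
  by (simp add: norm_quat_def)

lemma norm_quat_cnj [simp]: "norm (quat_cnj q) = norm q"
  by (simp add: norm_quat_def quat_cnj_def)

lemma quat_cnj_cnj [simp]: "quat_cnj (quat_cnj q) = q"
  by (simp add: quat_component_simps)

lemma quat_cnj_mult: "quat_cnj (p * q) = quat_cnj q * quat_cnj p"
  by (simp add: quat_component_simps)

lemma quat_cnj_diff: "quat_cnj (p - q) = quat_cnj p - quat_cnj q"
  by (simp add: quat_component_simps)

lemma bounded_linear_quat_cnj: "bounded_linear quat_cnj"
  by (rule bounded_linear_intro[where K=1]) (simp_all add: quat_component_simps norm_quat_def)

lemma measurable_quat_cnj [measurable]: "quat_cnj \<in> borel_measurable borel"
  by (intro borel_measurable_continuous_onI linear_continuous_on bounded_linear_quat_cnj)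

text \<open>The map \<open>\<phi>\<close> embeds the complex numbers by sending the imaginary unit
  to \<iota>. It is multiplicative because \<iota> squares to -1, and it is bounded, so it carries
  the complex exponential series to the quaternion one.\<close>

lemma exp_scaleR_imaginary_unit:
  fixes \<iota> :: quat
  assumes "\<iota> * \<iota> = - 1"
  shows "exp (t *\<^sub>R \<iota>) = cos t *\<^sub>R 1 + sin t *\<^sub>R \<iota>"
proof -
  define \<phi> where "\<phi> z = Re z *\<^sub>R 1 + Im z *\<^sub>R \<iota>" for z :: complex
  have bl: "bounded_linear \<phi>"
    unfolding \<phi>_def[abs_def]
    by (intro bounded_linear_add bounded_linear_scaleR_left[THEN bounded_linear_compose]
        bounded_linear_Re bounded_linear_Im)
  have mult: "\<phi> (x * y) = \<phi> x * \<phi> y" for x y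
    by (simp add: \<phi>_def algebra_simps assms mult_scaleR_left mult_scaleR_right)
  have pow: "\<phi> (z ^ n) = \<phi> z ^ n" for z n
    by (induction n) (simp_all add: mult, simp add: \<phi>_def)
  have "(\<lambda>n. \<phi> ((\<i> * t) ^ n /\<^sub>R fact n)) sums \<phi> (exp (\<i> * t))"
    using bounded_linear.sums[OF bl exp_converges[of "\<i> * t"]] .
  then have "(\<lambda>n. (t *\<^sub>R \<iota>) ^ n /\<^sub>R fact n) sums \<phi> (exp (\<i> * t))"
    by (simp add: bounded_linear.linear[OF bl, THEN linear_scale] pow) (simp add: \<phi>_def)
  then have "exp (t *\<^sub>R \<iota>) = \<phi> (exp (\<i> * t))"
    using exp_converges sums_unique2 by blast
  then show ?thesis
    by (simp add: \<phi>_def Re_exp Im_exp)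
qed

lemma imaginary_units_square: "\<iota> \<in> {quat_i, quat_j} \<Longrightarrow> \<iota> * \<iota> = - 1"
  using quat_units by auto

lemma exp_imaginary_unit_minus:
  assumes "\<iota> \<in> {quat_i, quat_j}"
  shows "exp (- (t *\<^sub>R \<iota>)) = cos t *\<^sub>R 1 - sin t *\<^sub>R \<iota>"
  using exp_scaleR_imaginary_unit[OF imaginary_units_square[OF assms], of "- t"] by simp

lemma norm_exp_imaginary_unit [simp]:
  "norm (exp (- (t *\<^sub>R quat_i))) = 1" "norm (exp (- (t *\<^sub>R quat_j))) = 1"
proof -
  have "(norm (exp (- (t *\<^sub>R \<iota>))))\<^sup>2 = 1\<^sup>2" if "\<iota> \<in> {quat_i, quat_j}" for \<iota>
    unfolding exp_imaginary_unit_minus[OF that] norm_quat_power2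
    using that sin_cos_squared_add3[of t] by (auto simp: quat_component_simps power2_eq_square)
  then show "norm (exp (- (t *\<^sub>R quat_i))) = 1" "norm (exp (- (t *\<^sub>R quat_j))) = 1"
    by (metis insertI1 insertI2 norm_ge_zero power2_eq_imp_eq zero_le_one)+
qed

lemma measurable_exp_imaginary [measurable (raw)]:
  "f \<in> borel_measurable M \<Longrightarrow> (\<lambda>x. exp (- (f x *\<^sub>R quat_i))) \<in> borel_measurable M"
  "f \<in> borel_measurable M \<Longrightarrow> (\<lambda>x. exp (- (f x *\<^sub>R quat_j))) \<in> borel_measurable M"
  by (simp_all add: exp_imaginary_unit_minus)

lemma quat_cnj_exp_j: "quat_cnj (exp (- (t *\<^sub>R quat_j))) = exp (- ((- t) *\<^sub>R quat_j))"
  by (simp only: exp_imaginary_unit_minus[OF insertI2[OF singletonI]])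
    (simp add: quat_component_simps)

text \<open>Left multiplication by a unit exponential is an isometry, so both phases can be moved
  onto p, and only a - b remains.\<close>

lemma inner_exp_mult_exp_mult:
  assumes "\<iota> \<in> {quat_i, quat_j}"
  shows "(exp (- (a *\<^sub>R \<iota>)) * p) \<bullet> (exp (- (b *\<^sub>R \<iota>)) * q)
    = cos (a - b) * (p \<bullet> q) - sin (a - b) * ((\<iota> * p) \<bullet> q)"
  using assms unfolding exp_imaginary_unit_minus[OF assms]
  by (auto simp: quat_component_simps cos_diff sin_diff algebra_simps)

text \<open>Both inner products are, up to sign, components of p times the conjugate of q, whose
  norm is |p| |q|. This bounds the amplitude of the trigonometric expression in the phase
  difference.\<close>

lemma inner_power2_add_inner_unit_power2_le:
  assumes "\<iota> \<in> {quat_i, quat_j}"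
  shows "(p \<bullet> q)\<^sup>2 + ((\<iota> * p) \<bullet> q)\<^sup>2 \<le> (norm p * norm q)\<^sup>2"
proof -
  have "(norm p * norm q)\<^sup>2 = (norm (p * quat_cnj q))\<^sup>2"
    by (simp add: norm_mult)
  moreover have "p \<bullet> q = qre (p * quat_cnj q)"
    by (simp add: quat_component_simps)
  moreover have "(\<iota> * p) \<bullet> q = - qim1 (p * quat_cnj q) \<or> (\<iota> * p) \<bullet> q = - qim2 (p * quat_cnj q)"
    using assms by (auto simp: quat_component_simps algebra_simps)
  ultimately show ?thesis
    unfolding norm_quat_power2 by (auto simp: norm_quat_power2)
qed

text \<open>Three of the four terms contain a sine of a phase difference; they are the ones that
  vanish once integrated against an even Gaussian.\<close>

lemma inner_two_sided_exp:
  "(exp (- (a *\<^sub>R quat_i)) * p * exp (- (c *\<^sub>R quat_j))) \<bullet> (exp (- (b *\<^sub>R quat_i)) * q * exp (- (d *\<^sub>R quat_j)))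
    = cos (a - b) * cos (c - d) * (p \<bullet> q) - sin (a - b) * cos (c - d) * ((quat_i * p) \<bullet> q)
      - cos (a - b) * sin (c - d) * ((p * quat_j) \<bullet> q)
      + sin (a - b) * sin (c - d) * ((quat_i * p * quat_j) \<bullet> q)"
proof -
  have *: "(x * exp (- (c *\<^sub>R quat_j))) \<bullet> (y * exp (- (d *\<^sub>R quat_j)))
    = cos (c - d) * (x \<bullet> y) - sin (c - d) * ((x * quat_j) \<bullet> y)" for x y
    unfolding exp_imaginary_unit_minus[OF insertI2[OF singletonI]]
    by (simp add: quat_component_simps cos_diff sin_diff algebra_simps)
  have "(exp (- (a *\<^sub>R quat_i)) * p * quat_j) \<bullet> (exp (- (b *\<^sub>R quat_i)) * q)
     = cos (a - b) * ((p * quat_j) \<bullet> q) - sin (a - b) * ((quat_i * p * quat_j) \<bullet> q)"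
    using inner_exp_mult_exp_mult[of quat_i a "p * quat_j" b q] by (simp add: mult.assoc)
  then show ?thesis
    unfolding * by (simp add: inner_exp_mult_exp_mult algebra_simps)
qed

subsection \<open>Gaussians\<close>

lemma has_bochner_integral_lborel_prod:
  fixes f :: "'a::euclidean_space \<Rightarrow> real \<Rightarrow> 'b::{real_normed_field,banach,second_countable_topology}"
  assumes f: "\<And>b. b \<in> Basis \<Longrightarrow> integrable lborel (f b)"
  shows "has_bochner_integral lborel (\<lambda>x. \<Prod>b\<in>Basis. f b (x \<bullet> b)) (\<Prod>b\<in>Basis. \<integral>x. f b x \<partial>lborel)"
proof -
  interpret product_sigma_finite "\<lambda>_::'a. lborel :: real measure" ..
  have m: "\<And>b. b \<in> Basis \<Longrightarrow> f b \<in> borel_measurable borel"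
    using f by (auto dest: borel_measurable_integrable)
  have [measurable]: "(\<lambda>x. \<Prod>b\<in>Basis. f b (x \<bullet> b)) \<in> borel_measurable borel"
    by (intro borel_measurable_prod measurable_compose[OF _ m]) auto
  have *: "(\<Prod>b\<in>Basis. f b ((\<Sum>b\<in>Basis. \<omega> b *\<^sub>R b) \<bullet> b)) = (\<Prod>b\<in>Basis. f b (\<omega> b))" for \<omega>
    by (intro prod.cong) simp_all
  have [measurable]: "(\<lambda>\<omega>. \<Sum>b\<in>Basis. \<omega> b *\<^sub>R b) \<in> measurable (\<Pi>\<^sub>M b\<in>(Basis::'a set). lborel) borel"
    by measurable
  show ?thesis
    unfolding has_bochner_integral_iff
    by (subst (1 2) lborel_eq, subst integrable_distr_eq, simp, simp, subst integral_distr, simp, simp)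
      (use f in \<open>simp add: * product_integrable_prod product_integral_prod del: inner_sum_left\<close>)
qed

lemma measurable_cis [measurable]: "cis \<in> borel_measurable borel"
  by (intro borel_measurable_continuous_onI continuous_intros)

text \<open>Rescales the characteristic function of the standard normal law, on which all later
  Gaussian integrals rest.\<close>

lemma integral_std_normal_cis:
  "has_bochner_integral lborel (\<lambda>x. complex_of_real (exp (- x\<^sup>2 / 2)) * cis (t * x))
    (sqrt (2 * pi) * exp (- t\<^sup>2 / 2))"
proof -
  have sd: "std_normal_density x * sqrt (2 * pi) = exp (- x\<^sup>2 / 2)" for x
    by (simp add: std_normal_density_def)
  have i: "integrable lborel (\<lambda>x. complex_of_real (std_normal_density x) * cis (t * x))"
    by (rule Bochner_Integration.integrable_bound[OF integrable_normal_density[where \<mu>=0 and \<sigma>=1]])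
      (auto simp: norm_mult)
  have "char std_normal_distribution t = (\<integral>x. std_normal_density x *\<^sub>R cis (t * x) \<partial>lborel)"
    unfolding char_def by (subst integral_density) (auto simp: cis_conv_exp mult_ac)
  then have "(\<integral>x. complex_of_real (std_normal_density x) * cis (t * x) \<partial>lborel) = exp (- t\<^sup>2 / 2)"
    by (simp add: char_std_normal_distribution scaleR_conv_of_real)
  then have "has_bochner_integral lborel (\<lambda>x. complex_of_real (std_normal_density x) * cis (t * x))
      (complex_of_real (exp (- t\<^sup>2 / 2)))"
    using i by (simp add: has_bochner_integral_iff)
  from has_bochner_integral_mult_right[of "complex_of_real (sqrt (2 * pi))", OF this]
  have "has_bochner_integral lborel
      (\<lambda>x. complex_of_real (sqrt (2 * pi)) * (complex_of_real (std_normal_density x) * cis (t * x)))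
      (complex_of_real (sqrt (2 * pi)) * complex_of_real (exp (- t\<^sup>2 / 2)))" .
  moreover have "complex_of_real (sqrt (2 * pi)) * (complex_of_real (std_normal_density x) * cis (t * x))
      = complex_of_real (exp (- x\<^sup>2 / 2)) * cis (t * x)" for x
    unfolding sd[symmetric] of_real_mult by (simp only: mult_ac)
  ultimately show ?thesis
    by (simp only: of_real_mult)
qed

definition gauss :: "real \<Rightarrow> 'a::euclidean_space \<Rightarrow> real"
  where "gauss \<sigma> u = exp (- (norm u)\<^sup>2 / (2 * \<sigma>\<^sup>2))"

text \<open>The unnormalized Fourier transform of \<open>gauss \<sigma>\<close> in closed form, as
  \<open>gauss_cis\<close> confirms: a Gaussian of reciprocal width. As \<sigma> grows,
  \<open>gauss \<sigma>\<close> increases to 1 while this kernel concentrates at the origin.\<close>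

definition gauss_ft :: "real \<Rightarrow> 'a::euclidean_space \<Rightarrow> real"
  where "gauss_ft \<sigma> s = (sqrt (2 * pi) * \<sigma>) ^ DIM('a) * gauss (1 / \<sigma>) s"

lemma gauss_bounds: "0 < gauss \<sigma> u" "gauss \<sigma> u \<le> 1"
  by (simp_all add: gauss_def)

lemma measurable_gauss [measurable]: "gauss \<sigma> \<in> borel_measurable borel"
  unfolding gauss_def[abs_def] by measurable

lemma measurable_gauss_ft [measurable]: "gauss_ft \<sigma> \<in> borel_measurable borel"
  unfolding gauss_ft_def[abs_def] by measurable

lemma gauss_ft_bounds:
  assumes "\<sigma> > 0"
  shows "0 \<le> gauss_ft \<sigma> (s::'a::euclidean_space)" "gauss_ft \<sigma> s \<le> (sqrt (2 * pi) * \<sigma>) ^ DIM('a)"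
  using assms gauss_bounds[of "1/\<sigma>" s] by (auto simp: gauss_ft_def intro: mult_left_le less_imp_le)

lemma gauss_ft_minus: "gauss_ft \<sigma> (- s) = gauss_ft \<sigma> s"
  by (simp add: gauss_ft_def gauss_def)

text \<open>The Gaussian and the character both factor over the coordinates, which leaves the
  one-dimensional integral; there the substitution \<sigma> x leads to the standard normal
  case.\<close>

lemma gauss_cis:
  fixes s :: "'a::euclidean_space"
  assumes \<sigma>: "\<sigma> > 0"
  shows "has_bochner_integral lborel (\<lambda>u. complex_of_real (gauss \<sigma> u) * cis (s \<bullet> u)) (gauss_ft \<sigma> s)"
proof -
  have 1: "has_bochner_integral lborel (\<lambda>x. complex_of_real (exp (- x\<^sup>2 / (2 * \<sigma>\<^sup>2))) * cis (t * x))
    (sqrt (2 * pi) * \<sigma> * exp (- (\<sigma> * t)\<^sup>2 / 2))" for t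
  proof -
    let ?g = "\<lambda>x. complex_of_real (exp (- x\<^sup>2 / (2 * \<sigma>\<^sup>2))) * cis (t * x)"
    have eq: "?g (0 + \<sigma> * x) = complex_of_real (exp (- x\<^sup>2 / 2)) * cis ((\<sigma> * t) * x)" for x
      using \<sigma> by (simp add: power_mult_distrib mult_ac)
    have "integrable lborel (\<lambda>x. ?g (0 + \<sigma> * x)) \<and>
        (\<integral>x. ?g (0 + \<sigma> * x) \<partial>lborel) = sqrt (2 * pi) * exp (- (\<sigma> * t)\<^sup>2 / 2)"
      unfolding eq using integral_std_normal_cis[of "\<sigma> * t"] by (simp only: has_bochner_integral_iff)
    then show ?thesis
      unfolding has_bochner_integral_iff
      using \<sigma> lborel_integrable_real_affine_iff[of \<sigma> ?g 0] lborel_integral_real_affine[of \<sigma> ?g 0]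
      by (simp add: scaleR_conv_of_real)
  qed
  have nsq: "(norm x)\<^sup>2 = (\<Sum>b\<in>Basis. (x \<bullet> b)\<^sup>2)" for x :: 'a
    unfolding power2_norm_eq_inner unfolding power2_eq_square by (rule euclidean_inner)
  have cis_sum: "cis (\<Sum>b\<in>A. h b) = (\<Prod>b\<in>A. cis (h b))" if "finite A" for A :: "'a set" and h
    using that by induction (simp_all add: cis_mult[symmetric])
  have gp: "gauss \<tau> u = (\<Prod>b\<in>Basis. exp (- (u \<bullet> b)\<^sup>2 / (2 * \<tau>\<^sup>2)))" for \<tau> and u :: 'a
    unfolding gauss_def nsq exp_sum[OF finite_Basis, symmetric] sum_divide_distrib[symmetric] sum_negf ..
  have "(\<lambda>u. \<Prod>b\<in>Basis. complex_of_real (exp (- (u \<bullet> b)\<^sup>2 / (2 * \<sigma>\<^sup>2))) * cis ((s \<bullet> b) * (u \<bullet> b)))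
      = (\<lambda>u. complex_of_real (gauss \<sigma> u) * cis (s \<bullet> u))"
    unfolding gp prod.distrib of_real_prod cis_sum[OF finite_Basis, symmetric] euclidean_inner[symmetric] ..
  moreover have "(\<Prod>b\<in>Basis. complex_of_real (sqrt (2 * pi) * \<sigma> * exp (- (\<sigma> * (s \<bullet> b))\<^sup>2 / 2)))
      = complex_of_real (gauss_ft \<sigma> s)"
    unfolding gauss_ft_def gp of_real_prod[symmetric]
    by (simp add: prod.distrib power_mult_distrib power_divide mult_ac)
  ultimately show ?thesis
    using has_bochner_integral_lborel_prod[of "\<lambda>b x. complex_of_real (exp (- x\<^sup>2 / (2 * \<sigma>\<^sup>2))) * cis ((s \<bullet> b) * x)"]
    using 1 by (simp add: has_bochner_integral_iff)
qed

lemma gauss_cos: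
  assumes "\<sigma> > 0"
  shows "has_bochner_integral lborel (\<lambda>u. gauss \<sigma> u * cos (s \<bullet> u)) (gauss_ft \<sigma> s)"
  using has_bochner_integral_bounded_linear[OF bounded_linear_Re gauss_cis[OF assms, of s]] by simp

lemma gauss_sin:
  assumes "\<sigma> > 0"
  shows "has_bochner_integral lborel (\<lambda>u. gauss \<sigma> u * sin (s \<bullet> u)) 0"
  using has_bochner_integral_bounded_linear[OF bounded_linear_Im gauss_cis[OF assms, of s]] by simp

lemma integrable_gauss: "\<sigma> > 0 \<Longrightarrow> integrable lborel (gauss \<sigma> :: 'a::euclidean_space \<Rightarrow> real)"
  using gauss_cos[of \<sigma> "0::'a"] by (simp add: has_bochner_integral_iff)

text \<open>The powers of \<sigma> in the prefactor and in the integral of the narrow Gaussian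
  cancel. That the mass is free of \<sigma> makes the fourth-moment bound uniform and fixes the
  Plancherel constant.\<close>

lemma has_bochner_integral_gauss_ft:
  assumes "\<sigma> > 0"
  shows "has_bochner_integral lborel (gauss_ft \<sigma> :: 'a::euclidean_space \<Rightarrow> real) ((2 * pi) ^ DIM('a))"
proof -
  have "has_bochner_integral lborel (gauss (1 / \<sigma>) :: 'a \<Rightarrow> real) ((sqrt (2 * pi) / \<sigma>) ^ DIM('a))"
    using gauss_cos[of "1 / \<sigma>" "0::'a"] assms by (simp add: gauss_ft_def gauss_def[of _ 0])
  from has_bochner_integral_mult_right[of "(sqrt (2 * pi) * \<sigma>) ^ DIM('a)", OF this]
  have "has_bochner_integral lborel (gauss_ft \<sigma> :: 'a \<Rightarrow> real)
      ((sqrt (2 * pi) * \<sigma>) ^ DIM('a) * (sqrt (2 * pi) / \<sigma>) ^ DIM('a))"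
    unfolding gauss_ft_def[abs_def] .
  also have "(sqrt (2 * pi) * \<sigma>) ^ DIM('a) * (sqrt (2 * pi) / \<sigma>) ^ DIM('a) = (2 * pi) ^ DIM('a)"
    unfolding power_mult_distrib[symmetric] using assms by simp
  finally show ?thesis .
qed

lemma nn_integral_gauss_ft:
  assumes "\<sigma> > 0"
  shows "(\<integral>\<^sup>+s. ennreal (gauss_ft \<sigma> (s::'a::euclidean_space)) \<partial>lborel) = ennreal ((2 * pi) ^ DIM('a))"
  using has_bochner_integral_gauss_ft[OF assms, where 'a='a] gauss_ft_bounds[OF assms, where 'a='a]
  by (simp add: has_bochner_integral_iff nn_integral_eq_integral)

subsection \<open>Integration on Euclidean spaces\<close>

lemma nn_integral_lborel_affine:
  fixes f :: "'a::euclidean_space \<Rightarrow> ennreal"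
  assumes [measurable]: "f \<in> borel_measurable borel" and c: "c \<noteq> 0"
  shows "(\<integral>\<^sup>+x. f x \<partial>lborel) = ennreal (\<bar>c\<bar> ^ DIM('a)) * (\<integral>\<^sup>+x. f (t + c *\<^sub>R x) \<partial>lborel)"
  by (subst lborel_affine[OF c, of t])
     (simp add: nn_integral_density nn_integral_distr nn_integral_cmult)

lemma nn_integral_lborel_translate:
  fixes f :: "'a::euclidean_space \<Rightarrow> ennreal"
  assumes [measurable]: "f \<in> borel_measurable borel"
  shows "(\<integral>\<^sup>+x. f (x + t) \<partial>lborel) = (\<integral>\<^sup>+x. f x \<partial>lborel)" "(\<integral>\<^sup>+x. f (x - t) \<partial>lborel) = (\<integral>\<^sup>+x. f x \<partial>lborel)"
    "(\<integral>\<^sup>+x. f (t - x) \<partial>lborel) = (\<integral>\<^sup>+x. f x \<partial>lborel)"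
  using nn_integral_lborel_affine[of f 1 t] nn_integral_lborel_affine[of f 1 "- t"]
    nn_integral_lborel_affine[of f "-1" t]
  by (simp_all add: add.commute)

lemma measurable_fst_snd_borel [measurable]:
  "fst \<in> measurable (borel :: ('a::second_countable_topology \<times> 'b::second_countable_topology) measure) borel"
  "snd \<in> measurable (borel :: ('a \<times> 'b) measure) borel"
  by (intro borel_measurable_continuous_onI continuous_intros)+

lemma nn_integral_lborel_pair:
  fixes f :: "'a::euclidean_space \<times> 'b::euclidean_space \<Rightarrow> ennreal"
  assumes "f \<in> borel_measurable borel"
  shows "(\<integral>\<^sup>+p. f p \<partial>lborel) = (\<integral>\<^sup>+x. \<integral>\<^sup>+y. f (x, y) \<partial>lborel \<partial>lborel)"
  using assms by (subst lborel.nn_integral_fst) (simp_all add: lborel_prod)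

lemma nn_integral_lborel_swap:
  fixes f :: "'a::euclidean_space \<Rightarrow> 'b::euclidean_space \<Rightarrow> ennreal"
  assumes "(\<lambda>p. f (fst p) (snd p)) \<in> borel_measurable borel"
  shows "(\<integral>\<^sup>+x. \<integral>\<^sup>+y. f x y \<partial>lborel \<partial>lborel) = (\<integral>\<^sup>+y. \<integral>\<^sup>+x. f x y \<partial>lborel \<partial>lborel)"
  by (rule lborel_pair.Fubini'[symmetric]) (use assms in \<open>simp add: lborel_prod split_beta'\<close>)

lemma nn_integral_convolution:
  fixes a b \<Phi> :: "'a::euclidean_space \<Rightarrow> ennreal"
  assumes [measurable]: "a \<in> borel_measurable borel" "b \<in> borel_measurable borel" "\<Phi> \<in> borel_measurable borel"
  shows "(\<integral>\<^sup>+s. \<integral>\<^sup>+t. a s * b t * \<Phi> (s + t) \<partial>lborel \<partial>lborel)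
    = (\<integral>\<^sup>+z. (\<integral>\<^sup>+s. a s * b (z - s) \<partial>lborel) * \<Phi> z \<partial>lborel)"
proof -
  have "(\<integral>\<^sup>+t. a s * b t * \<Phi> (s + t) \<partial>lborel) = (\<integral>\<^sup>+z. a s * b (z - s) * \<Phi> z \<partial>lborel)" for s
    using nn_integral_lborel_translate(2)[of "\<lambda>t. a s * b t * \<Phi> (s + t)" s] by simp
  then have "(\<integral>\<^sup>+s. \<integral>\<^sup>+t. a s * b t * \<Phi> (s + t) \<partial>lborel \<partial>lborel)
      = (\<integral>\<^sup>+s. \<integral>\<^sup>+z. a s * b (z - s) * \<Phi> z \<partial>lborel \<partial>lborel)"
    by simp
  also have "\<dots> = (\<integral>\<^sup>+z. \<integral>\<^sup>+s. a s * b (z - s) * \<Phi> z \<partial>lborel \<partial>lborel)"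
    by (rule nn_integral_lborel_swap) measurable
  finally show ?thesis
    by (simp add: nn_integral_multc)
qed

lemma ennreal_two_mult_le: "2 * x * y \<le> x\<^sup>2 + y\<^sup>2" for x y :: ennreal
proof (cases "x = \<top> \<or> y = \<top>")
  case True
  then show ?thesis by (auto simp: power2_eq_square ennreal_top_mult)
next
  case False
  then obtain a b where "x = ennreal a" "y = ennreal b" "a \<ge> 0" "b \<ge> 0"
    by (metis ennreal_cases)
  then show ?thesis
    using sum_squares_bound[of a b]
    by (simp add: ennreal_mult[symmetric] ennreal_power ennreal_plus[symmetric] ennreal_numeral[symmetric]
        del: ennreal_plus ennreal_numeral)
qed

text \<open>The L^1 case of Young's inequality, with constant 1. Bounding 2 H(z) H(w) by the sum of
  the squares leaves one variable that occurs in G alone, and translation or reflection then yields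
  the same product twice.\<close>

lemma nn_integral_quadratic_form_le:
  fixes G H :: "'a::euclidean_space \<Rightarrow> ennreal"
  assumes [measurable]: "G \<in> borel_measurable borel" "H \<in> borel_measurable borel"
  shows "(\<integral>\<^sup>+z. \<integral>\<^sup>+w. H z * H w * G (z - w) \<partial>lborel \<partial>lborel)
    \<le> (\<integral>\<^sup>+z. G z \<partial>lborel) * (\<integral>\<^sup>+z. (H z)\<^sup>2 \<partial>lborel)"
proof -
  let ?I = "\<integral>\<^sup>+z. \<integral>\<^sup>+w. H z * H w * G (z - w) \<partial>lborel \<partial>lborel"
  have "2 * ?I = (\<integral>\<^sup>+z. \<integral>\<^sup>+w. 2 * H z * H w * G (z - w) \<partial>lborel \<partial>lborel)"
    by (simp add: nn_integral_cmult[symmetric] mult.assoc)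
  also have "\<dots> \<le> (\<integral>\<^sup>+z. \<integral>\<^sup>+w. (H z)\<^sup>2 * G (z - w) + (H w)\<^sup>2 * G (z - w) \<partial>lborel \<partial>lborel)"
    by (intro nn_integral_mono) (use ennreal_two_mult_le in \<open>simp add: distrib_right[symmetric] mult_right_mono\<close>)
  also have "\<dots> = (\<integral>\<^sup>+z. \<integral>\<^sup>+w. (H z)\<^sup>2 * G (z - w) \<partial>lborel \<partial>lborel)
      + (\<integral>\<^sup>+z. \<integral>\<^sup>+w. (H w)\<^sup>2 * G (z - w) \<partial>lborel \<partial>lborel)"
    by (simp add: nn_integral_add)
  also have "(\<integral>\<^sup>+z. \<integral>\<^sup>+w. (H w)\<^sup>2 * G (z - w) \<partial>lborel \<partial>lborel)
      = (\<integral>\<^sup>+w. \<integral>\<^sup>+z. (H w)\<^sup>2 * G (z - w) \<partial>lborel \<partial>lborel)"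
    by (rule nn_integral_lborel_swap) measurable
  also have "\<dots> = (\<integral>\<^sup>+z. G z \<partial>lborel) * (\<integral>\<^sup>+z. (H z)\<^sup>2 \<partial>lborel)"
    by (simp add: nn_integral_cmult nn_integral_multc nn_integral_lborel_translate mult.commute)
  also have "(\<integral>\<^sup>+z. \<integral>\<^sup>+w. (H z)\<^sup>2 * G (z - w) \<partial>lborel \<partial>lborel)
      = (\<integral>\<^sup>+z. G z \<partial>lborel) * (\<integral>\<^sup>+z. (H z)\<^sup>2 \<partial>lborel)"
    by (simp add: nn_integral_cmult nn_integral_multc nn_integral_lborel_translate mult.commute)
  finally have "2 * ?I \<le> 2 * ((\<integral>\<^sup>+z. G z \<partial>lborel) * (\<integral>\<^sup>+z. (H z)\<^sup>2 \<partial>lborel))"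
    by (simp add: mult_2)
  then show ?thesis
    by (subst (asm) ennreal_mult_le_mult_iff) auto
qed

text \<open>Turns the squared norm of an integral into a double integral of inner products, the
  substitute for multiplying a complex transform by its conjugate.\<close>

lemma (in pair_sigma_finite) integral_inner_product:
  fixes F :: "_ \<Rightarrow> 'c::euclidean_space" and G :: "_ \<Rightarrow> 'c"
  assumes F: "integrable M1 F" and G: "integrable M2 G"
  shows "has_bochner_integral (M1 \<Otimes>\<^sub>M M2) (\<lambda>(x, y). F x \<bullet> G y) ((\<integral>x. F x \<partial>M1) \<bullet> (\<integral>y. G y \<partial>M2))"
proof -
  note [measurable] = borel_measurable_integrable[OF F] borel_measurable_integrable[OF G]
  have "integrable (M1 \<Otimes>\<^sub>M M2) (\<lambda>(x, y). F x \<bullet> G y)"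
  proof (rule Fubini_integrable)
    have "integrable M1 (\<lambda>x. norm (F x) * (\<integral>y. norm (G y) \<partial>M2))"
      using F by simp
    then show "integrable M1 (\<lambda>x. \<integral>y. norm (case (x, y) of (x, y) \<Rightarrow> F x \<bullet> G y) \<partial>M2)"
    proof (rule Bochner_Integration.integrable_bound, measurable, intro AE_I2)
      fix x
      have "(\<integral>y. \<bar>F x \<bullet> G y\<bar> \<partial>M2) \<le> (\<integral>y. norm (F x) * norm (G y) \<partial>M2)"
        using G by (intro integral_mono) (auto intro: Cauchy_Schwarz_ineq2)
      then show "norm (\<integral>y. norm (case (x, y) of (x, y) \<Rightarrow> F x \<bullet> G y) \<partial>M2) \<le> norm (norm (F x) * (\<integral>y. norm (G y) \<partial>M2))"
        by simp
    qed
  qed (use G in auto)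
  moreover from this have "(\<integral>p. (case p of (x, y) \<Rightarrow> F x \<bullet> G y) \<partial>(M1 \<Otimes>\<^sub>M M2)) = (\<integral>x. F x \<bullet> (\<integral>y. G y \<partial>M2) \<partial>M1)"
    using G by (simp add: integral_fst'[symmetric])
  ultimately show ?thesis
    using F by (simp add: has_bochner_integral_iff)
qed

lemma lborel_inner_product:
  fixes F :: "'a::euclidean_space \<Rightarrow> 'c::euclidean_space" and G :: "'b::euclidean_space \<Rightarrow> 'c"
  assumes F: "integrable lborel F" and G: "integrable lborel G"
  shows "integrable lborel (\<lambda>p. F (fst p) \<bullet> G (snd p))"
    "(\<integral>p. F (fst p) \<bullet> G (snd p) \<partial>lborel) = (\<integral>x. F x \<partial>lborel) \<bullet> (\<integral>y. G y \<partial>lborel)"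
  using lborel_pair.integral_inner_product[OF F G]
  by (simp_all add: has_bochner_integral_iff lborel_prod split_beta')

lemma lborel_mult_product:
  fixes F :: "'a::euclidean_space \<Rightarrow> real" and G :: "'b::euclidean_space \<Rightarrow> real"
  assumes F: "integrable lborel F" and G: "integrable lborel G"
  shows "integrable lborel (\<lambda>p. F (fst p) * G (snd p))"
    "(\<integral>p. F (fst p) * G (snd p) \<partial>lborel) = (\<integral>x. F x \<partial>lborel) * (\<integral>y. G y \<partial>lborel)"
  using lborel_inner_product[OF assms] by simp_all

text \<open>The damping factors increase to 1, so monotone convergence applies and covers an
  infinite limit as well.\<close>

lemma nn_integral_gauss_tendsto:
  fixes F :: "'a::euclidean_space \<Rightarrow> ennreal"
  assumes [measurable]: "F \<in> borel_measurable borel"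
  shows "(\<lambda>n. \<integral>\<^sup>+u. ennreal (gauss (real (Suc n)) u) * F u \<partial>lborel) \<longlonglongrightarrow> (\<integral>\<^sup>+u. F u \<partial>lborel)"
proof (rule nn_integral_LIMSEQ)
  show "incseq (\<lambda>n u. ennreal (gauss (real (Suc n)) u) * F u)"
    by (intro incseq_SucI le_funI mult_right_mono ennreal_leI)
      (auto simp: gauss_def intro!: divide_left_mono power_mono)
  show "(\<lambda>n. ennreal (gauss (real (Suc n)) u) * F u) \<longlonglongrightarrow> F u" for u
  proof -
    have "(\<lambda>n. gauss (real (Suc n)) u) \<longlonglongrightarrow> exp (- 0)"
      unfolding gauss_def minus_divide_left[symmetric]
      by (intro tendsto_intros) real_asymp
    then have "(\<lambda>n. ennreal (gauss (real (Suc n)) u) * F u) \<longlonglongrightarrow> ennreal 1 * F u"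
      by (intro tendsto_mult_ennreal tendsto_ennrealI tendsto_const) auto
    then show ?thesis by simp
  qed
qed simp

subsection \<open>The fourth moment of a one-sided quaternion Fourier transform\<close>

text \<open>The unit is a parameter because one estimate serves both stages: \<iota> = i in the
  first variable and, after conjugation, \<iota> = j in the second.\<close>

definition left_ft :: "quat \<Rightarrow> ('a::euclidean_space \<Rightarrow> quat) \<Rightarrow> 'a \<Rightarrow> quat"
  where "left_ft \<iota> h u = (\<integral>s. exp (- ((s \<bullet> u) *\<^sub>R \<iota>)) * h s \<partial>lborel)"

lemma imaginary_unit_simps:
  assumes "\<iota> \<in> {quat_i, quat_j}"
  shows norm_exp_imaginary_unit': "norm (exp (- (t *\<^sub>R \<iota>))) = 1"
    and measurable_exp_imaginary': "f \<in> borel_measurable M \<Longrightarrow> (\<lambda>x. exp (- (f x *\<^sub>R \<iota>))) \<in> borel_measurable M"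
  using assms by auto

text \<open>In the application \<open>n\<close> is |h| and \<open>G\<close> is the kernel
  \<open>gauss_ft \<sigma>\<close>. Written as (s + t) - (s' + t'), the argument of \<open>G\<close>
  depends on two sums only, so the fourfold integral is a quadratic form in the convolution square
  \<open>H\<close>.\<close>

lemma nn_integral_four_fold_le:
  fixes n :: "'a::euclidean_space \<Rightarrow> ennreal" and G :: "'a \<Rightarrow> ennreal"
  assumes [measurable]: "n \<in> borel_measurable borel" "G \<in> borel_measurable borel"
    and sym: "\<And>x. G (- x) = G x"
  shows "(\<integral>\<^sup>+r. n (fst (fst r)) * n (snd (fst r)) * (n (fst (snd r)) * n (snd (snd r))) *
        (G ((fst (fst r) - snd (fst r)) + (fst (snd r) - snd (snd r))) +
         G ((fst (fst r) - snd (fst r)) - (fst (snd r) - snd (snd r)))) \<partial>lborel)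
    \<le> 2 * (\<integral>\<^sup>+z. G z \<partial>lborel) * (\<integral>\<^sup>+z. (\<integral>\<^sup>+s. n s * n (z - s) \<partial>lborel)\<^sup>2 \<partial>lborel)"
proof -
  define H where "H z = (\<integral>\<^sup>+s. n s * n (z - s) \<partial>lborel)" for z
  have [measurable]: "H \<in> borel_measurable borel"
    unfolding H_def[abs_def] by measurable
  define X where "X = (\<integral>\<^sup>+s. \<integral>\<^sup>+s'. \<integral>\<^sup>+t. \<integral>\<^sup>+t'. n s * n s' * (n t * n t') * G ((s - s') + (t - t')) \<partial>lborel \<partial>lborel \<partial>lborel \<partial>lborel)"
  have X: "X \<le> (\<integral>\<^sup>+z. G z \<partial>lborel) * (\<integral>\<^sup>+z. (H z)\<^sup>2 \<partial>lborel)"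
  proof -
    have "X = (\<integral>\<^sup>+s. \<integral>\<^sup>+t. \<integral>\<^sup>+s'. \<integral>\<^sup>+t'. n s * n s' * (n t * n t') * G ((s - s') + (t - t')) \<partial>lborel \<partial>lborel \<partial>lborel \<partial>lborel)"
      unfolding X_def by (intro nn_integral_cong nn_integral_lborel_swap) measurable
    also have "\<dots> = (\<integral>\<^sup>+s. \<integral>\<^sup>+t. n s * n t * (\<integral>\<^sup>+s'. \<integral>\<^sup>+t'. n s' * n t' * G ((s + t) - (s' + t')) \<partial>lborel \<partial>lborel) \<partial>lborel \<partial>lborel)"
      by (simp add: nn_integral_cmult[symmetric] mult_ac diff_add_eq add_diff_eq diff_diff_add add_ac)
    also have "\<dots> = (\<integral>\<^sup>+s. \<integral>\<^sup>+t. n s * n t * (\<integral>\<^sup>+w. H w * G ((s + t) - w) \<partial>lborel) \<partial>lborel \<partial>lborel)"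
      unfolding H_def by (intro nn_integral_cong arg_cong2[where f="(*)"] refl
          nn_integral_convolution[where \<Phi>="\<lambda>z. G (_ - z)"]) measurable
    also have "\<dots> = (\<integral>\<^sup>+z. H z * (\<integral>\<^sup>+w. H w * G (z - w) \<partial>lborel) \<partial>lborel)"
      unfolding H_def by (intro nn_integral_convolution) measurable
    also have "\<dots> = (\<integral>\<^sup>+z. \<integral>\<^sup>+w. H z * H w * G (z - w) \<partial>lborel \<partial>lborel)"
      by (simp add: nn_integral_cmult[symmetric] mult_ac)
    also have "\<dots> \<le> (\<integral>\<^sup>+z. G z \<partial>lborel) * (\<integral>\<^sup>+z. (H z)\<^sup>2 \<partial>lborel)"
      by (rule nn_integral_quadratic_form_le) measurable
    finally show ?thesis .
  qed
  \<comment> \<open>Interchanging the names t and t' flips the sign of t - t', so the difference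
    term equals the sum term.\<close>
  have Y: "(\<integral>\<^sup>+s. \<integral>\<^sup>+s'. \<integral>\<^sup>+t. \<integral>\<^sup>+t'. n s * n s' * (n t * n t') * G ((s - s') - (t - t')) \<partial>lborel \<partial>lborel \<partial>lborel \<partial>lborel) = X"
  proof -
    have "(\<integral>\<^sup>+t. \<integral>\<^sup>+t'. n s * n s' * (n t * n t') * G ((s - s') - (t - t')) \<partial>lborel \<partial>lborel)
       = (\<integral>\<^sup>+t'. \<integral>\<^sup>+t. n s * n s' * (n t * n t') * G ((s - s') - (t - t')) \<partial>lborel \<partial>lborel)" for s s'
      by (rule nn_integral_lborel_swap) measurable
    then show ?thesis
      unfolding X_def by (simp add: mult_ac diff_diff_eq2 add_diff_eq)
  qed
  have "(\<integral>\<^sup>+r. n (fst (fst r)) * n (snd (fst r)) * (n (fst (snd r)) * n (snd (snd r))) *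
        (G ((fst (fst r) - snd (fst r)) + (fst (snd r) - snd (snd r))) +
         G ((fst (fst r) - snd (fst r)) - (fst (snd r) - snd (snd r)))) \<partial>lborel)
     = (\<integral>\<^sup>+r. n (fst (fst r)) * n (snd (fst r)) * (n (fst (snd r)) * n (snd (snd r))) *
          G ((fst (fst r) - snd (fst r)) + (fst (snd r) - snd (snd r))) \<partial>lborel)
     + (\<integral>\<^sup>+r. n (fst (fst r)) * n (snd (fst r)) * (n (fst (snd r)) * n (snd (snd r))) *
          G ((fst (fst r) - snd (fst r)) - (fst (snd r) - snd (snd r))) \<partial>lborel)"
    unfolding distrib_left by (rule nn_integral_add) measurable
  also have "\<dots> = X + X"
    by (simp add: nn_integral_lborel_pair Y) (simp add: X_def)
  finally show ?thesis
    using add_mono[OF X X] by (simp add: H_def mult_2[symmetric] mult.assoc)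
qed

text \<open>The product-to-sum formulas leave cosines at A + B and A - B, while the sines integrate
  to 0. The two cosine coefficients are at most M M' / 2 by Cauchy-Schwarz, and the bound survives
  multiplication by \<open>gauss_ft\<close> because that kernel is nonnegative.\<close>

lemma integral_gauss_trig_product_le:
  fixes A B :: "'a::euclidean_space"
  assumes \<sigma>: "\<sigma> > 0" and ab: "\<alpha>\<^sup>2 + \<beta>\<^sup>2 \<le> M\<^sup>2" and ab': "\<alpha>'\<^sup>2 + \<beta>'\<^sup>2 \<le> M'\<^sup>2" and M: "0 \<le> M" "0 \<le> M'"
  shows "(\<integral>u. gauss \<sigma> u * ((cos (A \<bullet> u) * \<alpha> - sin (A \<bullet> u) * \<beta>) * (cos (B \<bullet> u) * \<alpha>' - sin (B \<bullet> u) * \<beta>')) \<partial>lborel)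
    \<le> (M * M' / 2) * (gauss_ft \<sigma> (A + B) + gauss_ft \<sigma> (A - B))"
proof -
  have prod: "(cos x * \<alpha> - sin x * \<beta>) * (cos y * \<alpha>' - sin y * \<beta>') =
     cos (x + y) * ((\<alpha> * \<alpha>' - \<beta> * \<beta>') / 2) + cos (x - y) * ((\<alpha> * \<alpha>' + \<beta> * \<beta>') / 2)
     - sin (x + y) * ((\<alpha> * \<beta>' + \<beta> * \<alpha>') / 2) - sin (x - y) * ((\<beta> * \<alpha>' - \<alpha> * \<beta>') / 2)" for x y
    by (simp add: cos_add cos_diff sin_add sin_diff field_simps)
  have "(\<integral>u. gauss \<sigma> u * ((cos (A \<bullet> u) * \<alpha> - sin (A \<bullet> u) * \<beta>) * (cos (B \<bullet> u) * \<alpha>' - sin (B \<bullet> u) * \<beta>')) \<partial>lborel)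
    = gauss_ft \<sigma> (A + B) * ((\<alpha> * \<alpha>' - \<beta> * \<beta>') / 2) + gauss_ft \<sigma> (A - B) * ((\<alpha> * \<alpha>' + \<beta> * \<beta>') / 2)
      - 0 * ((\<alpha> * \<beta>' + \<beta> * \<alpha>') / 2) - 0 * ((\<beta> * \<alpha>' - \<alpha> * \<beta>') / 2)"
  proof (rule has_bochner_integral_integral_eq, rule has_bochner_integral_cong[OF refl _ refl, THEN iffD1])
    show "has_bochner_integral lborel (\<lambda>u. gauss \<sigma> u * cos ((A + B) \<bullet> u) * ((\<alpha> * \<alpha>' - \<beta> * \<beta>') / 2)
        + gauss \<sigma> u * cos ((A - B) \<bullet> u) * ((\<alpha> * \<alpha>' + \<beta> * \<beta>') / 2)
        - gauss \<sigma> u * sin ((A + B) \<bullet> u) * ((\<alpha> * \<beta>' + \<beta> * \<alpha>') / 2)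
        - gauss \<sigma> u * sin ((A - B) \<bullet> u) * ((\<beta> * \<alpha>' - \<alpha> * \<beta>') / 2))
      (gauss_ft \<sigma> (A + B) * ((\<alpha> * \<alpha>' - \<beta> * \<beta>') / 2) + gauss_ft \<sigma> (A - B) * ((\<alpha> * \<alpha>' + \<beta> * \<beta>') / 2)
        - 0 * ((\<alpha> * \<beta>' + \<beta> * \<alpha>') / 2) - 0 * ((\<beta> * \<alpha>' - \<alpha> * \<beta>') / 2))"
      by (intro has_bochner_integral_add has_bochner_integral_diff has_bochner_integral_mult_left
          gauss_cos gauss_sin \<sigma>)
  qed (simp only: prod inner_add_left inner_diff_left, simp only: right_diff_distrib distrib_left mult.assoc)
  moreover have "(\<alpha> * \<alpha>' + \<beta> * \<beta>')\<^sup>2 \<le> (M * M')\<^sup>2" "(\<alpha> * \<alpha>' - \<beta> * \<beta>')\<^sup>2 \<le> (M * M')\<^sup>2"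
  proof -
    have "(\<alpha>\<^sup>2 + \<beta>\<^sup>2) * (\<alpha>'\<^sup>2 + \<beta>'\<^sup>2) \<le> M\<^sup>2 * M'\<^sup>2"
      using ab ab' by (intro mult_mono) auto
    \<comment> \<open>The two-squares identity, in both sign patterns, is Cauchy-Schwarz for each of
      the two coefficients.\<close>
    moreover have "(\<alpha>\<^sup>2 + \<beta>\<^sup>2) * (\<alpha>'\<^sup>2 + \<beta>'\<^sup>2) = (\<alpha> * \<alpha>' + \<beta> * \<beta>')\<^sup>2 + (\<alpha> * \<beta>' - \<beta> * \<alpha>')\<^sup>2"
      "(\<alpha>\<^sup>2 + \<beta>\<^sup>2) * (\<alpha>'\<^sup>2 + \<beta>'\<^sup>2) = (\<alpha> * \<alpha>' - \<beta> * \<beta>')\<^sup>2 + (\<alpha> * \<beta>' + \<beta> * \<alpha>')\<^sup>2"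
      by algebra+
    ultimately show "(\<alpha> * \<alpha>' + \<beta> * \<beta>')\<^sup>2 \<le> (M * M')\<^sup>2" "(\<alpha> * \<alpha>' - \<beta> * \<beta>')\<^sup>2 \<le> (M * M')\<^sup>2"
      unfolding power_mult_distrib[of M] by (smt (verit) zero_le_power2)+
  qed
  then have "\<alpha> * \<alpha>' + \<beta> * \<beta>' \<le> M * M'" "\<alpha> * \<alpha>' - \<beta> * \<beta>' \<le> M * M'"
    using M by (auto intro: power2_le_imp_le)
  then have "gauss_ft \<sigma> (A + B) * ((\<alpha> * \<alpha>' - \<beta> * \<beta>') / 2) + gauss_ft \<sigma> (A - B) * ((\<alpha> * \<alpha>' + \<beta> * \<beta>') / 2)
      \<le> gauss_ft \<sigma> (A + B) * ((M * M') / 2) + gauss_ft \<sigma> (A - B) * ((M * M') / 2)"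
    using gauss_ft_bounds(1)[OF \<sigma>, where 'a='a] by (intro add_mono mult_left_mono) auto
  ultimately show ?thesis
    by (simp add: field_simps)
qed

text \<open>The fourth power of the transform is a fourfold integral in which u enters through
  phases only. The Gaussian makes it absolutely convergent jointly with u, so the integral over u
  can be done first. The right side is free of \<sigma> because the mass of the resulting kernel
  is.\<close>

lemma left_ft_gauss_fourth_moment_le:
  fixes h :: "'a::euclidean_space \<Rightarrow> quat"
  assumes h: "integrable lborel h" and \<iota>: "\<iota> \<in> {quat_i, quat_j}" and \<sigma>: "\<sigma> > 0"
  shows "(\<integral>\<^sup>+u. ennreal (gauss \<sigma> u) * ennreal ((norm (left_ft \<iota> h u)) ^ 4) \<partial>lborel)
    \<le> ennreal ((2 * pi) ^ DIM('a)) *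
      (\<integral>\<^sup>+z. (\<integral>\<^sup>+s. ennreal (norm (h s)) * ennreal (norm (h (z - s))) \<partial>lborel)\<^sup>2 \<partial>lborel)"
proof -
  have [measurable]: "h \<in> borel_measurable borel"
    using borel_measurable_integrable[OF h] by simp
  note [measurable (raw)] = measurable_exp_imaginary'[OF \<iota>]
  define F where "F u s = exp (- ((s \<bullet> u) *\<^sub>R \<iota>)) * h s" for u s
  have F: "integrable lborel (F u)" for u
    using h unfolding F_def
    by (rule Bochner_Integration.integrable_bound) (simp_all add: norm_mult norm_exp_imaginary_unit'[OF \<iota>])
  define c where "c u p = F u (fst p) \<bullet> F u (snd p)" for u and p :: "'a \<times> 'a"
  define N where "N p = norm (h (fst p)) * norm (h (snd p))" for p :: "'a \<times> 'a"
  define R where "R r = N (fst r) * N (snd r)" for r :: "('a \<times> 'a) \<times> ('a \<times> 'a)"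
  have [measurable]: "(\<lambda>q. c (fst q) (snd q)) \<in> borel_measurable borel" "N \<in> borel_measurable borel"
    "R \<in> borel_measurable borel"
    unfolding c_def F_def R_def[abs_def] N_def[abs_def] by measurable
  have [measurable]: "(\<lambda>q :: 'a \<times> ('a \<times> 'a) \<times> ('a \<times> 'a). c (fst q) (fst (snd q))) \<in> borel_measurable borel" "(\<lambda>q :: 'a \<times> ('a \<times> 'a) \<times> ('a \<times> 'a). c (fst q) (snd (snd q))) \<in> borel_measurable borel"
    unfolding c_def F_def by measurable
  have R0: "0 \<le> R r" for r
    by (simp add: R_def N_def)
  have c_le: "\<bar>c u p\<bar> \<le> N p" for u p
    using Cauchy_Schwarz_ineq2[of "F u (fst p)" "F u (snd p)"]
    by (simp add: c_def N_def F_def norm_mult norm_exp_imaginary_unit'[OF \<iota>])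
  have c_int: "integrable lborel (c u)" "(\<integral>p. c u p \<partial>lborel) = (norm (left_ft \<iota> h u))\<^sup>2" for u
    unfolding c_def[abs_def] using lborel_inner_product[OF F F, of u u]
    by (simp_all add: left_ft_def F_def power2_norm_eq_inner)
  have four: "(norm (left_ft \<iota> h u)) ^ 4 = (\<integral>r. c u (fst r) * c u (snd r) \<partial>lborel)" for u
    using lborel_mult_product(2)[OF c_int(1) c_int(1), of u u]
    by (simp add: c_int(2) power_mult[of _ 2 2, simplified] power2_eq_square[of "(norm _)\<^sup>2"])
  have "integrable lborel N"
    unfolding N_def[abs_def] using h by (intro lborel_mult_product) auto
  then have R_int: "integrable lborel R"
    unfolding R_def[abs_def] by (intro lborel_mult_product) auto
  \<comment> \<open>Without the factor \<open>gauss \<sigma>\<close> the majorant \<open>R\<close>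
    would not decay in u, and the exchange of integrals would lack a justification.\<close>
  have K: "integrable lborel (\<lambda>q. gauss \<sigma> (fst q) * (c (fst q) (fst (snd q)) * c (fst q) (snd (snd q))))"
  proof (rule Bochner_Integration.integrable_bound)
    show "integrable lborel (\<lambda>q::'a \<times> ('a \<times> 'a) \<times> ('a \<times> 'a). gauss \<sigma> (fst q) * R (snd q))"
      by (intro lborel_mult_product integrable_gauss \<sigma> R_int)
    show "AE q in lborel. norm (gauss \<sigma> (fst q) * (c (fst q) (fst (snd q)) * c (fst q) (snd (snd q))))
        \<le> norm (gauss \<sigma> (fst q) * R (snd q))"
    proof (intro AE_I2)
      fix q :: "'a \<times> ('a \<times> 'a) \<times> ('a \<times> 'a)"
      have "\<bar>c (fst q) (fst (snd q))\<bar> * \<bar>c (fst q) (snd (snd q))\<bar> \<le> R (snd q)"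
        unfolding R_def by (intro mult_mono c_le) (auto simp: N_def)
      then show "norm (gauss \<sigma> (fst q) * (c (fst q) (fst (snd q)) * c (fst q) (snd (snd q))))
        \<le> norm (gauss \<sigma> (fst q) * R (snd q))"
        using gauss_bounds(1)[of \<sigma> "fst q"] R0[of "snd q"] by (simp add: abs_mult)
    qed
  qed measurable
  have K': "integrable (lborel \<Otimes>\<^sub>M lborel) (\<lambda>(u, r). gauss \<sigma> u * (c u (fst r) * c u (snd r)))"
    using K by (simp add: lborel_prod split_beta')
  define D where "D r = fst r - snd r" for r :: "'a \<times> 'a"
  define \<Gamma> where "\<Gamma> r = gauss_ft \<sigma> (D (fst r) + D (snd r)) + gauss_ft \<sigma> (D (fst r) - D (snd r))" for r
  have [measurable]: "D \<in> borel_measurable borel" "\<Gamma> \<in> borel_measurable borel"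
    unfolding \<Gamma>_def[abs_def] D_def[abs_def] by measurable
  have \<Gamma>0: "0 \<le> \<Gamma> r" for r
    unfolding \<Gamma>_def by (intro add_nonneg_nonneg gauss_ft_bounds(1)[OF \<sigma>])
  have inner_le: "(\<integral>u. gauss \<sigma> u * (c u (fst r) * c u (snd r)) \<partial>lborel) \<le> R r / 2 * \<Gamma> r" for r
  proof -
    have "c u p = cos (D p \<bullet> u) * (h (fst p) \<bullet> h (snd p)) - sin (D p \<bullet> u) * ((\<iota> * h (fst p)) \<bullet> h (snd p))" for u p
      unfolding c_def F_def inner_exp_mult_exp_mult[OF \<iota>] D_def inner_diff_left ..
    then show ?thesis
      unfolding \<Gamma>_def R_def
      by (simp only:) (intro integral_gauss_trig_product_le \<sigma>, auto simp: N_def intro!: inner_power2_add_inner_unit_power2_le[OF \<iota>])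
  qed
  have RG_int: "integrable lborel (\<lambda>r. R r / 2 * \<Gamma> r)"
  proof (rule Bochner_Integration.integrable_bound)
    show "integrable lborel (\<lambda>r. R r * (sqrt (2 * pi) * \<sigma>) ^ DIM('a))"
      using R_int by simp
    show "AE r in lborel. norm (R r / 2 * \<Gamma> r) \<le> norm (R r * (sqrt (2 * pi) * \<sigma>) ^ DIM('a))"
    proof (intro AE_I2)
      fix r
      have "\<Gamma> r / 2 \<le> (sqrt (2 * pi) * \<sigma>) ^ DIM('a)"
        using gauss_ft_bounds(2)[OF \<sigma>, of "D (fst r) + D (snd r)"] gauss_ft_bounds(2)[OF \<sigma>, of "D (fst r) - D (snd r)"]
        by (simp add: \<Gamma>_def)
      then show "norm (R r / 2 * \<Gamma> r) \<le> norm (R r * (sqrt (2 * pi) * \<sigma>) ^ DIM('a))"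
        using R0[of r] \<Gamma>0[of r] \<sigma> mult_left_mono[of "\<Gamma> r / 2" "(sqrt (2 * pi) * \<sigma>) ^ DIM('a)" "R r"] by simp
    qed
  qed measurable
  have "(\<integral>u. gauss \<sigma> u * (norm (left_ft \<iota> h u)) ^ 4 \<partial>lborel)
      = (\<integral>u. \<integral>r. gauss \<sigma> u * (c u (fst r) * c u (snd r)) \<partial>lborel \<partial>lborel)"
    by (simp add: four)
  also have "\<dots> = (\<integral>r. \<integral>u. gauss \<sigma> u * (c u (fst r) * c u (snd r)) \<partial>lborel \<partial>lborel)"
    using lborel_pair.Fubini_integral[OF K'] by simp
  also have "\<dots> \<le> (\<integral>r. R r / 2 * \<Gamma> r \<partial>lborel)"
    using lborel_pair.integrable_snd[OF K'] RG_int by (intro integral_mono inner_le) auto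
  finally have real_le: "(\<integral>u. gauss \<sigma> u * (norm (left_ft \<iota> h u)) ^ 4 \<partial>lborel) \<le> (\<integral>r. R r / 2 * \<Gamma> r \<partial>lborel)" .
  have "integrable lborel (\<lambda>u. gauss \<sigma> u * (norm (left_ft \<iota> h u)) ^ 4)"
    using lborel_pair.integrable_fst[OF K'] by (simp add: four)
  then have "(\<integral>\<^sup>+u. ennreal (gauss \<sigma> u) * ennreal ((norm (left_ft \<iota> h u)) ^ 4) \<partial>lborel)
      = ennreal (\<integral>u. gauss \<sigma> u * (norm (left_ft \<iota> h u)) ^ 4 \<partial>lborel)"
    using gauss_bounds(1)[THEN less_imp_le]
    by (subst nn_integral_eq_integral[symmetric]) (auto simp: ennreal_mult'' intro!: AE_I2 mult_nonneg_nonneg)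
  also have "\<dots> \<le> ennreal (\<integral>r. R r / 2 * \<Gamma> r \<partial>lborel)"
    by (intro ennreal_leI real_le)
  also have "\<dots> = (\<integral>\<^sup>+r. ennreal (R r / 2 * \<Gamma> r) \<partial>lborel)"
    using RG_int R0 \<Gamma>0 by (intro nn_integral_eq_integral[symmetric]) auto
  finally have le: "(\<integral>\<^sup>+u. ennreal (gauss \<sigma> u) * ennreal ((norm (left_ft \<iota> h u)) ^ 4) \<partial>lborel)
      \<le> (\<integral>\<^sup>+r. ennreal (R r / 2 * \<Gamma> r) \<partial>lborel)" .
  let ?n = "\<lambda>s. ennreal (norm (h s))" and ?G = "\<lambda>s::'a. ennreal (gauss_ft \<sigma> s)"
  \<comment> \<open>The half from the product-to-sum formulas is balanced by the two kernel terms in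
    \<open>\<Gamma>\<close>, so no numerical factor remains.\<close>
  have "2 * (\<integral>\<^sup>+r. ennreal (R r / 2 * \<Gamma> r) \<partial>lborel) = (\<integral>\<^sup>+r. ennreal (R r * \<Gamma> r) \<partial>lborel)"
    using R0 \<Gamma>0 by (simp add: nn_integral_cmult[symmetric] ennreal_mult[symmetric] ennreal_numeral[symmetric] del: ennreal_numeral)
  also have "\<dots> = (\<integral>\<^sup>+r. ?n (fst (fst r)) * ?n (snd (fst r)) * (?n (fst (snd r)) * ?n (snd (snd r))) *
        (?G ((fst (fst r) - snd (fst r)) + (fst (snd r) - snd (snd r))) +
         ?G ((fst (fst r) - snd (fst r)) - (fst (snd r) - snd (snd r)))) \<partial>lborel)"
    using R0 \<Gamma>0 gauss_ft_bounds(1)[OF \<sigma>, where 'a='a]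
    by (simp add: R_def N_def \<Gamma>_def D_def ennreal_mult)
  also have "\<dots> \<le> 2 * (\<integral>\<^sup>+z. ?G z \<partial>lborel) * (\<integral>\<^sup>+z. (\<integral>\<^sup>+s. ?n s * ?n (z - s) \<partial>lborel)\<^sup>2 \<partial>lborel)"
    by (rule nn_integral_four_fold_le[of ?n ?G]) (simp_all add: gauss_ft_minus)
  finally have "(\<integral>\<^sup>+r. ennreal (R r / 2 * \<Gamma> r) \<partial>lborel)
      \<le> (\<integral>\<^sup>+z. ?G z \<partial>lborel) * (\<integral>\<^sup>+z. (\<integral>\<^sup>+s. ?n s * ?n (z - s) \<partial>lborel)\<^sup>2 \<partial>lborel)"
    unfolding mult.assoc by (subst (asm) ennreal_mult_le_mult_iff) auto
  with le show ?thesis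
    by (simp add: nn_integral_gauss_ft[OF \<sigma>])
qed

text \<open>The Gaussian bound is uniform in \<sigma>, so the damping can be removed. Non-integrable
  h is included because the later applications take slices that need not be integrable for every
  value of the parameters.\<close>

lemma left_ft_fourth_moment_le:
  fixes h :: "'a::euclidean_space \<Rightarrow> quat"
  assumes [measurable]: "h \<in> borel_measurable borel" and \<iota>: "\<iota> \<in> {quat_i, quat_j}"
  shows "(\<integral>\<^sup>+u. ennreal ((norm (left_ft \<iota> h u)) ^ 4) \<partial>lborel)
    \<le> ennreal ((2 * pi) ^ DIM('a)) *
      (\<integral>\<^sup>+z. (\<integral>\<^sup>+s. ennreal (norm (h s)) * ennreal (norm (h (z - s))) \<partial>lborel)\<^sup>2 \<partial>lborel)"
proof (cases "integrable lborel h")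
  case True
  note [measurable (raw)] = measurable_exp_imaginary'[OF \<iota>]
  have [measurable]: "left_ft \<iota> h \<in> borel_measurable borel"
    unfolding left_ft_def[abs_def] by measurable
  show ?thesis
    by (rule LIMSEQ_le_const2[OF nn_integral_gauss_tendsto])
      (use left_ft_gauss_fourth_moment_le[OF True \<iota>] in \<open>auto simp del: of_nat_Suc\<close>)
next
  case False
  note [measurable (raw)] = measurable_exp_imaginary'[OF \<iota>]
  \<comment> \<open>A phase does not change norms, so the integrand is integrable at no frequency.
    Then \<open>left_ft\<close> is 0 everywhere by the default value of the integral, and the bound
    is trivial.\<close>
  have "\<not> integrable lborel (\<lambda>s. exp (- ((s \<bullet> u) *\<^sub>R \<iota>)) * h s)" for u
  proof
    assume "integrable lborel (\<lambda>s. exp (- ((s \<bullet> u) *\<^sub>R \<iota>)) * h s)"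
    then have "integrable lborel h"
      by (rule Bochner_Integration.integrable_bound) (simp_all add: norm_mult norm_exp_imaginary_unit'[OF \<iota>])
    with False show False by simp
  qed
  then show ?thesis
    by (simp add: left_ft_def not_integrable_integral_eq)
qed

subsection \<open>The fourth moment of the windowed transform\<close>

lemma ennreal_power2_le_imp_le: "x \<le> y" if "x\<^sup>2 \<le> y\<^sup>2" for x y :: ennreal
proof (rule ccontr)
  assume "\<not> x \<le> y"
  then have "y < x" by simp
  then obtain b where b: "y = ennreal b" "b \<ge> 0"
    by (cases y) auto
  show False
  proof (cases x)
    case (real a)
    then have "a \<le> b"
      using that b by (intro power2_le_imp_le[of a b]) (simp_all add: ennreal_power)
    with real b \<open>y < x\<close> show False
      by (simp add: ennreal_leI leD)
  next
    case top
    with that b show False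
      by (simp add: ennreal_power top_unique)
  qed
qed

lemma nn_integral_power2:
  fixes F :: "'a::euclidean_space \<Rightarrow> ennreal"
  assumes [measurable]: "F \<in> borel_measurable borel"
  shows "(\<integral>\<^sup>+x. F x \<partial>lborel)\<^sup>2 = (\<integral>\<^sup>+x. \<integral>\<^sup>+y. F x * F y \<partial>lborel \<partial>lborel)"
  by (simp add: power2_eq_square nn_integral_cmult nn_integral_multc)

text \<open>The Jacobian of \<open>z - 2 *\<^sub>R x\<close> is the source of the factor \<open>2\<close> in the logarithm.\<close>

lemma nn_integral_convolution_squares:
  fixes a b :: "'a::euclidean_space \<Rightarrow> ennreal"
  assumes [measurable]: "a \<in> borel_measurable borel" "b \<in> borel_measurable borel"
  shows "ennreal (2 ^ DIM('a)) * (\<integral>\<^sup>+x. \<integral>\<^sup>+z. (\<integral>\<^sup>+s. a s * a (z - s) \<partial>lborel) *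
      (\<integral>\<^sup>+s. b (s - x) * b (z - s - x) \<partial>lborel) \<partial>lborel \<partial>lborel)
    = (\<integral>\<^sup>+s. a s \<partial>lborel)\<^sup>2 * (\<integral>\<^sup>+s. b s \<partial>lborel)\<^sup>2"
proof -
  define L where "L z = (\<integral>\<^sup>+s. a s * a (z - s) \<partial>lborel)" for z
  define K where "K z = (\<integral>\<^sup>+s. b s * b (z - s) \<partial>lborel)" for z
  have [measurable]: "L \<in> borel_measurable borel" "K \<in> borel_measurable borel"
    unfolding L_def[abs_def] K_def[abs_def] by measurable
  have conv: "(\<integral>\<^sup>+z. \<integral>\<^sup>+s. c s * c (z - s) \<partial>lborel \<partial>lborel) = (\<integral>\<^sup>+s. c s \<partial>lborel)\<^sup>2"
    if [measurable]: "c \<in> borel_measurable borel" for c :: "'a \<Rightarrow> ennreal"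
    using nn_integral_convolution[of c c "\<lambda>_. 1"] by (simp add: nn_integral_power2)
  \<comment> \<open>The arguments s - x and z - s - x of the two windows add up to z - 2x,
    independently of s.\<close>
  have "(\<integral>\<^sup>+s. b (s - x) * b (z - s - x) \<partial>lborel) = K (z - 2 *\<^sub>R x)" for x z
  proof -
    have "(\<integral>\<^sup>+s. b (s - x) * b (z - s - x) \<partial>lborel)
        = (\<integral>\<^sup>+s. (\<lambda>s. b s * b (z - 2 *\<^sub>R x - s)) (s - x) \<partial>lborel)"
      by (intro nn_integral_cong) (simp add: scaleR_2 algebra_simps)
    also have "\<dots> = K (z - 2 *\<^sub>R x)"
      unfolding K_def by (rule nn_integral_lborel_translate) measurable
    finally show ?thesis .
  qed
  then have "(\<integral>\<^sup>+x. \<integral>\<^sup>+z. (\<integral>\<^sup>+s. a s * a (z - s) \<partial>lborel) *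
      (\<integral>\<^sup>+s. b (s - x) * b (z - s - x) \<partial>lborel) \<partial>lborel \<partial>lborel)
    = (\<integral>\<^sup>+x. \<integral>\<^sup>+z. L z * K (z - 2 *\<^sub>R x) \<partial>lborel \<partial>lborel)"
    by (simp add: L_def)
  also have "\<dots> = (\<integral>\<^sup>+z. \<integral>\<^sup>+x. L z * K (z - 2 *\<^sub>R x) \<partial>lborel \<partial>lborel)"
    by (rule nn_integral_lborel_swap) measurable
  finally have "ennreal (2 ^ DIM('a)) * (\<integral>\<^sup>+x. \<integral>\<^sup>+z. (\<integral>\<^sup>+s. a s * a (z - s) \<partial>lborel) *
      (\<integral>\<^sup>+s. b (s - x) * b (z - s - x) \<partial>lborel) \<partial>lborel \<partial>lborel)
     = (\<integral>\<^sup>+z. L z * (ennreal (2 ^ DIM('a)) * (\<integral>\<^sup>+x. K (z - 2 *\<^sub>R x) \<partial>lborel)) \<partial>lborel)"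
    by (simp add: nn_integral_cmult[symmetric] mult_ac)
  also have "\<dots> = (\<integral>\<^sup>+z. L z * (\<integral>\<^sup>+x. K x \<partial>lborel) \<partial>lborel)"
    using nn_integral_lborel_affine[of K "-2"] by simp
  also have "\<dots> = (\<integral>\<^sup>+s. a s \<partial>lborel)\<^sup>2 * (\<integral>\<^sup>+s. b s \<partial>lborel)\<^sup>2"
    using conv[of a] conv[of b] by (simp add: nn_integral_multc L_def K_def)
  finally show ?thesis .
qed

text \<open>Hoelder's inequality with four exponents 4, as two nested Cauchy-Schwarz inequalities;
  it is kept in fourth powers so that no roots of extended reals occur.\<close>

lemma nn_integral_four_mult_le:
  assumes [measurable]: "w1 \<in> borel_measurable M" "w2 \<in> borel_measurable M"
    "w3 \<in> borel_measurable M" "w4 \<in> borel_measurable M"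
  shows "(\<integral>\<^sup>+p. (w1 p * w2 p) * (w3 p * w4 p) \<partial>M) ^ 4 \<le>
    ((\<integral>\<^sup>+p. w1 p ^ 4 \<partial>M) * (\<integral>\<^sup>+p. w2 p ^ 4 \<partial>M)) * ((\<integral>\<^sup>+p. w3 p ^ 4 \<partial>M) * (\<integral>\<^sup>+p. w4 p ^ 4 \<partial>M))"
proof -
  have two: "(\<integral>\<^sup>+p. (u p * v p)\<^sup>2 \<partial>M)\<^sup>2 \<le> (\<integral>\<^sup>+p. u p ^ 4 \<partial>M) * (\<integral>\<^sup>+p. v p ^ 4 \<partial>M)"
    if [measurable]: "u \<in> borel_measurable M" "v \<in> borel_measurable M" for u v
    using Cauchy_Schwarz_nn_integral[of "\<lambda>p. (u p)\<^sup>2" M "\<lambda>p. (v p)\<^sup>2"]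
    by (simp add: power_mult_distrib power_mult[symmetric])
  have "(\<integral>\<^sup>+p. (w1 p * w2 p) * (w3 p * w4 p) \<partial>M) ^ 4 = ((\<integral>\<^sup>+p. (w1 p * w2 p) * (w3 p * w4 p) \<partial>M)\<^sup>2)\<^sup>2"
    by (simp add: power_mult[symmetric])
  also have "\<dots> \<le> ((\<integral>\<^sup>+p. (w1 p * w2 p)\<^sup>2 \<partial>M) * (\<integral>\<^sup>+p. (w3 p * w4 p)\<^sup>2 \<partial>M))\<^sup>2"
    by (intro power_mono Cauchy_Schwarz_nn_integral) auto
  also have "\<dots> \<le> ((\<integral>\<^sup>+p. w1 p ^ 4 \<partial>M) * (\<integral>\<^sup>+p. w2 p ^ 4 \<partial>M)) * ((\<integral>\<^sup>+p. w3 p ^ 4 \<partial>M) * (\<integral>\<^sup>+p. w4 p ^ 4 \<partial>M))"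
    unfolding power_mult_distrib[of "\<integral>\<^sup>+p. (w1 p * w2 p)\<^sup>2 \<partial>M"] by (intro mult_mono two) auto
  finally show ?thesis .
qed

text \<open>In terms of roots, X is at most C times the geometric mean of a and b, hence at most C
  times their arithmetic mean. Comparing squares avoids roots of values that may be
  infinite.\<close>

lemma two_mult_le_of_power4_le:
  fixes X C a b :: ennreal
  assumes "X ^ 4 \<le> C ^ 4 * (a * b)\<^sup>2"
  shows "2 * X \<le> C * (a + b)"
proof -
  have "(X\<^sup>2)\<^sup>2 \<le> (C\<^sup>2 * (a * b))\<^sup>2"
    using assms by (simp add: power_mult_distrib power_mult[symmetric])
  then have "X\<^sup>2 \<le> C\<^sup>2 * (a * b)"
    by (rule ennreal_power2_le_imp_le)
  then have "(2 * X)\<^sup>2 \<le> C\<^sup>2 * (4 * (a * b))"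
    using mult_left_mono[of "X\<^sup>2" "C\<^sup>2 * (a * b)" 4] by (simp add: power_mult_distrib mult_ac)
  also have "4 * (a * b) = 2 * (a * b) + 2 * a * b"
    by (simp add: mult.assoc flip: distrib_right)
  also have "C\<^sup>2 * (2 * (a * b) + 2 * a * b) \<le> C\<^sup>2 * (2 * (a * b) + (a\<^sup>2 + b\<^sup>2))"
    using ennreal_two_mult_le[of a b] by (intro mult_left_mono add_mono) auto
  also have "\<dots> = (C * (a + b))\<^sup>2"
    by (simp add: power_mult_distrib power2_sum add_ac mult.assoc)
  finally show ?thesis
    by (rule ennreal_power2_le_imp_le)
qed

text \<open>The second stage of the transform. Here \<open>w\<close> stands for the modulus of the
  kernels left by the first stage, and \<open>p\<close> collects the variables of that stage.
  Expanding the square and applying Hoelder in p gives C times the root of U(t) V(t) U(t') V(t').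
  The arithmetic-geometric mean then does pointwise what Cauchy-Schwarz would do for the integral
  over t.\<close>

lemma nn_integral_kernel_self_convolution_le:
  fixes w :: "'p::euclidean_space \<Rightarrow> 'b::euclidean_space \<Rightarrow> 'b \<Rightarrow> ennreal" and A B :: "'b \<Rightarrow> ennreal"
  assumes w [measurable]: "(\<lambda>q. w (fst q) (fst (snd q)) (snd (snd q))) \<in> borel_measurable borel"
    and [measurable]: "A \<in> borel_measurable borel" "B \<in> borel_measurable borel"
    and le: "\<And>t t'. (\<integral>\<^sup>+p. w p t t' ^ 4 \<partial>lborel) \<le> C * (A t)\<^sup>2 * (B t')\<^sup>2"
  shows "ennreal (2 ^ DIM('b)) *
      (\<integral>\<^sup>+p. \<integral>\<^sup>+x. \<integral>\<^sup>+z. (\<integral>\<^sup>+t. w p t (t - x) * w p (z - t) (z - t - x) \<partial>lborel)\<^sup>2 \<partial>lborel \<partial>lborel \<partial>lborel)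
    \<le> C * (\<integral>\<^sup>+t. A t \<partial>lborel)\<^sup>2 * (\<integral>\<^sup>+t. B t \<partial>lborel)\<^sup>2"
proof -
  have wm [measurable (raw)]: "(\<lambda>q. w (f q) (g q) (h q)) \<in> borel_measurable N"
    if [measurable]: "f \<in> borel_measurable N" "g \<in> borel_measurable N" "h \<in> borel_measurable N"
    for f g h and N :: "'n measure"
    using measurable_compose[OF _ w, of "\<lambda>q. (f q, g q, h q)" N] by simp
  define \<Theta> where "\<Theta> p x z t t' = (w p t (t - x) * w p (z - t) (z - t - x)) *
    (w p t' (t' - x) * w p (z - t') (z - t' - x))" for p x z t t'
  define U where "U z t = A t * A (z - t)" for z t
  define V where "V x z t = B (t - x) * B (z - t - x)" for x z t
  have \<Theta>: "2 * (\<integral>\<^sup>+p. \<Theta> p x z t t' \<partial>lborel) \<le> C * (U z t * V x z t' + U z t' * V x z t)" for x z t t'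
  proof (rule two_mult_le_of_power4_le)
    have "(\<integral>\<^sup>+p. \<Theta> p x z t t' \<partial>lborel) ^ 4
      \<le> ((\<integral>\<^sup>+p. w p t (t - x) ^ 4 \<partial>lborel) * (\<integral>\<^sup>+p. w p (z - t) (z - t - x) ^ 4 \<partial>lborel)) *
        ((\<integral>\<^sup>+p. w p t' (t' - x) ^ 4 \<partial>lborel) * (\<integral>\<^sup>+p. w p (z - t') (z - t' - x) ^ 4 \<partial>lborel))"
      unfolding \<Theta>_def by (rule nn_integral_four_mult_le) measurable
    also have "\<dots> \<le> ((C * (A t)\<^sup>2 * (B (t - x))\<^sup>2) * (C * (A (z - t))\<^sup>2 * (B (z - t - x))\<^sup>2)) *
       ((C * (A t')\<^sup>2 * (B (t' - x))\<^sup>2) * (C * (A (z - t'))\<^sup>2 * (B (z - t' - x))\<^sup>2))"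
      by (intro mult_mono le) auto
    \<comment> \<open>The factors are paired crosswise: \<open>U\<close> at t with \<open>V\<close>
      at t', and vice versa. After the arithmetic-geometric mean each summand then splits into an
      integral of \<open>U\<close> times an integral of \<open>V\<close>.\<close>
    also have "\<dots> = C ^ 4 * (U z t * V x z t' * (U z t' * V x z t))\<^sup>2"
      by (simp add: U_def V_def power2_eq_square power4_eq_xxxx mult_ac)
    finally show "(\<integral>\<^sup>+p. \<Theta> p x z t t' \<partial>lborel) ^ 4 \<le> C ^ 4 * (U z t * V x z t' * (U z t' * V x z t))\<^sup>2" .
  qed
  have "(\<integral>\<^sup>+p. \<integral>\<^sup>+x. \<integral>\<^sup>+z. (\<integral>\<^sup>+t. w p t (t - x) * w p (z - t) (z - t - x) \<partial>lborel)\<^sup>2 \<partial>lborel \<partial>lborel \<partial>lborel)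
    = (\<integral>\<^sup>+p. \<integral>\<^sup>+x. \<integral>\<^sup>+z. \<integral>\<^sup>+t. \<integral>\<^sup>+t'. \<Theta> p x z t t' \<partial>lborel \<partial>lborel \<partial>lborel \<partial>lborel \<partial>lborel)"
    unfolding \<Theta>_def by (intro nn_integral_cong nn_integral_power2) measurable
  \<comment> \<open>Tonelli, one variable at a time, moves p to the innermost place, where the bound
    on \<open>\<Theta>\<close> applies.\<close>
  also have "\<dots> = (\<integral>\<^sup>+x. \<integral>\<^sup>+p. \<integral>\<^sup>+z. \<integral>\<^sup>+t. \<integral>\<^sup>+t'. \<Theta> p x z t t' \<partial>lborel \<partial>lborel \<partial>lborel \<partial>lborel \<partial>lborel)"
    unfolding \<Theta>_def by (intro nn_integral_lborel_swap) measurable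
  also have "\<dots> = (\<integral>\<^sup>+x. \<integral>\<^sup>+z. \<integral>\<^sup>+p. \<integral>\<^sup>+t. \<integral>\<^sup>+t'. \<Theta> p x z t t' \<partial>lborel \<partial>lborel \<partial>lborel \<partial>lborel \<partial>lborel)"
    unfolding \<Theta>_def by (intro nn_integral_cong nn_integral_lborel_swap) measurable
  also have "\<dots> = (\<integral>\<^sup>+x. \<integral>\<^sup>+z. \<integral>\<^sup>+t. \<integral>\<^sup>+p. \<integral>\<^sup>+t'. \<Theta> p x z t t' \<partial>lborel \<partial>lborel \<partial>lborel \<partial>lborel \<partial>lborel)"
    unfolding \<Theta>_def by (intro nn_integral_cong nn_integral_lborel_swap) measurable
  also have "\<dots> = (\<integral>\<^sup>+x. \<integral>\<^sup>+z. \<integral>\<^sup>+t. \<integral>\<^sup>+t'. \<integral>\<^sup>+p. \<Theta> p x z t t' \<partial>lborel \<partial>lborel \<partial>lborel \<partial>lborel \<partial>lborel)"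
    unfolding \<Theta>_def by (intro nn_integral_cong nn_integral_lborel_swap) measurable
  finally have "2 * (\<integral>\<^sup>+p. \<integral>\<^sup>+x. \<integral>\<^sup>+z. (\<integral>\<^sup>+t. w p t (t - x) * w p (z - t) (z - t - x) \<partial>lborel)\<^sup>2 \<partial>lborel \<partial>lborel \<partial>lborel)
    = (\<integral>\<^sup>+x. \<integral>\<^sup>+z. \<integral>\<^sup>+t. \<integral>\<^sup>+t'. 2 * (\<integral>\<^sup>+p. \<Theta> p x z t t' \<partial>lborel) \<partial>lborel \<partial>lborel \<partial>lborel \<partial>lborel)"
    unfolding \<Theta>_def by (simp add: nn_integral_cmult)
  also have "\<dots> \<le> (\<integral>\<^sup>+x. \<integral>\<^sup>+z. \<integral>\<^sup>+t. \<integral>\<^sup>+t'. C * (U z t * V x z t' + U z t' * V x z t) \<partial>lborel \<partial>lborel \<partial>lborel \<partial>lborel)"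
    by (intro nn_integral_mono \<Theta>)
  also have "\<dots> = (\<integral>\<^sup>+x. \<integral>\<^sup>+z. 2 * C * ((\<integral>\<^sup>+t. U z t \<partial>lborel) * (\<integral>\<^sup>+t. V x z t \<partial>lborel)) \<partial>lborel \<partial>lborel)"
  proof (intro nn_integral_cong)
    fix x z
    have [measurable]: "U z \<in> borel_measurable borel" "V x z \<in> borel_measurable borel"
      unfolding U_def[abs_def] V_def[abs_def] by measurable
    let ?u = "\<integral>\<^sup>+t. U z t \<partial>lborel" and ?v = "\<integral>\<^sup>+t. V x z t \<partial>lborel"
    have "(\<integral>\<^sup>+t. \<integral>\<^sup>+t'. C * (U z t * V x z t' + U z t' * V x z t) \<partial>lborel \<partial>lborel)
      = (\<integral>\<^sup>+t. C * (U z t * ?v + ?u * V x z t) \<partial>lborel)"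
      by (intro nn_integral_cong) (simp add: nn_integral_cmult nn_integral_multc nn_integral_add)
    also have "\<dots> = C * (?u * ?v + ?u * ?v)"
      by (simp add: nn_integral_cmult nn_integral_multc nn_integral_add)
    finally show "(\<integral>\<^sup>+t. \<integral>\<^sup>+t'. C * (U z t * V x z t' + U z t' * V x z t) \<partial>lborel \<partial>lborel)
      = 2 * C * (?u * ?v)"
      by (simp add: mult_2[symmetric] mult_ac)
  qed
  also have "\<dots> = 2 * (C * (\<integral>\<^sup>+x. \<integral>\<^sup>+z. (\<integral>\<^sup>+t. U z t \<partial>lborel) * (\<integral>\<^sup>+t. V x z t \<partial>lborel) \<partial>lborel \<partial>lborel))"
    unfolding U_def V_def by (simp add: nn_integral_cmult mult.assoc)
  finally have "(\<integral>\<^sup>+p. \<integral>\<^sup>+x. \<integral>\<^sup>+z. (\<integral>\<^sup>+t. w p t (t - x) * w p (z - t) (z - t - x) \<partial>lborel)\<^sup>2 \<partial>lborel \<partial>lborel \<partial>lborel)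
      \<le> C * (\<integral>\<^sup>+x. \<integral>\<^sup>+z. (\<integral>\<^sup>+t. U z t \<partial>lborel) * (\<integral>\<^sup>+t. V x z t \<partial>lborel) \<partial>lborel \<partial>lborel)"
    by (subst (asm) ennreal_mult_le_mult_iff) auto
  then have "ennreal (2 ^ DIM('b)) * (\<integral>\<^sup>+p. \<integral>\<^sup>+x. \<integral>\<^sup>+z. (\<integral>\<^sup>+t. w p t (t - x) * w p (z - t) (z - t - x) \<partial>lborel)\<^sup>2 \<partial>lborel \<partial>lborel \<partial>lborel)
      \<le> C * (ennreal (2 ^ DIM('b)) * (\<integral>\<^sup>+x. \<integral>\<^sup>+z. (\<integral>\<^sup>+t. U z t \<partial>lborel) * (\<integral>\<^sup>+t. V x z t \<partial>lborel) \<partial>lborel \<partial>lborel))"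
    unfolding mult.left_commute[of C "ennreal (2 ^ DIM('b))"] by (intro mult_left_mono) auto
  also have "\<dots> = C * ((\<integral>\<^sup>+t. A t \<partial>lborel)\<^sup>2 * (\<integral>\<^sup>+t. B t \<partial>lborel)\<^sup>2)"
    unfolding U_def V_def by (subst nn_integral_convolution_squares) auto
  finally show ?thesis
    by (simp add: mult.assoc)
qed

section \<open>The two-sided transform as two successive one-sided transforms\<close>

definition windowed_ft ::
  "('a::euclidean_space \<times> 'b::euclidean_space \<Rightarrow> quat) \<Rightarrow> ('a \<times> 'b \<Rightarrow> quat) \<Rightarrow> 'a \<times> 'b \<Rightarrow> 'a \<times> 'b \<Rightarrow> quat"
  where "windowed_ft g f x w = (\<integral>y. exp (- ((fst y \<bullet> fst w) *\<^sub>R quat_i)) * f y * quat_cnj (g (y - x)) *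
    exp (- ((snd y \<bullet> snd w) *\<^sub>R quat_j)) \<partial>lborel)"

abbreviation L2_mass :: "('a::euclidean_space \<Rightarrow> quat) \<Rightarrow> ennreal"
  where "L2_mass f \<equiv> \<integral>\<^sup>+y. ennreal ((norm (f y))\<^sup>2) \<partial>lborel"

lemma integrable_mult_translate:
  fixes f g :: "'a::euclidean_space \<Rightarrow> quat"
  assumes [measurable]: "f \<in> borel_measurable borel" "g \<in> borel_measurable borel"
    and fin: "L2_mass f < \<infinity>" "L2_mass g < \<infinity>"
  shows "integrable lborel (\<lambda>y. f y * quat_cnj (g (y - x)))"
proof (rule integrableI_bounded)
  have "(\<integral>\<^sup>+y. ennreal (norm (f y)) * ennreal (norm (g (y - x))) \<partial>lborel)\<^sup>2
      \<le> (\<integral>\<^sup>+y. (ennreal (norm (f y)))\<^sup>2 \<partial>lborel) * (\<integral>\<^sup>+y. (ennreal (norm (g (y - x))))\<^sup>2 \<partial>lborel)"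
    by (rule Cauchy_Schwarz_nn_integral) measurable
  also have "\<dots> = L2_mass f * L2_mass g"
    using nn_integral_lborel_translate(2)[of "\<lambda>y. ennreal ((norm (g y))\<^sup>2)" x] by (simp add: ennreal_power)
  also have "\<dots> < \<infinity>"
    using fin by (simp add: ennreal_mult_less_top)
  finally show "(\<integral>\<^sup>+y. ennreal (norm (f y * quat_cnj (g (y - x)))) \<partial>lborel) < \<infinity>"
    by (simp add: norm_mult ennreal_mult'' power_less_top_ennreal)
qed measurable

text \<open>Integrating over s first produces a left transform. Conjugation reverses products, so it
  turns the right exponential in t into a left one of opposite sign, whence the frequency
  \<open>- snd w\<close>. It preserves the norm, which is all that the moments see.\<close>

lemma windowed_ft_eq_iterated:
  fixes f g :: "'a::euclidean_space \<times> 'b::euclidean_space \<Rightarrow> quat"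
  assumes [measurable]: "f \<in> borel_measurable borel" "g \<in> borel_measurable borel"
    and fin: "L2_mass f < \<infinity>" "L2_mass g < \<infinity>"
  shows "norm (windowed_ft g f x w) = norm (left_ft quat_j
    (\<lambda>t. quat_cnj (left_ft quat_i (\<lambda>s. f (s, t) * quat_cnj (g (s - fst x, t - snd x))) (fst w))) (- snd w))"
proof -
  define W where "W t = left_ft quat_i (\<lambda>s. f (s, t) * quat_cnj (g (s - fst x, t - snd x))) (fst w)" for t
  define H where "H s t = exp (- ((s \<bullet> fst w) *\<^sub>R quat_i)) * (f (s, t) * quat_cnj (g (s - fst x, t - snd x))) *
    exp (- ((t \<bullet> snd w) *\<^sub>R quat_j))" for s t
  have "integrable lborel (\<lambda>y. H (fst y) (snd y))"
  proof (rule Bochner_Integration.integrable_bound[OF integrable_mult_translate[OF assms, of x]])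
    show "AE y in lborel. norm (H (fst y) (snd y)) \<le> norm (f y * quat_cnj (g (y - x)))"
      by (simp add: H_def norm_mult minus_prod_def)
  qed (unfold H_def, measurable)
  then have H: "integrable (lborel \<Otimes>\<^sub>M lborel) (\<lambda>(s, t). H s t)"
    by (simp add: lborel_prod split_beta')
  have "windowed_ft g f x w = (\<integral>y. H (fst y) (snd y) \<partial>lborel)"
    by (simp add: windowed_ft_def H_def minus_prod_def mult.assoc)
  also have "\<dots> = (\<integral>t. \<integral>s. H s t \<partial>lborel \<partial>lborel)"
    using lborel_pair.integral_snd[OF H] by (simp add: lborel_prod split_beta')
  also have "\<dots> = (\<integral>t. W t * exp (- ((t \<bullet> snd w) *\<^sub>R quat_j)) \<partial>lborel)"
  proof (intro Bochner_Integration.integral_cong refl)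
    fix t :: 'b
    \<comment> \<open>Right multiplication by a nonzero exponential is invertible, so it commutes
      with the integral even at those t where the slice in s is not integrable and both sides are
      0.\<close>
    have "exp (- ((t \<bullet> snd w) *\<^sub>R quat_j)) \<noteq> 0"
      using norm_exp_imaginary_unit(2)[of "t \<bullet> snd w"] by (metis norm_zero zero_neq_one)
    then show "(\<integral>s. H s t \<partial>lborel) = W t * exp (- ((t \<bullet> snd w) *\<^sub>R quat_j))"
      unfolding W_def left_ft_def H_def
      by (intro integral_bounded_linear'[where T'="\<lambda>q. q * inverse (exp (- ((t \<bullet> snd w) *\<^sub>R quat_j)))"]
          bounded_linear_mult_left) (simp add: mult.assoc)
  qed
  finally have "quat_cnj (windowed_ft g f x w) = quat_cnj (\<integral>t. W t * exp (- ((t \<bullet> snd w) *\<^sub>R quat_j)) \<partial>lborel)"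
    by simp
  also have "\<dots> = (\<integral>t. quat_cnj (W t * exp (- ((t \<bullet> snd w) *\<^sub>R quat_j))) \<partial>lborel)"
    by (intro integral_bounded_linear'[where T'=quat_cnj, symmetric] bounded_linear_quat_cnj) simp
  also have "\<dots> = left_ft quat_j (\<lambda>t. quat_cnj (W t)) (- snd w)"
    by (simp add: left_ft_def quat_cnj_mult quat_cnj_exp_j)
  finally show ?thesis
    unfolding W_def by (metis norm_quat_cnj)
qed

text \<open>Cauchy-Schwarz in s separates the self-convolution of the squared modulus of \<phi> from
  that of \<psi>. The constant 2 \<pi> per coordinate of the one-sided estimate, divided by the
  Jacobian 2 of the shift, leaves \<pi>.\<close>

lemma left_ft_window_fourth_moment_le:
  fixes \<phi> \<psi> :: "'a::euclidean_space \<Rightarrow> quat"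
  assumes [measurable]: "\<phi> \<in> borel_measurable borel" "\<psi> \<in> borel_measurable borel"
  shows "(\<integral>\<^sup>+x. \<integral>\<^sup>+u. ennreal (norm (left_ft quat_i (\<lambda>s. \<phi> s * quat_cnj (\<psi> (s - x))) u)) ^ 4 \<partial>lborel \<partial>lborel)
    \<le> ennreal (pi ^ DIM('a)) * (L2_mass \<phi>)\<^sup>2 * (L2_mass \<psi>)\<^sup>2"
proof -
  define a where "a s = ennreal ((norm (\<phi> s))\<^sup>2)" for s
  define b where "b s = ennreal ((norm (\<psi> s))\<^sup>2)" for s
  have [measurable]: "a \<in> borel_measurable borel" "b \<in> borel_measurable borel"
    unfolding a_def[abs_def] b_def[abs_def] by measurable
  let ?I = "\<integral>\<^sup>+x. \<integral>\<^sup>+z. (\<integral>\<^sup>+s. a s * a (z - s) \<partial>lborel) * (\<integral>\<^sup>+s. b (s - x) * b (z - s - x) \<partial>lborel) \<partial>lborel \<partial>lborel"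
  have "(\<integral>\<^sup>+u. ennreal (norm (left_ft quat_i (\<lambda>s. \<phi> s * quat_cnj (\<psi> (s - x))) u)) ^ 4 \<partial>lborel)
    \<le> ennreal ((2 * pi) ^ DIM('a)) * (\<integral>\<^sup>+z. (\<integral>\<^sup>+s. a s * a (z - s) \<partial>lborel) *
      (\<integral>\<^sup>+s. b (s - x) * b (z - s - x) \<partial>lborel) \<partial>lborel)" (is "?lhs \<le> _") for x
  proof -
    have "?lhs \<le> ennreal ((2 * pi) ^ DIM('a)) * (\<integral>\<^sup>+z. (\<integral>\<^sup>+s. ennreal (norm (\<phi> s * quat_cnj (\<psi> (s - x)))) *
      ennreal (norm (\<phi> (z - s) * quat_cnj (\<psi> (z - s - x)))) \<partial>lborel)\<^sup>2 \<partial>lborel)"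
      using left_ft_fourth_moment_le[of "\<lambda>s. \<phi> s * quat_cnj (\<psi> (s - x))" quat_i] by (simp add: ennreal_power)
    also have "\<dots> \<le> ennreal ((2 * pi) ^ DIM('a)) * (\<integral>\<^sup>+z. (\<integral>\<^sup>+s. a s * a (z - s) \<partial>lborel) *
      (\<integral>\<^sup>+s. b (s - x) * b (z - s - x) \<partial>lborel) \<partial>lborel)"
    proof (intro mult_left_mono nn_integral_mono)
      fix z
      have "(\<integral>\<^sup>+s. ennreal (norm (\<phi> s * quat_cnj (\<psi> (s - x)))) * ennreal (norm (\<phi> (z - s) * quat_cnj (\<psi> (z - s - x)))) \<partial>lborel)\<^sup>2
        = (\<integral>\<^sup>+s. (ennreal (norm (\<phi> s)) * ennreal (norm (\<phi> (z - s)))) *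
            (ennreal (norm (\<psi> (s - x))) * ennreal (norm (\<psi> (z - s - x)))) \<partial>lborel)\<^sup>2"
        by (simp add: norm_mult ennreal_mult mult_ac)
      also have "\<dots> \<le> (\<integral>\<^sup>+s. (ennreal (norm (\<phi> s)) * ennreal (norm (\<phi> (z - s))))\<^sup>2 \<partial>lborel) *
            (\<integral>\<^sup>+s. (ennreal (norm (\<psi> (s - x))) * ennreal (norm (\<psi> (z - s - x))))\<^sup>2 \<partial>lborel)"
        by (rule Cauchy_Schwarz_nn_integral) measurable
      also have "\<dots> = (\<integral>\<^sup>+s. a s * a (z - s) \<partial>lborel) * (\<integral>\<^sup>+s. b (s - x) * b (z - s - x) \<partial>lborel)"
        by (simp add: a_def b_def power_mult_distrib ennreal_power)
      finally show "(\<integral>\<^sup>+s. ennreal (norm (\<phi> s * quat_cnj (\<psi> (s - x)))) * ennreal (norm (\<phi> (z - s) * quat_cnj (\<psi> (z - s - x)))) \<partial>lborel)\<^sup>2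
        \<le> (\<integral>\<^sup>+s. a s * a (z - s) \<partial>lborel) * (\<integral>\<^sup>+s. b (s - x) * b (z - s - x) \<partial>lborel)" .
    qed simp
    finally show ?thesis .
  qed
  then have "(\<integral>\<^sup>+x. \<integral>\<^sup>+u. ennreal (norm (left_ft quat_i (\<lambda>s. \<phi> s * quat_cnj (\<psi> (s - x))) u)) ^ 4 \<partial>lborel \<partial>lborel)
     \<le> (\<integral>\<^sup>+x. ennreal ((2 * pi) ^ DIM('a)) * (\<integral>\<^sup>+z. (\<integral>\<^sup>+s. a s * a (z - s) \<partial>lborel) *
      (\<integral>\<^sup>+s. b (s - x) * b (z - s - x) \<partial>lborel) \<partial>lborel) \<partial>lborel)"
    by (intro nn_integral_mono)
  also have "\<dots> = ennreal (pi ^ DIM('a)) * (ennreal (2 ^ DIM('a)) * ?I)"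
    by (simp add: nn_integral_cmult power_mult_distrib ennreal_mult mult_ac)
  also have "\<dots> = ennreal (pi ^ DIM('a)) * ((L2_mass \<phi>)\<^sup>2 * (L2_mass \<psi>)\<^sup>2)"
    by (subst nn_integral_convolution_squares) (simp_all add: a_def[abs_def] b_def[abs_def])
  finally show ?thesis
    by (simp add: mult.assoc)
qed

text \<open>Each stage contributes 2 \<pi> per coordinate from the one-sided estimate and 1/2 from
  the Jacobian of its own shift, which gives \<pi> to the total dimension. The second frequency is
  integrated first, with the other variables fixed; only moduli of the first-stage kernels remain
  after that.\<close>

lemma windowed_ft_fourth_moment_le:
  fixes f g :: "'a::euclidean_space \<times> 'b::euclidean_space \<Rightarrow> quat"
  assumes [measurable]: "f \<in> borel_measurable borel" "g \<in> borel_measurable borel"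
    and fin: "L2_mass f < \<infinity>" "L2_mass g < \<infinity>"
  shows "(\<integral>\<^sup>+z. ennreal ((norm (windowed_ft g f (fst z) (snd z))) ^ 4) \<partial>lborel)
    \<le> ennreal (pi ^ DIM('a \<times> 'b)) * (L2_mass f)\<^sup>2 * (L2_mass g)\<^sup>2"
proof -
  \<comment> \<open>\<open>p\<close> pairs the first shift with the first frequency. The window
    slice t' is kept independent of t and specialized to t - x2 only later, so that the first-stage
    bound is available for each pair of slices.\<close>
  define W where "W p t t' = left_ft quat_i (\<lambda>s. f (s, t) * quat_cnj (g (s - fst p, t'))) (snd p)"
    for p :: "'a \<times> 'a" and t t' :: 'b
  define w where "w p t t' = ennreal (norm (W p t t'))" for p t t'
  have W [measurable]: "(\<lambda>q. W (fst q) (fst (snd q)) (snd (snd q))) \<in> borel_measurable borel"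
    unfolding W_def left_ft_def by measurable
  have wm [measurable]: "(\<lambda>q. w (fst q) (fst (snd q)) (snd (snd q))) \<in> borel_measurable borel"
    unfolding w_def by measurable
  have Wm [measurable (raw)]: "(\<lambda>q. W (f q) (g q) (h q)) \<in> borel_measurable N"
    if [measurable]: "f \<in> borel_measurable N" "g \<in> borel_measurable N" "h \<in> borel_measurable N"
    for f g h and N :: "'n measure"
    using measurable_compose[OF _ W, of "\<lambda>q. (f q, g q, h q)" N] by simp
  define A where "A t = L2_mass (\<lambda>s. f (s, t))" for t
  define B where "B t = L2_mass (\<lambda>s. g (s, t))" for t
  have [measurable]: "A \<in> borel_measurable borel" "B \<in> borel_measurable borel"
    unfolding A_def[abs_def] B_def[abs_def] by measurable
  have AB: "(\<integral>\<^sup>+t. A t \<partial>lborel) = L2_mass f" "(\<integral>\<^sup>+t. B t \<partial>lborel) = L2_mass g"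
    unfolding A_def B_def
    by (subst nn_integral_lborel_pair, measurable, rule nn_integral_lborel_swap, measurable)+
  have w: "(\<integral>\<^sup>+p. w p t t' ^ 4 \<partial>lborel) \<le> ennreal (pi ^ DIM('a)) * (A t)\<^sup>2 * (B t')\<^sup>2" for t t'
  proof -
    have "(\<lambda>p. w p t t' ^ 4) \<in> borel_measurable borel"
      unfolding w_def by measurable
    then show ?thesis
      using left_ft_window_fourth_moment_le[of "\<lambda>s. f (s, t)" "\<lambda>s. g (s, t')"]
      by (simp add: nn_integral_lborel_pair) (simp add: w_def W_def A_def B_def)
  qed
  have v: "(\<integral>\<^sup>+v. ennreal ((norm (windowed_ft g f (x1, x2) (u, v))) ^ 4) \<partial>lborel)
     \<le> ennreal ((2 * pi) ^ DIM('b)) * (\<integral>\<^sup>+z. (\<integral>\<^sup>+t. w (x1, u) t (t - x2) * w (x1, u) (z - t) (z - t - x2) \<partial>lborel)\<^sup>2 \<partial>lborel)"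
    for x1 x2 u
  proof -
    let ?h = "\<lambda>t. quat_cnj (W (x1, u) t (t - x2))"
    have [measurable]: "left_ft quat_j ?h \<in> borel_measurable borel"
      unfolding left_ft_def[abs_def] by measurable
    \<comment> \<open>The frequency enters as -v, which the reflection invariance of Lebesgue
      measure absorbs.\<close>
    have "(\<integral>\<^sup>+v. ennreal ((norm (windowed_ft g f (x1, x2) (u, v))) ^ 4) \<partial>lborel)
        = (\<integral>\<^sup>+v. ennreal ((norm (left_ft quat_j ?h (0 - v))) ^ 4) \<partial>lborel)"
      by (simp add: windowed_ft_eq_iterated[OF assms] W_def)
    also have "\<dots> = (\<integral>\<^sup>+v. ennreal ((norm (left_ft quat_j ?h v)) ^ 4) \<partial>lborel)"
      by (rule nn_integral_lborel_translate(3)) measurable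
    also have "\<dots> \<le> ennreal ((2 * pi) ^ DIM('b)) * (\<integral>\<^sup>+z. (\<integral>\<^sup>+t. ennreal (norm (?h t)) * ennreal (norm (?h (z - t))) \<partial>lborel)\<^sup>2 \<partial>lborel)"
      by (rule left_ft_fourth_moment_le) auto
    finally show ?thesis
      by (simp add: w_def)
  qed
  have Q [measurable]: "(\<lambda>z. windowed_ft g f (fst z) (snd z)) \<in> borel_measurable borel"
    unfolding windowed_ft_def by measurable
  have Qm [measurable (raw)]: "(\<lambda>q. windowed_ft g f (a q) (b q)) \<in> borel_measurable N"
    if [measurable]: "a \<in> borel_measurable N" "b \<in> borel_measurable N"
    for a b and N :: "'n measure"
    using measurable_compose[OF _ Q, of "\<lambda>q. (a q, b q)" N] by simp
  have "(\<integral>\<^sup>+z. ennreal ((norm (windowed_ft g f (fst z) (snd z))) ^ 4) \<partial>lborel)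
    = (\<integral>\<^sup>+x1. \<integral>\<^sup>+x2. \<integral>\<^sup>+u. \<integral>\<^sup>+v. ennreal ((norm (windowed_ft g f (x1, x2) (u, v))) ^ 4) \<partial>lborel \<partial>lborel \<partial>lborel \<partial>lborel)"
    by (simp add: nn_integral_lborel_pair)
  \<comment> \<open>The shift x2 belongs to the second stage and is moved inside u; the outer
    variables x1 and u then form \<open>p\<close>.\<close>
  also have "\<dots> = (\<integral>\<^sup>+x1. \<integral>\<^sup>+u. \<integral>\<^sup>+x2. \<integral>\<^sup>+v. ennreal ((norm (windowed_ft g f (x1, x2) (u, v))) ^ 4) \<partial>lborel \<partial>lborel \<partial>lborel \<partial>lborel)"
    by (intro nn_integral_cong nn_integral_lborel_swap) measurable
  also have "\<dots> \<le> (\<integral>\<^sup>+x1. \<integral>\<^sup>+u. \<integral>\<^sup>+x2. ennreal ((2 * pi) ^ DIM('b)) *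
      (\<integral>\<^sup>+z. (\<integral>\<^sup>+t. w (x1, u) t (t - x2) * w (x1, u) (z - t) (z - t - x2) \<partial>lborel)\<^sup>2 \<partial>lborel) \<partial>lborel \<partial>lborel \<partial>lborel)"
    by (intro nn_integral_mono v)
  also have "\<dots> = ennreal ((2 * pi) ^ DIM('b)) * (\<integral>\<^sup>+p. \<integral>\<^sup>+x2.
      \<integral>\<^sup>+z. (\<integral>\<^sup>+t. w p t (t - x2) * w p (z - t) (z - t - x2) \<partial>lborel)\<^sup>2 \<partial>lborel \<partial>lborel \<partial>lborel)"
    unfolding w_def by (subst nn_integral_lborel_pair) (simp_all add: nn_integral_cmult)
  also have "\<dots> = ennreal (pi ^ DIM('b)) * (ennreal (2 ^ DIM('b)) * (\<integral>\<^sup>+p. \<integral>\<^sup>+x2.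
      \<integral>\<^sup>+z. (\<integral>\<^sup>+t. w p t (t - x2) * w p (z - t) (z - t - x2) \<partial>lborel)\<^sup>2 \<partial>lborel \<partial>lborel \<partial>lborel))"
    by (simp add: power_mult_distrib ennreal_mult mult_ac)
  also have "\<dots> \<le> ennreal (pi ^ DIM('b)) * (ennreal (pi ^ DIM('a)) * (L2_mass f)\<^sup>2 * (L2_mass g)\<^sup>2)"
    using nn_integral_kernel_self_convolution_le[OF wm _ _ w] by (intro mult_left_mono) (auto simp: AB)
  also have "\<dots> = ennreal (pi ^ DIM('a \<times> 'b)) * (L2_mass f)\<^sup>2 * (L2_mass g)\<^sup>2"
    by (simp add: power_add ennreal_mult mult_ac)
  finally show ?thesis .
qed

subsection \<open>The second moment of the windowed transform\<close>

lemma gauss_prod: "gauss \<sigma> (w :: 'a::euclidean_space \<times> 'b::euclidean_space) = gauss \<sigma> (fst w) * gauss \<sigma> (snd w)"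
  by (simp add: gauss_def norm_prod_def exp_add[symmetric] add_divide_distrib diff_divide_distrib)

lemma gauss_ft_prod:
  "gauss_ft \<sigma> (w :: 'a::euclidean_space \<times> 'b::euclidean_space) = gauss_ft \<sigma> (fst w) * gauss_ft \<sigma> (snd w)"
  by (simp add: gauss_ft_def gauss_prod power_add)

text \<open>Each integral with a sine factor vanishes by oddness. Only \<alpha> survives, which will
  be the plain inner product, so the noncommuting units leave no trace in the second moment.\<close>

lemma integral_gauss_two_sided_exp:
  fixes A :: "'a::euclidean_space \<times> 'b::euclidean_space"
  assumes \<sigma>: "\<sigma> > 0"
  shows "(\<integral>w. gauss \<sigma> w * (cos (fst A \<bullet> fst w) * cos (snd A \<bullet> snd w) * \<alpha> - sin (fst A \<bullet> fst w) * cos (snd A \<bullet> snd w) * \<beta>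
      - cos (fst A \<bullet> fst w) * sin (snd A \<bullet> snd w) * \<gamma> + sin (fst A \<bullet> fst w) * sin (snd A \<bullet> snd w) * \<delta>) \<partial>lborel)
    = gauss_ft \<sigma> A * \<alpha>"
proof -
  have prod: "has_bochner_integral lborel (\<lambda>w. F (fst w) * G (snd w)) (X * Y)"
    if "has_bochner_integral lborel F X" "has_bochner_integral lborel G Y"
    for F :: "'a \<Rightarrow> real" and G :: "'b \<Rightarrow> real" and X Y
    using that lborel_mult_product[of F G] by (auto simp: has_bochner_integral_iff)
  have "has_bochner_integral lborel (\<lambda>w.
      gauss \<sigma> (fst w) * cos (fst A \<bullet> fst w) * (gauss \<sigma> (snd w) * cos (snd A \<bullet> snd w)) * \<alpha>
      - gauss \<sigma> (fst w) * sin (fst A \<bullet> fst w) * (gauss \<sigma> (snd w) * cos (snd A \<bullet> snd w)) * \<beta>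
      - gauss \<sigma> (fst w) * cos (fst A \<bullet> fst w) * (gauss \<sigma> (snd w) * sin (snd A \<bullet> snd w)) * \<gamma>
      + gauss \<sigma> (fst w) * sin (fst A \<bullet> fst w) * (gauss \<sigma> (snd w) * sin (snd A \<bullet> snd w)) * \<delta>)
    (gauss_ft \<sigma> (fst A) * gauss_ft \<sigma> (snd A) * \<alpha> - 0 * gauss_ft \<sigma> (snd A) * \<beta> - gauss_ft \<sigma> (fst A) * 0 * \<gamma> + 0 * 0 * \<delta>)"
    by (intro has_bochner_integral_add has_bochner_integral_diff has_bochner_integral_mult_left prod gauss_cos gauss_sin \<sigma>)
  then show ?thesis
    by (intro has_bochner_integral_integral_eq) (simp add: gauss_prod gauss_ft_prod algebra_simps)
qed

text \<open>The squared norm is expanded as a double integral, and the Gaussian allows the integral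
  over w to be done first. The last claim cannot be read off the integrand, which may change sign;
  it comes from the left side and permits the passage to extended nonnegative integrals.\<close>

lemma two_sided_gauss_second_moment:
  fixes h :: "'a::euclidean_space \<times> 'b::euclidean_space \<Rightarrow> quat"
  assumes h: "integrable lborel h" and \<sigma>: "\<sigma> > 0"
  defines "Q w \<equiv> \<integral>y. exp (- ((fst y \<bullet> fst w) *\<^sub>R quat_i)) * h y * exp (- ((snd y \<bullet> snd w) *\<^sub>R quat_j)) \<partial>lborel"
  shows "(\<integral>\<^sup>+w. ennreal (gauss \<sigma> w) * ennreal ((norm (Q w))\<^sup>2) \<partial>lborel)
      = ennreal (\<integral>p. gauss_ft \<sigma> (fst p - snd p) * (h (fst p) \<bullet> h (snd p)) \<partial>lborel)"
    and "integrable lborel (\<lambda>p. gauss_ft \<sigma> (fst p - snd p) * (h (fst p) \<bullet> h (snd p)))"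
    and "0 \<le> (\<integral>p. gauss_ft \<sigma> (fst p - snd p) * (h (fst p) \<bullet> h (snd p)) \<partial>lborel)"
proof -
  have [measurable]: "h \<in> borel_measurable borel"
    using borel_measurable_integrable[OF h] by simp
  define F where "F w y = exp (- ((fst y \<bullet> fst w) *\<^sub>R quat_i)) * h y * exp (- ((snd y \<bullet> snd w) *\<^sub>R quat_j))" for w y
  have F: "integrable lborel (F w)" for w
    using h unfolding F_def
    by (rule Bochner_Integration.integrable_bound) (simp_all add: norm_mult)
  define c where "c w p = F w (fst p) \<bullet> F w (snd p)" for w p
  define N where "N p = norm (h (fst p)) * norm (h (snd p))" for p
  have [measurable]: "(\<lambda>q. c (fst q) (snd q)) \<in> borel_measurable borel" "N \<in> borel_measurable borel"
    unfolding c_def F_def N_def[abs_def] by measurable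
  have c_le: "\<bar>c w p\<bar> \<le> N p" for w p
    using Cauchy_Schwarz_ineq2[of "F w (fst p)" "F w (snd p)"]
    by (simp add: c_def N_def F_def norm_mult)
  have c_int: "(norm (Q w))\<^sup>2 = (\<integral>p. c w p \<partial>lborel)" for w
    unfolding c_def[abs_def] using lborel_inner_product[OF F F, of w w]
    by (simp add: Q_def F_def power2_norm_eq_inner)
  have N_int: "integrable lborel N"
    unfolding N_def[abs_def] using h by (intro lborel_mult_product) auto
  have "integrable lborel (\<lambda>q. gauss \<sigma> (fst q) * c (fst q) (snd q))"
  proof (rule Bochner_Integration.integrable_bound)
    show "integrable lborel (\<lambda>q. gauss \<sigma> (fst q :: 'a \<times> 'b) * N (snd q))"
      by (intro lborel_mult_product integrable_gauss \<sigma> N_int)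
    show "AE q in lborel. norm (gauss \<sigma> (fst q) * c (fst q) (snd q)) \<le> norm (gauss \<sigma> (fst q) * N (snd q))"
    proof (intro AE_I2)
      fix q
      show "norm (gauss \<sigma> (fst q) * c (fst q) (snd q)) \<le> norm (gauss \<sigma> (fst q) * N (snd q))"
        using gauss_bounds(1)[of \<sigma> "fst q"] c_le[of "fst q" "snd q"] by (simp add: abs_mult)
    qed
  qed measurable
  then have K: "integrable (lborel \<Otimes>\<^sub>M lborel) (\<lambda>(w, p). gauss \<sigma> w * c w p)"
    by (simp add: lborel_prod split_beta')
  have inner: "(\<integral>w. gauss \<sigma> w * c w p \<partial>lborel) = gauss_ft \<sigma> (fst p - snd p) * (h (fst p) \<bullet> h (snd p))" for p
    using integral_gauss_two_sided_exp[OF \<sigma>, of "fst p - snd p"]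
    unfolding c_def F_def inner_two_sided_exp fst_diff snd_diff inner_diff_left .
  have eq: "(\<integral>w. gauss \<sigma> w * (norm (Q w))\<^sup>2 \<partial>lborel)
      = (\<integral>p. gauss_ft \<sigma> (fst p - snd p) * (h (fst p) \<bullet> h (snd p)) \<partial>lborel)"
    using lborel_pair.Fubini_integral[OF K] by (simp add: c_int inner)
  have int: "integrable lborel (\<lambda>w. gauss \<sigma> w * (norm (Q w))\<^sup>2)"
    using lborel_pair.integrable_fst[OF K] by (simp add: c_int)
  show "integrable lborel (\<lambda>p. gauss_ft \<sigma> (fst p - snd p) * (h (fst p) \<bullet> h (snd p)))"
    using lborel_pair.integrable_snd[OF K] by (simp add: inner)
  show "(\<integral>\<^sup>+w. ennreal (gauss \<sigma> w) * ennreal ((norm (Q w))\<^sup>2) \<partial>lborel)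
      = ennreal (\<integral>p. gauss_ft \<sigma> (fst p - snd p) * (h (fst p) \<bullet> h (snd p)) \<partial>lborel)"
    unfolding eq[symmetric] using int gauss_bounds(1)[THEN less_imp_le]
    by (subst nn_integral_eq_integral[symmetric]) (auto simp: ennreal_mult'' intro!: AE_I2 mult_nonneg_nonneg)
  show "0 \<le> (\<integral>p. gauss_ft \<sigma> (fst p - snd p) * (h (fst p) \<bullet> h (snd p)) \<partial>lborel)"
    unfolding eq[symmetric] using gauss_bounds(1)[THEN less_imp_le] by (intro Bochner_Integration.integral_nonneg mult_nonneg_nonneg) auto
qed

text \<open>The summand \<open>a\<close> may be negative in places, where \<open>ennreal\<close>
  would truncate it, so it contributes through its real integral. If \<open>b\<close> is not
  integrable, both sides are infinite.\<close>

lemma nn_integral_add_integrable: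
  assumes a: "integrable M a" and [measurable]: "b \<in> borel_measurable M" and b: "\<And>x. 0 \<le> b x"
    and ab: "\<And>x. 0 \<le> a x + b x" and a0: "0 \<le> (\<integral>x. a x \<partial>M)"
  shows "(\<integral>\<^sup>+x. ennreal (a x + b x) \<partial>M) = ennreal (\<integral>x. a x \<partial>M) + (\<integral>\<^sup>+x. ennreal (b x) \<partial>M)"
proof (cases "integrable M b")
  case True
  then have "(\<integral>\<^sup>+x. ennreal (a x + b x) \<partial>M) = ennreal ((\<integral>x. a x \<partial>M) + (\<integral>x. b x \<partial>M))"
    using a ab by (subst nn_integral_eq_integral) auto
  then show ?thesis
    using True b a0 by (simp add: nn_integral_eq_integral ennreal_plus)
next
  case False
  have [measurable]: "a \<in> borel_measurable M"
    using a by auto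
  have b_top: "(\<integral>\<^sup>+x. ennreal (b x) \<partial>M) = \<infinity>"
    using False b by (simp add: integrable_iff_bounded less_top[symmetric])
  have "(\<integral>\<^sup>+x. ennreal (b x) \<partial>M) \<le> (\<integral>\<^sup>+x. ennreal (a x + b x) + ennreal (norm (a x)) \<partial>M)"
    using ab by (intro nn_integral_mono) (auto simp: ennreal_plus[symmetric] simp del: ennreal_plus intro!: ennreal_leI)
  also have "\<dots> = (\<integral>\<^sup>+x. ennreal (a x + b x) \<partial>M) + (\<integral>\<^sup>+x. ennreal (norm (a x)) \<partial>M)"
    by (rule nn_integral_add) measurable
  finally have "(\<integral>\<^sup>+x. ennreal (a x + b x) \<partial>M) = \<infinity>"
    using a b_top by (auto simp: integrable_iff_bounded top_unique ennreal_add_eq_top)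
  with b_top show ?thesis by simp
qed

text \<open>Polarization replaces twice the inner product by two squared norms minus the squared
  norm of the difference. The last is kept as a nonnegative term on the left, so nothing infinite is
  subtracted and infinite L^2 mass is allowed. This matters for products of f with a shifted window:
  they are integrable for every shift, but square integrability is only guaranteed for almost every
  shift.\<close>

lemma two_sided_gauss_plancherel:
  fixes h :: "'a::euclidean_space \<times> 'b::euclidean_space \<Rightarrow> quat"
  assumes h: "integrable lborel h" and \<sigma>: "\<sigma> > 0"
  defines "Q w \<equiv> \<integral>y. exp (- ((fst y \<bullet> fst w) *\<^sub>R quat_i)) * h y * exp (- ((snd y \<bullet> snd w) *\<^sub>R quat_j)) \<partial>lborel"
  shows "2 * (\<integral>\<^sup>+w. ennreal (gauss \<sigma> w) * ennreal ((norm (Q w))\<^sup>2) \<partial>lborel)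
      + (\<integral>\<^sup>+y. \<integral>\<^sup>+r. ennreal (gauss_ft \<sigma> r) * ennreal ((norm (h y - h (y - r)))\<^sup>2) \<partial>lborel \<partial>lborel)
    = 2 * (ennreal ((2 * pi) ^ DIM('a \<times> 'b)) * L2_mass h)"
proof -
  have [measurable]: "h \<in> borel_measurable borel"
    using borel_measurable_integrable[OF h] by simp
  note G0 = gauss_ft_bounds(1)[OF \<sigma>, where 'a="'a \<times> 'b"]
  let ?a = "\<lambda>p. gauss_ft \<sigma> (fst p - snd p) * (h (fst p) \<bullet> h (snd p))"
  let ?b = "\<lambda>p. gauss_ft \<sigma> (fst p - snd p) * (norm (h (fst p) - h (snd p)))\<^sup>2"
  note I = two_sided_gauss_second_moment[OF h \<sigma>]
  have polar: "2 * ?a p + ?b p = gauss_ft \<sigma> (fst p - snd p) * ((norm (h (fst p)))\<^sup>2 + (norm (h (snd p)))\<^sup>2)" for p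
    by (simp add: power2_norm_eq_inner inner_diff_left inner_diff_right inner_commute algebra_simps)
  have "(\<integral>\<^sup>+p. ennreal (2 * ?a p + ?b p) \<partial>lborel) = ennreal (\<integral>p. 2 * ?a p \<partial>lborel) + (\<integral>\<^sup>+p. ennreal (?b p) \<partial>lborel)"
  proof (rule nn_integral_add_integrable[where a="\<lambda>p. 2 * ?a p" and b="?b"])
    show "0 \<le> 2 * ?a p + ?b p" for p
      unfolding polar by (intro mult_nonneg_nonneg G0) auto
  qed (use I(2,3) G0 in auto)
  also have "ennreal (\<integral>p. 2 * ?a p \<partial>lborel) = 2 * (\<integral>\<^sup>+w. ennreal (gauss \<sigma> w) * ennreal ((norm (Q w))\<^sup>2) \<partial>lborel)"
    unfolding Q_def I(1) using I(3) by (simp add: ennreal_mult)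
  also have "(\<integral>\<^sup>+p. ennreal (?b p) \<partial>lborel)
      = (\<integral>\<^sup>+y. \<integral>\<^sup>+y'. ennreal (gauss_ft \<sigma> (y - y')) * ennreal ((norm (h y - h y'))\<^sup>2) \<partial>lborel \<partial>lborel)"
    using G0 by (simp add: nn_integral_lborel_pair ennreal_mult)
  also have "\<dots> = (\<integral>\<^sup>+y. \<integral>\<^sup>+r. ennreal (gauss_ft \<sigma> r) * ennreal ((norm (h y - h (y - r)))\<^sup>2) \<partial>lborel \<partial>lborel)"
  proof (rule nn_integral_cong)
    fix y
    show "(\<integral>\<^sup>+y'. ennreal (gauss_ft \<sigma> (y - y')) * ennreal ((norm (h y - h y'))\<^sup>2) \<partial>lborel)
      = (\<integral>\<^sup>+r. ennreal (gauss_ft \<sigma> r) * ennreal ((norm (h y - h (y - r)))\<^sup>2) \<partial>lborel)"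
      using nn_integral_lborel_translate(3)[of "\<lambda>y'. ennreal (gauss_ft \<sigma> (y - y')) * ennreal ((norm (h y - h y'))\<^sup>2)" y]
      by simp
  qed
  finally have "2 * (\<integral>\<^sup>+w. ennreal (gauss \<sigma> w) * ennreal ((norm (Q w))\<^sup>2) \<partial>lborel)
      + (\<integral>\<^sup>+y. \<integral>\<^sup>+r. ennreal (gauss_ft \<sigma> r) * ennreal ((norm (h y - h (y - r)))\<^sup>2) \<partial>lborel \<partial>lborel)
    = (\<integral>\<^sup>+p. ennreal (2 * ?a p + ?b p) \<partial>lborel)" ..
  also have "\<dots> = (\<integral>\<^sup>+y. \<integral>\<^sup>+y'. ennreal (gauss_ft \<sigma> (y - y')) * ennreal ((norm (h y))\<^sup>2)
      + ennreal (gauss_ft \<sigma> (y - y')) * ennreal ((norm (h y'))\<^sup>2) \<partial>lborel \<partial>lborel)"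
    unfolding polar using G0 by (simp add: nn_integral_lborel_pair ennreal_mult distrib_left)
  also have "\<dots> = (\<integral>\<^sup>+y. \<integral>\<^sup>+y'. ennreal (gauss_ft \<sigma> (y - y')) * ennreal ((norm (h y))\<^sup>2) \<partial>lborel \<partial>lborel)
      + (\<integral>\<^sup>+y. \<integral>\<^sup>+y'. ennreal (gauss_ft \<sigma> (y - y')) * ennreal ((norm (h y'))\<^sup>2) \<partial>lborel \<partial>lborel)"
    by (simp add: nn_integral_add)
  also have "(\<integral>\<^sup>+y. \<integral>\<^sup>+y'. ennreal (gauss_ft \<sigma> (y - y')) * ennreal ((norm (h y'))\<^sup>2) \<partial>lborel \<partial>lborel)
      = (\<integral>\<^sup>+y'. \<integral>\<^sup>+y. ennreal (gauss_ft \<sigma> (y - y')) * ennreal ((norm (h y'))\<^sup>2) \<partial>lborel \<partial>lborel)"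
    by (rule nn_integral_lborel_swap) measurable
  finally have *: "2 * (\<integral>\<^sup>+w. ennreal (gauss \<sigma> w) * ennreal ((norm (Q w))\<^sup>2) \<partial>lborel)
      + (\<integral>\<^sup>+y. \<integral>\<^sup>+r. ennreal (gauss_ft \<sigma> r) * ennreal ((norm (h y - h (y - r)))\<^sup>2) \<partial>lborel \<partial>lborel)
    = (\<integral>\<^sup>+y. \<integral>\<^sup>+y'. ennreal (gauss_ft \<sigma> (y - y')) * ennreal ((norm (h y))\<^sup>2) \<partial>lborel \<partial>lborel)
      + (\<integral>\<^sup>+y'. \<integral>\<^sup>+y. ennreal (gauss_ft \<sigma> (y - y')) * ennreal ((norm (h y'))\<^sup>2) \<partial>lborel \<partial>lborel)" .
  have G: "(\<integral>\<^sup>+y'. ennreal (gauss_ft \<sigma> (y - y')) \<partial>lborel) = ennreal ((2 * pi) ^ DIM('a \<times> 'b))"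
    "(\<integral>\<^sup>+y'. ennreal (gauss_ft \<sigma> (y' - y)) \<partial>lborel) = ennreal ((2 * pi) ^ DIM('a \<times> 'b))" for y :: "'a \<times> 'b"
    unfolding nn_integral_gauss_ft[OF \<sigma>, symmetric] by (intro nn_integral_lborel_translate, measurable)+
  have "(\<integral>\<^sup>+y. \<integral>\<^sup>+y'. ennreal (gauss_ft \<sigma> (y - y')) * ennreal ((norm (h y))\<^sup>2) \<partial>lborel \<partial>lborel)
      = (\<integral>\<^sup>+y. ennreal ((2 * pi) ^ DIM('a \<times> 'b)) * ennreal ((norm (h y))\<^sup>2) \<partial>lborel)"
    by (subst nn_integral_multc) (simp_all only: G, measurable)
  moreover have "(\<integral>\<^sup>+y'. \<integral>\<^sup>+y. ennreal (gauss_ft \<sigma> (y - y')) * ennreal ((norm (h y'))\<^sup>2) \<partial>lborel \<partial>lborel)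
      = (\<integral>\<^sup>+y. ennreal ((2 * pi) ^ DIM('a \<times> 'b)) * ennreal ((norm (h y))\<^sup>2) \<partial>lborel)"
    by (subst nn_integral_multc) (simp_all only: G, measurable)
  moreover have "(\<integral>\<^sup>+y. ennreal ((2 * pi) ^ DIM('a \<times> 'b)) * ennreal ((norm (h y))\<^sup>2) \<partial>lborel)
      = ennreal ((2 * pi) ^ DIM('a \<times> 'b)) * L2_mass h"
    by (rule nn_integral_cmult) measurable
  ultimately show ?thesis
    unfolding * by (simp only: mult_2)
qed

section \<open>Continuity of translations in L^2, through the squared modulus of continuity\<close>

definition translation_defect :: "('a::euclidean_space \<Rightarrow> quat) \<Rightarrow> 'a \<Rightarrow> ennreal"
  where "translation_defect f r = L2_mass (\<lambda>y. f y - f (y - r))"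

lemma norm_add_power2_le: "(norm (x + y))\<^sup>2 \<le> 2 * (norm x)\<^sup>2 + 2 * (norm y)\<^sup>2" for x y :: "'a::real_inner"
  using norm_triangle_ineq[of x y] sum_squares_bound[of "norm x" "norm y"]
    power_mono[of "norm (x + y)" "norm x + norm y" 2]
  by (simp add: power2_sum)

lemma L2_mass_add_le:
  fixes f g :: "'a::euclidean_space \<Rightarrow> quat"
  assumes [measurable]: "f \<in> borel_measurable borel" "g \<in> borel_measurable borel"
  shows "L2_mass (\<lambda>y. f y + g y) \<le> 2 * (L2_mass f + L2_mass g)"
proof -
  have "L2_mass (\<lambda>y. f y + g y) \<le> (\<integral>\<^sup>+y. 2 * (ennreal ((norm (f y))\<^sup>2) + ennreal ((norm (g y))\<^sup>2)) \<partial>lborel)"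
    by (intro nn_integral_mono)
      (simp add: norm_add_power2_le ennreal_plus[symmetric] ennreal_mult[symmetric] ennreal_numeral[symmetric] ennreal_leI
        del: ennreal_plus ennreal_numeral)
  also have "\<dots> = 2 * (L2_mass f + L2_mass g)"
    by (simp add: nn_integral_cmult nn_integral_add)
  finally show ?thesis .
qed

lemma L2_mass_translate:
  fixes f :: "'a::euclidean_space \<Rightarrow> quat"
  assumes [measurable]: "f \<in> borel_measurable borel"
  shows "L2_mass (\<lambda>y. f (y - r)) = L2_mass f"
  by (rule nn_integral_lborel_translate) measurable

lemma translation_defect_le:
  fixes f :: "'a::euclidean_space \<Rightarrow> quat"
  assumes [measurable]: "f \<in> borel_measurable borel"
  shows "translation_defect f r \<le> 4 * L2_mass f"
proof -
  have "translation_defect f r \<le> 2 * (L2_mass f + L2_mass (\<lambda>y. - f (y - r)))"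
    using L2_mass_add_le[of f "\<lambda>y. - f (y - r)"] by (simp add: translation_defect_def)
  also have "\<dots> = 4 * L2_mass f"
    by (simp add: L2_mass_translate mult_2[symmetric] mult.assoc[symmetric])
  finally show ?thesis .
qed

text \<open>The bound K keeps all translated supports inside one ball, so a constant on that ball
  dominates; continuity gives pointwise convergence.\<close>

lemma translation_defect_continuous_compact_support:
  fixes \<phi> :: "'a::euclidean_space \<Rightarrow> quat"
  assumes cont: "continuous_on UNIV \<phi>" and bound: "\<And>y. norm (\<phi> y) \<le> m" and supp: "\<And>y. norm y > R \<Longrightarrow> \<phi> y = 0"
    and r: "r \<longlonglongrightarrow> 0" "\<And>n. norm (r n) \<le> K"
  shows "(\<lambda>n. translation_defect \<phi> (r n)) \<longlonglongrightarrow> 0"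
proof -
  have [measurable]: "\<phi> \<in> borel_measurable borel"
    by (rule borel_measurable_continuous_onI[OF cont])
  have [measurable]: "cball (0::'a) (R + K) \<in> sets borel"
    by simp
  have "(\<lambda>n. \<integral>\<^sup>+y. ennreal ((norm (\<phi> y - \<phi> (y - r n)))\<^sup>2) \<partial>lborel) \<longlonglongrightarrow> (\<integral>\<^sup>+y. ennreal 0 \<partial>(lborel :: 'a measure))"
  proof (rule nn_integral_dominated_convergence)
    show "AE y in lborel. ennreal ((norm (\<phi> y - \<phi> (y - r n)))\<^sup>2) \<le> ennreal ((2 * m)\<^sup>2) * indicator (cball 0 (R + K)) y" for n
    proof (intro AE_I2)
      fix y
      show "ennreal ((norm (\<phi> y - \<phi> (y - r n)))\<^sup>2) \<le> ennreal ((2 * m)\<^sup>2) * indicator (cball 0 (R + K)) y"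
      proof (cases "norm y \<le> R + K")
        case True
        have "norm (\<phi> y - \<phi> (y - r n)) \<le> 2 * m"
          using norm_triangle_ineq4[of "\<phi> y" "\<phi> (y - r n)"] bound[of y] bound[of "y - r n"] by linarith
        then have "(norm (\<phi> y - \<phi> (y - r n)))\<^sup>2 \<le> (2 * m)\<^sup>2"
          by (intro power_mono) auto
        then show ?thesis
          using True by (simp add: ennreal_leI)
      next
        case False
        moreover have "0 \<le> K"
          using r(2)[of n] norm_ge_zero order_trans by blast
        ultimately have "norm (y - r n) > R" "norm y > R"
          using norm_triangle_ineq2[of y "r n"] r(2)[of n] by auto
        then show ?thesis
          using False by (simp add: supp)
      qed
    qed
    show "(\<integral>\<^sup>+y. ennreal ((2 * m)\<^sup>2) * indicator (cball 0 (R + K)) y \<partial>(lborel :: 'a measure)) < \<infinity>"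
    proof -
      have "cball (0::'a) (R + K) \<in> sets lborel"
        by simp
      from nn_integral_cmult_indicator[OF this] show ?thesis
        using emeasure_lborel_cball_finite[of "0::'a" "R + K"] by (simp add: ennreal_mult_less_top)
    qed
    show "AE y in lborel. (\<lambda>n. ennreal ((norm (\<phi> y - \<phi> (y - r n)))\<^sup>2)) \<longlonglongrightarrow> ennreal 0"
    proof (intro AE_I2 tendsto_ennrealI)
      fix y
      have "(\<lambda>n. y - r n) \<longlonglongrightarrow> y - 0"
        by (intro tendsto_diff tendsto_const r)
      then have "(\<lambda>n. \<phi> (y - r n)) \<longlonglongrightarrow> \<phi> y"
        using cont by (auto intro: continuous_on_tendsto_compose[OF cont])
      then have "(\<lambda>n. (norm (\<phi> y - \<phi> (y - r n)))\<^sup>2) \<longlonglongrightarrow> (norm (\<phi> y - \<phi> y))\<^sup>2"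
        by (intro tendsto_intros)
      then show "(\<lambda>n. (norm (\<phi> y - \<phi> (y - r n)))\<^sup>2) \<longlonglongrightarrow> 0"
        by simp
    qed
  qed measurable
  then show ?thesis
    by (simp add: translation_defect_def)
qed

text \<open>Truncation in value and in position comes first. The continuous approximants of the
  truncated function can then be forced below a constant on a ball, which upgrades convergence
  almost everywhere to convergence in L^2.\<close>

lemma continuous_compact_support_dense_L2:
  fixes f :: "'a::euclidean_space \<Rightarrow> quat"
  assumes [measurable]: "f \<in> borel_measurable borel" and fin: "L2_mass f < \<infinity>" and e: "e > 0"
  obtains \<phi> m where "continuous_on UNIV \<phi>" "\<And>y. norm (\<phi> y) \<le> m" "\<And>y. norm y > m + 1 \<Longrightarrow> \<phi> y = 0"
    "L2_mass (\<lambda>y. f y - \<phi> y) < e"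
proof -
  define F where "F k y = (if norm (f y) \<le> real k \<and> norm y \<le> real k then f y else 0)" for k :: nat and y
  have [measurable]: "F k \<in> borel_measurable borel" for k
    unfolding F_def[abs_def] by measurable
  have "(\<lambda>k. L2_mass (\<lambda>y. f y - F k y)) \<longlonglongrightarrow> (\<integral>\<^sup>+y. ennreal 0 \<partial>(lborel :: 'a measure))"
  proof (rule nn_integral_dominated_convergence[where w="\<lambda>y. ennreal ((norm (f y))\<^sup>2)"])
    show "AE y in lborel. ennreal ((norm (f y - F k y))\<^sup>2) \<le> ennreal ((norm (f y))\<^sup>2)" for k
      by (simp add: F_def)
    show "AE y in lborel. (\<lambda>k. ennreal ((norm (f y - F k y))\<^sup>2)) \<longlonglongrightarrow> ennreal 0"
    proof (intro AE_I2 tendsto_eventually)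
      fix y
      obtain K :: nat where "max (norm (f y)) (norm y) \<le> real K"
        using real_arch_simple by blast
      then show "\<forall>\<^sub>F k in sequentially. ennreal ((norm (f y - F k y))\<^sup>2) = ennreal 0"
        by (intro eventually_sequentiallyI[of K]) (auto simp: F_def)
    qed
  qed (use fin in auto)
  then have "(\<lambda>k. L2_mass (\<lambda>y. f y - F k y)) \<longlonglongrightarrow> 0"
    by simp
  \<comment> \<open>Two approximation errors below e/4 suffice, since the quadratic triangle
    inequality doubles their sum.\<close>
  moreover have e4: "0 < e / 4"
    using e by (simp add: ennreal_zero_less_divide)
  ultimately have "\<forall>\<^sub>F k in sequentially. L2_mass (\<lambda>y. f y - F k y) < e / 4"
    by (rule order_tendstoD(2))
  then obtain k where k: "L2_mass (\<lambda>y. f y - F k y) < e / 4"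
    by (auto simp: eventually_sequentially)
  \<comment> \<open>\<open>Suc\<close> keeps m positive, so the denominator in \<open>clamp\<close>
    never vanishes, even for k = 0.\<close>
  define m where "m = real (Suc k)"
  have m: "m > 0" "real k \<le> m"
    by (simp_all add: m_def)
  have [measurable]: "cball (0::'a) (m + 1) \<in> sets borel"
    by simp
  have "F k \<in> borel_measurable lebesgue"
    by (rule measurable_completion) measurable
  then have "F k measurable_on UNIV"
    by (simp add: measurable_on_iff_borel_measurable)
  then obtain S g where S: "negligible S" and g: "\<And>n. continuous_on UNIV (g n)"
    and lim: "\<And>x. x \<notin> S \<Longrightarrow> (\<lambda>n. g n x) \<longlonglongrightarrow> F k x"
    unfolding measurable_on_def by auto
  have AE_S: "AE x in lborel. x \<notin> S"
    using S by (metis AE_completion_iff AE_not_in negligible_iff_null_sets)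
  \<comment> \<open>The continuous functions \<open>g n\<close> converge almost everywhere but
    without control of their size. The radial retraction onto the ball of radius m and the cutoff
    supply a bound and a compact support, and together they leave the limit \<open>F k\<close>
    unchanged.\<close>
  define clamp where "clamp q = (m / max m (norm q)) *\<^sub>R q" for q :: quat
  define cut where "cut y = max 0 (min 1 (m + 1 - norm y))" for y :: 'a
  define \<phi> where "\<phi> n y = cut y *\<^sub>R clamp (g n y)" for n y
  have clamp_le: "norm (clamp q) \<le> m" for q
    using m by (simp add: clamp_def field_simps max_def)
  have cut: "0 \<le> cut y" "cut y \<le> 1" for y
    by (simp_all add: cut_def)
  have \<phi>_cont: "continuous_on UNIV (\<phi> n)" for n
    unfolding \<phi>_def[abs_def] cut_def clamp_def using m
    by (intro continuous_intros g) auto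
  have \<phi>_le: "norm (\<phi> n y) \<le> m" for n y
    using mult_mono[OF cut(2)[of y] clamp_le[of "g n y"]] cut[of y] by (simp add: \<phi>_def)
  have \<phi>_supp: "\<phi> n y = 0" if "norm y > m + 1" for n y
    using that by (simp add: \<phi>_def cut_def)
  have \<phi>_m [measurable]: "\<phi> n \<in> borel_measurable borel" for n
    by (rule borel_measurable_continuous_onI[OF \<phi>_cont])
  have F_le: "norm (F k y) \<le> m" for y
    using m by (auto simp: F_def)
  have F_supp: "F k y = 0" if "norm y > m" for y
    using that m by (simp add: F_def)
  have F_fix: "cut y *\<^sub>R clamp (F k y) = F k y" for y
    using F_le[of y] F_supp[of y] m by (cases "norm y > m") (simp_all add: clamp_def cut_def max_def)
  have "(\<lambda>n. L2_mass (\<lambda>y. F k y - \<phi> n y)) \<longlonglongrightarrow> (\<integral>\<^sup>+y. ennreal 0 \<partial>(lborel :: 'a measure))"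
  proof (rule nn_integral_dominated_convergence[where w="\<lambda>y. ennreal ((2 * m)\<^sup>2) * indicator (cball 0 (m + 1)) y"])
    show "AE y in lborel. ennreal ((norm (F k y - \<phi> n y))\<^sup>2) \<le> ennreal ((2 * m)\<^sup>2) * indicator (cball 0 (m + 1)) y" for n
    proof (intro AE_I2)
      fix y
      have "norm (F k y - \<phi> n y) \<le> 2 * m"
        using norm_triangle_ineq4[of "F k y" "\<phi> n y"] F_le[of y] \<phi>_le[of n y] by linarith
      then have "(norm (F k y - \<phi> n y))\<^sup>2 \<le> (2 * m)\<^sup>2"
        by (intro power_mono) auto
      then show "ennreal ((norm (F k y - \<phi> n y))\<^sup>2) \<le> ennreal ((2 * m)\<^sup>2) * indicator (cball 0 (m + 1)) y"
        using F_supp[of y] \<phi>_supp[of y n] by (cases "norm y \<le> m + 1") (auto intro!: ennreal_leI)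
    qed
    show "(\<integral>\<^sup>+y. ennreal ((2 * m)\<^sup>2) * indicator (cball 0 (m + 1)) y \<partial>(lborel :: 'a measure)) < \<infinity>"
    proof -
      have "cball (0::'a) (m + 1) \<in> sets lborel"
        by simp
      from nn_integral_cmult_indicator[OF this] show ?thesis
        using emeasure_lborel_cball_finite[of "0::'a" "m + 1"] by (simp add: ennreal_mult_less_top)
    qed
    show "AE y in lborel. (\<lambda>n. ennreal ((norm (F k y - \<phi> n y))\<^sup>2)) \<longlonglongrightarrow> ennreal 0"
      using AE_S
    proof eventually_elim
      case (elim y)
      have "(\<lambda>n. \<phi> n y) \<longlonglongrightarrow> cut y *\<^sub>R clamp (F k y)"
        unfolding \<phi>_def clamp_def using m by (intro tendsto_intros lim elim) auto
      then have "(\<lambda>n. (norm (F k y - \<phi> n y))\<^sup>2) \<longlonglongrightarrow> (norm (F k y - F k y))\<^sup>2"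
        unfolding F_fix by (intro tendsto_intros)
      then show "(\<lambda>n. ennreal ((norm (F k y - \<phi> n y))\<^sup>2)) \<longlonglongrightarrow> ennreal 0"
        by (intro tendsto_ennrealI) simp
    qed
  qed measurable
  then have "(\<lambda>n. L2_mass (\<lambda>y. F k y - \<phi> n y)) \<longlonglongrightarrow> 0"
    by simp
  from order_tendstoD(2)[OF this e4] obtain n where n: "L2_mass (\<lambda>y. F k y - \<phi> n y) < e / 4"
    by (auto simp: eventually_sequentially)
  have "L2_mass (\<lambda>y. f y - \<phi> n y) \<le> 2 * (L2_mass (\<lambda>y. f y - F k y) + L2_mass (\<lambda>y. F k y - \<phi> n y))"
    using L2_mass_add_le[of "\<lambda>y. f y - F k y" "\<lambda>y. F k y - \<phi> n y"] by simp
  also have "\<dots> < 2 * (e / 4 + e / 4)"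
    using k n by (intro ennreal_mult_strict_left_mono add_strict_mono) auto
  also have "\<dots> \<le> e"
    by (cases e) (simp_all add: ennreal_plus[symmetric] ennreal_mult[symmetric] divide_ennreal
        ennreal_numeral[symmetric] del: ennreal_plus ennreal_numeral)
  finally show ?thesis
    using that[OF \<phi>_cont \<phi>_le \<phi>_supp] by blast
qed

lemma translation_defect_tendsto:
  fixes f :: "'a::euclidean_space \<Rightarrow> quat"
  assumes [measurable]: "f \<in> borel_measurable borel" and fin: "L2_mass f < \<infinity>"
    and r: "r \<longlonglongrightarrow> 0" "\<And>n. norm (r n) \<le> K"
  shows "(\<lambda>n. translation_defect f (r n)) \<longlonglongrightarrow> 0"
proof (rule order_tendstoI)
  fix e :: ennreal assume e: "0 < e"
  \<comment> \<open>Chosen so that 2 * (4 * (e/16) + e/4) = e: the 2 is from the quadratic triangle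
    inequality, the 4 from the crude bound on the defect of the error f - \<phi>.\<close>
  then have e': "0 < e / 16" "0 < e / 4"
    by (simp_all add: ennreal_zero_less_divide)
  obtain \<phi> m where \<phi>: "continuous_on UNIV \<phi>" "\<And>y. norm (\<phi> y) \<le> m" "\<And>y. norm y > m + 1 \<Longrightarrow> \<phi> y = 0"
    and close: "L2_mass (\<lambda>y. f y - \<phi> y) < e / 16"
    using continuous_compact_support_dense_L2[OF assms(1) fin e'(1)] by metis
  have [measurable]: "\<phi> \<in> borel_measurable borel"
    by (rule borel_measurable_continuous_onI[OF \<phi>(1)])
  have "\<forall>\<^sub>F n in sequentially. translation_defect \<phi> (r n) < e / 4"
    using order_tendstoD(2)[OF translation_defect_continuous_compact_support[OF \<phi> r] e'(2)] .
  then show "\<forall>\<^sub>F n in sequentially. translation_defect f (r n) < e"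
  proof eventually_elim
    case (elim n)
    have "translation_defect f (r n) = L2_mass (\<lambda>y. ((f y - \<phi> y) - (f (y - r n) - \<phi> (y - r n))) + (\<phi> y - \<phi> (y - r n)))"
      by (simp add: translation_defect_def algebra_simps)
    also have "\<dots> \<le> 2 * (translation_defect (\<lambda>y. f y - \<phi> y) (r n) + translation_defect \<phi> (r n))"
      unfolding translation_defect_def by (rule L2_mass_add_le) measurable
    also have "\<dots> \<le> 2 * (4 * L2_mass (\<lambda>y. f y - \<phi> y) + translation_defect \<phi> (r n))"
      by (intro mult_left_mono add_right_mono translation_defect_le) auto
    also have "\<dots> < 2 * (4 * (e / 16) + e / 4)"
      using close elim by (intro ennreal_mult_strict_left_mono add_strict_mono) auto
    also have "\<dots> \<le> e"
      by (cases e) (simp_all add: ennreal_plus[symmetric] ennreal_mult[symmetric] divide_ennreal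
          ennreal_numeral[symmetric] ennreal_leI del: ennreal_plus ennreal_numeral)
    finally show ?case .
  qed
qed simp

text \<open>A product rule for differences: each term varies one factor only, so translations of a
  product are controlled by translations of f and of g.\<close>

lemma norm_mult_diff_power2_le:
  "(norm (a * quat_cnj b - a' * quat_cnj b'))\<^sup>2 \<le> 2 * (norm a)\<^sup>2 * (norm (b - b'))\<^sup>2 + 2 * (norm (a - a'))\<^sup>2 * (norm b')\<^sup>2"
proof -
  have "a * quat_cnj b - a' * quat_cnj b' = a * quat_cnj (b - b') + (a - a') * quat_cnj b'"
    by (simp add: quat_cnj_diff algebra_simps)
  then show ?thesis
    using norm_add_power2_le[of "a * quat_cnj (b - b')" "(a - a') * quat_cnj b'"]
    by (simp add: norm_mult power_mult_distrib)
qed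

text \<open>Rescaling turns the varying kernel into the fixed kernel \<open>gauss_ft 1\<close> and
  moves \<sigma> into the argument of \<Omega>. Convergence is then needed only along each ray, and
  the fixed kernel times B dominates.\<close>

lemma gauss_ft_approximate_identity:
  fixes \<Omega> :: "'a::euclidean_space \<Rightarrow> ennreal"
  assumes [measurable]: "\<Omega> \<in> borel_measurable borel" and bound: "\<And>r. \<Omega> r \<le> B" "B < \<infinity>"
    and lim: "\<And>\<rho>. (\<lambda>n. \<Omega> (\<rho> /\<^sub>R real (Suc n))) \<longlonglongrightarrow> 0"
  shows "(\<lambda>n. \<integral>\<^sup>+r. ennreal (gauss_ft (real (Suc n)) r) * \<Omega> r \<partial>lborel) \<longlonglongrightarrow> 0"
proof -
  have eq: "(\<integral>\<^sup>+r. ennreal (gauss_ft \<sigma> r) * \<Omega> r \<partial>lborel) = (\<integral>\<^sup>+\<rho>. ennreal (gauss_ft 1 \<rho>) * \<Omega> (\<rho> /\<^sub>R \<sigma>) \<partial>lborel)"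
    if \<sigma>: "\<sigma> > 0" for \<sigma> :: real
  proof -
    have "gauss_ft 1 (0 + \<sigma> *\<^sub>R r) * \<sigma> ^ DIM('a) = gauss_ft \<sigma> r" for r :: 'a
      using \<sigma> by (simp add: gauss_ft_def gauss_def power_mult_distrib power_divide)
    then have "ennreal (gauss_ft \<sigma> r) = ennreal (gauss_ft 1 (0 + \<sigma> *\<^sub>R r)) * ennreal (\<sigma> ^ DIM('a))" for r :: 'a
      using gauss_ft_bounds(1)[of 1 "0 + \<sigma> *\<^sub>R r"] \<sigma> by (metis ennreal_mult' zero_less_one)
    then show ?thesis
      using \<sigma> nn_integral_lborel_affine[of "\<lambda>\<rho>. ennreal (gauss_ft 1 \<rho>) * \<Omega> (\<rho> /\<^sub>R \<sigma>)" \<sigma> 0]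
      by (simp add: nn_integral_cmult[symmetric] mult_ac)
  qed
  have "(\<lambda>n. \<integral>\<^sup>+\<rho>. ennreal (gauss_ft 1 \<rho>) * \<Omega> (\<rho> /\<^sub>R real (Suc n)) \<partial>lborel) \<longlonglongrightarrow> (\<integral>\<^sup>+\<rho>. 0 \<partial>(lborel :: 'a measure))"
  proof (rule nn_integral_dominated_convergence[where w="\<lambda>\<rho>. ennreal (gauss_ft 1 \<rho>) * B"])
    show "(\<integral>\<^sup>+\<rho>. ennreal (gauss_ft 1 (\<rho>::'a)) * B \<partial>lborel) < \<infinity>"
      using bound(2) by (simp add: nn_integral_multc nn_integral_gauss_ft ennreal_mult_less_top)
    show "AE \<rho> in lborel. ennreal (gauss_ft 1 \<rho>) * \<Omega> (\<rho> /\<^sub>R real (Suc n)) \<le> ennreal (gauss_ft 1 \<rho>) * B" for n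
      by (intro AE_I2 mult_left_mono bound) auto
    show "AE \<rho> in lborel. (\<lambda>n. ennreal (gauss_ft 1 \<rho>) * \<Omega> (\<rho> /\<^sub>R real (Suc n))) \<longlonglongrightarrow> 0"
    proof (intro AE_I2)
      fix \<rho> :: 'a
      show "(\<lambda>n. ennreal (gauss_ft 1 \<rho>) * \<Omega> (\<rho> /\<^sub>R real (Suc n))) \<longlonglongrightarrow> 0"
        using ennreal_tendsto_cmult[OF _ lim, of "ennreal (gauss_ft 1 \<rho>)" \<rho>] by simp
    qed
  qed measurable
  then show ?thesis
    by (simp add: eq del: of_nat_Suc)
qed

text \<open>The Gaussian identity is integrated over all shifts before the limit is taken. The
  defect is then bounded through translations of f and of g separately, so continuity of
  translations is applied to these two functions and not to the products at individual
  shifts.\<close>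

lemma windowed_ft_second_moment:
  fixes f g :: "'a::euclidean_space \<times> 'b::euclidean_space \<Rightarrow> quat"
  assumes [measurable]: "f \<in> borel_measurable borel" "g \<in> borel_measurable borel"
    and fin: "L2_mass f < \<infinity>" "L2_mass g < \<infinity>"
  shows "(\<integral>\<^sup>+z. ennreal ((norm (windowed_ft g f (fst z) (snd z)))\<^sup>2) \<partial>lborel)
    = ennreal ((2 * pi) ^ DIM('a \<times> 'b)) * (L2_mass f * L2_mass g)"
proof -
  have Q [measurable]: "(\<lambda>z. windowed_ft g f (fst z) (snd z)) \<in> borel_measurable borel"
    unfolding windowed_ft_def by measurable
  have Qm [measurable (raw)]: "(\<lambda>q. windowed_ft g f (a q) (b q)) \<in> borel_measurable N"
    if [measurable]: "a \<in> borel_measurable N" "b \<in> borel_measurable N"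
    for a b and N :: "'n measure"
    using measurable_compose[OF _ Q, of "\<lambda>q. (a q, b q)" N] by simp
  define h where "h x y = f y * quat_cnj (g (y - x))" for x y
  define c where "c = ennreal ((2 * pi) ^ DIM('a \<times> 'b))"
  define I where "I \<sigma> = (\<integral>\<^sup>+x. \<integral>\<^sup>+w. ennreal (gauss \<sigma> w) * ennreal ((norm (windowed_ft g f x w))\<^sup>2) \<partial>lborel \<partial>lborel)" for \<sigma>
  define E where "E \<sigma> = (\<integral>\<^sup>+x. \<integral>\<^sup>+y. \<integral>\<^sup>+r. ennreal (gauss_ft \<sigma> r) * ennreal ((norm (h x y - h x (y - r)))\<^sup>2) \<partial>lborel \<partial>lborel \<partial>lborel)" for \<sigma>
  \<comment> \<open>The bound that the product rule for differences leaves after integration over x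
    and y; the factors 2 are those of the quadratic triangle inequality.\<close>
  define \<Omega> where "\<Omega> r = 2 * (L2_mass f * translation_defect g r) + 2 * (translation_defect f r * L2_mass g)" for r
  have tm [measurable]: "translation_defect f \<in> borel_measurable borel" "translation_defect g \<in> borel_measurable borel"
    unfolding translation_defect_def[abs_def] by measurable
  have [measurable]: "\<Omega> \<in> borel_measurable borel"
    unfolding \<Omega>_def[abs_def] by measurable
  have hmass: "(\<integral>\<^sup>+x. L2_mass (h x) \<partial>lborel) = L2_mass f * L2_mass g"
  proof -
    have "(\<integral>\<^sup>+x. L2_mass (h x) \<partial>lborel) = (\<integral>\<^sup>+x. \<integral>\<^sup>+y. ennreal ((norm (f y))\<^sup>2) * ennreal ((norm (g (y - x)))\<^sup>2) \<partial>lborel \<partial>lborel)"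
      by (simp add: h_def norm_mult power_mult_distrib ennreal_mult)
    also have "\<dots> = (\<integral>\<^sup>+y. \<integral>\<^sup>+x. ennreal ((norm (f y))\<^sup>2) * ennreal ((norm (g (y - x)))\<^sup>2) \<partial>lborel \<partial>lborel)"
      by (rule nn_integral_lborel_swap) measurable
    also have "\<dots> = (\<integral>\<^sup>+y. ennreal ((norm (f y))\<^sup>2) * L2_mass g \<partial>lborel)"
    proof (rule nn_integral_cong)
      fix y
      show "(\<integral>\<^sup>+x. ennreal ((norm (f y))\<^sup>2) * ennreal ((norm (g (y - x)))\<^sup>2) \<partial>lborel) = ennreal ((norm (f y))\<^sup>2) * L2_mass g"
        using nn_integral_lborel_translate(3)[of "\<lambda>x. ennreal ((norm (g x))\<^sup>2)" y] by (simp add: nn_integral_cmult)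
    qed
    finally show ?thesis
      by (simp add: nn_integral_multc)
  qed
  have IE: "2 * I \<sigma> + E \<sigma> = 2 * (c * (L2_mass f * L2_mass g))" if \<sigma>: "\<sigma> > 0" for \<sigma>
  proof -
    have h: "integrable lborel (h x)" for x
      unfolding h_def using integrable_mult_translate[OF assms] .
    have "2 * I \<sigma> + E \<sigma> = (\<integral>\<^sup>+x. 2 * (\<integral>\<^sup>+w. ennreal (gauss \<sigma> w) * ennreal ((norm (windowed_ft g f x w))\<^sup>2) \<partial>lborel)
       + (\<integral>\<^sup>+y. \<integral>\<^sup>+r. ennreal (gauss_ft \<sigma> r) * ennreal ((norm (h x y - h x (y - r)))\<^sup>2) \<partial>lborel \<partial>lborel) \<partial>lborel)"
      unfolding I_def E_def h_def by (simp add: nn_integral_add nn_integral_cmult)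
    also have "\<dots> = (\<integral>\<^sup>+x. 2 * (c * L2_mass (h x)) \<partial>lborel)"
      using two_sided_gauss_plancherel[OF h \<sigma>]
      by (simp add: windowed_ft_def h_def c_def mult.assoc)
    also have "\<dots> = 2 * (c * (L2_mass f * L2_mass g))"
      unfolding hmass[symmetric] unfolding h_def by (simp add: nn_integral_cmult)
    finally show ?thesis .
  qed
  have E_le: "E \<sigma> \<le> (\<integral>\<^sup>+r. ennreal (gauss_ft \<sigma> r) * \<Omega> r \<partial>lborel)" for \<sigma>
  proof -
    have "E \<sigma> = (\<integral>\<^sup>+x. \<integral>\<^sup>+r. \<integral>\<^sup>+y. ennreal (gauss_ft \<sigma> r) * ennreal ((norm (h x y - h x (y - r)))\<^sup>2) \<partial>lborel \<partial>lborel \<partial>lborel)"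
      unfolding E_def h_def by (intro nn_integral_cong nn_integral_lborel_swap) measurable
    also have "\<dots> = (\<integral>\<^sup>+r. \<integral>\<^sup>+x. \<integral>\<^sup>+y. ennreal (gauss_ft \<sigma> r) * ennreal ((norm (h x y - h x (y - r)))\<^sup>2) \<partial>lborel \<partial>lborel \<partial>lborel)"
      unfolding h_def by (intro nn_integral_lborel_swap) measurable
    also have "\<dots> = (\<integral>\<^sup>+r. ennreal (gauss_ft \<sigma> r) * (\<integral>\<^sup>+x. \<integral>\<^sup>+y. ennreal ((norm (h x y - h x (y - r)))\<^sup>2) \<partial>lborel \<partial>lborel) \<partial>lborel)"
      unfolding h_def by (simp add: nn_integral_cmult)
    also have "\<dots> \<le> (\<integral>\<^sup>+r. ennreal (gauss_ft \<sigma> r) * \<Omega> r \<partial>lborel)"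
    proof (intro nn_integral_mono mult_left_mono)
      fix r
      have "(\<integral>\<^sup>+x. \<integral>\<^sup>+y. ennreal ((norm (h x y - h x (y - r)))\<^sup>2) \<partial>lborel \<partial>lborel)
        = (\<integral>\<^sup>+y. \<integral>\<^sup>+x. ennreal ((norm (h x y - h x (y - r)))\<^sup>2) \<partial>lborel \<partial>lborel)"
        unfolding h_def by (rule nn_integral_lborel_swap) measurable
      also have "\<dots> \<le> (\<integral>\<^sup>+y. 2 * (ennreal ((norm (f y))\<^sup>2) * translation_defect g r) + 2 * (ennreal ((norm (f y - f (y - r)))\<^sup>2) * L2_mass g) \<partial>lborel)"
      proof (rule nn_integral_mono)
        fix y
        have "(\<integral>\<^sup>+x. ennreal ((norm (h x y - h x (y - r)))\<^sup>2) \<partial>lborel)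
           \<le> (\<integral>\<^sup>+x. 2 * (ennreal ((norm (f y))\<^sup>2) * ennreal ((norm (g (y - x) - g (y - x - r)))\<^sup>2)) +
             2 * (ennreal ((norm (f y - f (y - r)))\<^sup>2) * ennreal ((norm (g (y - r - x)))\<^sup>2)) \<partial>lborel)"
        proof (rule nn_integral_mono)
          fix x
          have *: "y - x - r = y - r - x"
            by simp
          show "ennreal ((norm (h x y - h x (y - r)))\<^sup>2) \<le>
             2 * (ennreal ((norm (f y))\<^sup>2) * ennreal ((norm (g (y - x) - g (y - x - r)))\<^sup>2)) +
             2 * (ennreal ((norm (f y - f (y - r)))\<^sup>2) * ennreal ((norm (g (y - r - x)))\<^sup>2))"
            unfolding h_def *
            using ennreal_leI[OF norm_mult_diff_power2_le[of "f y" "g (y - x)" "f (y - r)" "g (y - r - x)"]]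
            by (simp add: ennreal_mult mult.assoc)
        qed
        also have "\<dots> = 2 * (ennreal ((norm (f y))\<^sup>2) * (\<integral>\<^sup>+x. ennreal ((norm (g (y - x) - g (y - x - r)))\<^sup>2) \<partial>lborel)) +
             2 * (ennreal ((norm (f y - f (y - r)))\<^sup>2) * (\<integral>\<^sup>+x. ennreal ((norm (g (y - r - x)))\<^sup>2) \<partial>lborel))"
          by (simp add: nn_integral_add nn_integral_cmult)
        also have "(\<integral>\<^sup>+x. ennreal ((norm (g (y - x) - g (y - x - r)))\<^sup>2) \<partial>lborel) = translation_defect g r"
          unfolding translation_defect_def by (rule nn_integral_lborel_translate) measurable
        also have "(\<integral>\<^sup>+x. ennreal ((norm (g (y - r - x)))\<^sup>2) \<partial>lborel) = L2_mass g"
          by (rule nn_integral_lborel_translate) measurable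
        finally show "(\<integral>\<^sup>+x. ennreal ((norm (h x y - h x (y - r)))\<^sup>2) \<partial>lborel)
          \<le> 2 * (ennreal ((norm (f y))\<^sup>2) * translation_defect g r) + 2 * (ennreal ((norm (f y - f (y - r)))\<^sup>2) * L2_mass g)" .
      qed
      also have "\<dots> = \<Omega> r"
        unfolding \<Omega>_def translation_defect_def[of f] by (simp add: nn_integral_add nn_integral_cmult nn_integral_multc)
      finally show "(\<integral>\<^sup>+x. \<integral>\<^sup>+y. ennreal ((norm (h x y - h x (y - r)))\<^sup>2) \<partial>lborel \<partial>lborel) \<le> \<Omega> r" .
    qed simp
    finally show ?thesis .
  qed
  have "(\<lambda>n. \<integral>\<^sup>+r. ennreal (gauss_ft (real (Suc n)) r) * \<Omega> r \<partial>lborel) \<longlonglongrightarrow> 0"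
  proof (rule gauss_ft_approximate_identity)
    show "\<Omega> r \<le> 2 * (L2_mass f * (4 * L2_mass g)) + 2 * (4 * L2_mass f * L2_mass g)" for r
      unfolding \<Omega>_def by (intro add_mono mult_mono translation_defect_le) auto
    show "2 * (L2_mass f * (4 * L2_mass g)) + 2 * (4 * L2_mass f * L2_mass g) < \<infinity>"
      using fin by (simp add: ennreal_mult_less_top)
    show "(\<lambda>n. \<Omega> (\<rho> /\<^sub>R real (Suc n))) \<longlonglongrightarrow> 0" for \<rho>
    proof -
      have r: "(\<lambda>n. \<rho> /\<^sub>R real (Suc n)) \<longlonglongrightarrow> 0"
        using tendsto_scaleR[OF LIMSEQ_inverse_real_of_nat tendsto_const, of \<rho>] by simp
      have K: "norm (\<rho> /\<^sub>R real (Suc n)) \<le> norm \<rho>" for n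
        using mult_right_mono[of "inverse (real (Suc n))" 1 "norm \<rho>"] by (simp add: inverse_le_1_iff)
      note t = translation_defect_tendsto[OF _ _ r K]
      have "(\<lambda>n. \<Omega> (\<rho> /\<^sub>R real (Suc n))) \<longlonglongrightarrow> 2 * (L2_mass f * 0) + 2 * (L2_mass g * 0)"
        unfolding \<Omega>_def mult.commute[of _ "L2_mass g"] using fin
        by (intro tendsto_add ennreal_tendsto_cmult t) (auto simp: less_top)
      then show ?thesis by simp
    qed
  qed measurable
  then have E_lim: "(\<lambda>n. E (real (Suc n))) \<longlonglongrightarrow> 0"
    by (rule tendsto_sandwich[OF _ _ tendsto_const, rotated -1]) (auto intro!: always_eventually E_le)
  have I_lim: "(\<lambda>n. I (real (Suc n))) \<longlonglongrightarrow> (\<integral>\<^sup>+w. \<integral>\<^sup>+x. ennreal ((norm (windowed_ft g f x w))\<^sup>2) \<partial>lborel \<partial>lborel)"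
  proof -
    have "I \<sigma> = (\<integral>\<^sup>+w. ennreal (gauss \<sigma> w) * (\<integral>\<^sup>+x. ennreal ((norm (windowed_ft g f x w))\<^sup>2) \<partial>lborel) \<partial>lborel)" for \<sigma>
    proof -
      have "I \<sigma> = (\<integral>\<^sup>+w. \<integral>\<^sup>+x. ennreal (gauss \<sigma> w) * ennreal ((norm (windowed_ft g f x w))\<^sup>2) \<partial>lborel \<partial>lborel)"
        unfolding I_def by (rule nn_integral_lborel_swap) measurable
      then show ?thesis
        by (simp add: nn_integral_cmult)
    qed
    then show ?thesis
      by (simp only:) (rule nn_integral_gauss_tendsto, measurable)
  qed
  let ?M = "\<integral>\<^sup>+w. \<integral>\<^sup>+x. ennreal ((norm (windowed_ft g f x w))\<^sup>2) \<partial>lborel \<partial>lborel"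
  \<comment> \<open>By \<open>IE\<close> this sequence is constant, so its limit determines the
    undamped second moment.\<close>
  have "(\<lambda>n. 2 * I (real (Suc n)) + E (real (Suc n))) \<longlonglongrightarrow> 2 * ?M + 0"
    by (intro tendsto_add ennreal_tendsto_cmult I_lim E_lim) auto
  then have "(\<lambda>n. 2 * (c * (L2_mass f * L2_mass g))) \<longlonglongrightarrow> 2 * ?M"
    by (simp add: IE del: of_nat_Suc)
  then have "2 * ?M = 2 * (c * (L2_mass f * L2_mass g))"
    by (metis LIMSEQ_const_iff)
  then have "?M = c * (L2_mass f * L2_mass g)"
    by (subst (asm) ennreal_mult_cancel_left) auto
  moreover have "(\<integral>\<^sup>+z. ennreal ((norm (windowed_ft g f (fst z) (snd z)))\<^sup>2) \<partial>lborel) = ?M"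
    by (subst nn_integral_lborel_pair, measurable) (simp, rule nn_integral_lborel_swap, measurable)
  ultimately show ?thesis
    by (simp add: c_def)
qed

subsection \<open>The entropy inequality\<close>

lemma lebesgue_2pi_eq_density:
  "lebesgue_2pi = density (lebesgue :: 'a::euclidean_space measure) (\<lambda>_. ennreal (1 / (2 * pi) powr (real DIM('a) / 2)))"
  by (rule measure_eqI) (simp_all add: lebesgue_2pi_def emeasure_density nn_integral_cmult_indicator del: emeasure_completion)

lemma space_lebesgue_2pi [simp]: "space lebesgue_2pi = UNIV"
  and sets_lebesgue_2pi [simp, measurable_cong]: "sets lebesgue_2pi = sets lebesgue"
  by (simp_all add: lebesgue_2pi_eq_density)

lemma AE_lebesgue_2pi_iff: "(AE x in (lebesgue_2pi :: 'a::euclidean_space measure). P x) \<longleftrightarrow> (AE x in lborel. P x)"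
  unfolding lebesgue_2pi_eq_density by (simp add: AE_density AE_completion_iff)

lemma nn_integral_lebesgue_2pi:
  fixes f :: "'a::euclidean_space \<Rightarrow> ennreal"
  assumes "f \<in> borel_measurable lebesgue"
  shows "(\<integral>\<^sup>+x. f x \<partial>lebesgue_2pi) = ennreal (1 / (2 * pi) powr (real DIM('a) / 2)) * (\<integral>\<^sup>+x. f x \<partial>lborel)"
  using assms unfolding lebesgue_2pi_def by (simp add: nn_integral_scale_measure nn_integral_completion)

lemma integral_lebesgue_2pi:
  fixes f :: "'a::euclidean_space \<Rightarrow> 'b::euclidean_space"
  assumes [measurable]: "f \<in> borel_measurable borel"
  shows "(\<integral>x. f x \<partial>lebesgue_2pi) = (1 / (2 * pi) powr (real DIM('a) / 2)) *\<^sub>R (\<integral>x. f x \<partial>lborel)"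
proof -
  have "f \<in> borel_measurable lebesgue"
    by (rule measurable_completion) measurable
  then show ?thesis
    unfolding lebesgue_2pi_eq_density by (subst integral_density) (auto simp: integral_completion)
qed

text \<open>The moment estimates are for Borel functions, whereas members of \<open>quat_L2\<close>
  are only Lebesgue measurable. The real-valued case is applied to the four components.\<close>

lemma quat_measurable_borel_representative:
  fixes f :: "'a::euclidean_space \<Rightarrow> quat"
  assumes "f \<in> borel_measurable lebesgue"
  obtains f' where "f' \<in> borel_measurable borel" "AE x in lborel. f x = f' x"
proof -
  have "\<exists>f'\<in>borel_measurable lborel. AE x in lborel. f x \<bullet> b = f' x" for b
    by (intro completion_ex_borel_measurable_real borel_measurable_inner borel_measurable_const assms)
  then obtain F where F: "\<And>b. F b \<in> borel_measurable lborel" "\<And>b. AE x in lborel. f x \<bullet> b = F b x"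
    by metis
  have [measurable]: "F b \<in> borel_measurable borel" for b
    using F(1)[of b] by simp
  have "AE x in lborel. \<forall>b\<in>(Basis :: quat set). f x \<bullet> b = F b x"
    using F(2) by (simp add: AE_ball_countable countable_finite)
  then have "AE x in lborel. f x = (\<Sum>b\<in>Basis. F b x *\<^sub>R b)"
  proof eventually_elim
    case (elim x)
    then show ?case
      using euclidean_representation[of "f x"] by (metis (no_types, lifting) sum.cong)
  qed
  then show thesis
    by (intro that[of "\<lambda>x. \<Sum>b\<in>Basis. F b x *\<^sub>R b"]) auto
qed

lemma AE_lborel_diff:
  fixes x :: "'a::euclidean_space"
  assumes "AE y in lborel. P y"
  shows "AE y in lborel. P (y - x)"
proof -
  have "AE y in distr lborel borel ((+) (- x)). P y"
    unfolding lborel_distr_plus by (rule assms)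
  from AE_distrD[OF _ this] show ?thesis
    by simp
qed

text \<open>Completeness: preimages under f and h differ by a null set. This makes the integrand of
  \<open>qwft\<close>, formed from the original functions, measurable.\<close>

lemma borel_measurable_lebesgue_AE:
  fixes f h :: "'a::euclidean_space \<Rightarrow> 'b::euclidean_space"
  assumes h: "h \<in> borel_measurable borel" and ae: "AE y in lborel. f y = h y"
  shows "f \<in> borel_measurable lebesgue"
proof (rule borel_measurableI)
  fix T :: "'b set" assume T: "open T"
  have "h -` T \<inter> space lborel \<in> sets lborel"
    using h T by (intro measurable_sets[of h lborel borel]) auto
  then have "h -` T \<in> sets lebesgue"
    by simp
  then show "f -` T \<inter> space lebesgue \<in> sets lebesgue"
    by (rule completion.in_sets_AE[rotated]) (use ae in \<open>auto simp: AE_completion_iff\<close>)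
qed

text \<open>This is Jensen's inequality for the logarithm under the probability density P/N: the
  mean of P under it is at most N / 2^D, and the tangent is taken at that value.\<close>

lemma entropy_2pi_ge_of_second_moment:
  fixes P :: "'a::euclidean_space \<Rightarrow> real"
  assumes [measurable]: "P \<in> borel_measurable borel" and P0: "\<And>z. 0 \<le> P z" and N: "N > 0"
    and mass: "(\<integral>\<^sup>+z. ennreal (P z) \<partial>lebesgue_2pi) = ennreal N"
    and sq: "(\<integral>\<^sup>+z. ennreal ((P z)\<^sup>2) \<partial>lebesgue_2pi) \<le> ennreal (N\<^sup>2 / 2 ^ D)"
  shows "ereal (N * (real D * ln 2 - ln N)) \<le> entropy_2pi P"
proof -
  have Pm [measurable]: "P \<in> borel_measurable lebesgue_2pi"
    unfolding measurable_cong_sets[OF sets_lebesgue_2pi refl] by (rule measurable_completion) simp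
  have int: "integrable lebesgue_2pi P" "(\<integral>z. P z \<partial>lebesgue_2pi) = N"
    using mass P0 N by (auto simp: integrable_iff_bounded integral_eq_nn_integral)
  have int2: "integrable lebesgue_2pi (\<lambda>z. (P z)\<^sup>2)"
    using sq by (simp add: integrable_iff_bounded le_less_trans)
  have int2_le: "(\<integral>z. (P z)\<^sup>2 \<partial>lebesgue_2pi) \<le> N\<^sup>2 / 2 ^ D"
    using sq N by (simp add: integral_eq_nn_integral enn2real_leI)
  let ?L = "\<lambda>z. ln (P z) * P z"
  \<comment> \<open>Square integrability thus bounds the positive part of P ln P, so the entropy is
    a real number or +\<infinity> and never an undefined difference.\<close>
  have L_le: "?L z \<le> (P z)\<^sup>2" for z
  proof (cases "P z = 0")
    case False
    then show ?thesis
      using P0[of z] ln_le_minus_one[of "P z"] by (auto simp: power2_eq_square intro!: mult_right_mono)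
  qed simp
  have pos: "(\<integral>\<^sup>+z. ennreal (?L z) \<partial>lebesgue_2pi) < \<infinity>"
  proof -
    have "(\<integral>\<^sup>+z. ennreal (?L z) \<partial>lebesgue_2pi) \<le> (\<integral>\<^sup>+z. ennreal ((P z)\<^sup>2) \<partial>lebesgue_2pi)"
      by (intro nn_integral_mono ennreal_leI L_le)
    also have "\<dots> < \<infinity>"
      using sq le_less_trans by fastforce
    finally show ?thesis .
  qed
  show ?thesis
  proof (cases "(\<integral>\<^sup>+z. ennreal (- ?L z) \<partial>lebesgue_2pi) < \<infinity>")
    \<comment> \<open>A divergent negative part makes the entropy +\<infinity>, since the positive
      part is finite by \<open>pos\<close>.\<close>
    case False
    then have "(\<integral>\<^sup>+z. ennreal (- ?L z) \<partial>lebesgue_2pi) = \<infinity>"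
      by (simp add: less_top[symmetric])
    moreover obtain a where "(\<integral>\<^sup>+z. ennreal (?L z) \<partial>lebesgue_2pi) = ennreal a" "a \<ge> 0"
      using pos by (cases "\<integral>\<^sup>+z. ennreal (?L z) \<partial>lebesgue_2pi") auto
    ultimately show ?thesis
      by (simp add: entropy_2pi_def)
  next
    case True
    have "?L \<in> borel_measurable lebesgue_2pi"
      unfolding measurable_cong_sets[OF sets_lebesgue_2pi refl] by (rule measurable_completion) measurable
    then have Lint: "integrable lebesgue_2pi ?L"
      unfolding real_integrable_def using pos True by auto
    have E: "entropy_2pi P = ereal (- (\<integral>z. ?L z \<partial>lebesgue_2pi))"
    proof -
      obtain a where a: "(\<integral>\<^sup>+z. ennreal (?L z) \<partial>lebesgue_2pi) = ennreal a" "a \<ge> 0"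
        using pos by (cases "\<integral>\<^sup>+z. ennreal (?L z) \<partial>lebesgue_2pi") auto
      obtain b where b: "(\<integral>\<^sup>+z. ennreal (- ?L z) \<partial>lebesgue_2pi) = ennreal b" "b \<ge> 0"
        using True by (cases "\<integral>\<^sup>+z. ennreal (- ?L z) \<partial>lebesgue_2pi") auto
      show ?thesis
        unfolding entropy_2pi_def real_lebesgue_integral_def[OF Lint] a b using a(2) b(2) by simp
    qed
    define c where "c = N / 2 ^ D"
    have c: "c > 0"
      using N by (simp add: c_def)
    have tangent: "?L z \<le> P z * (ln c - 1) + (P z)\<^sup>2 / c" for z
    proof (cases "P z = 0")
      case False
      then have p: "P z > 0"
        using P0[of z] by simp
      have "ln (P z) \<le> ln c - 1 + P z / c"
        using ln_le_minus_one[of "P z / c"] p c by (simp add: ln_div)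
      from mult_right_mono[OF this less_imp_le[OF p]] show ?thesis
        by (simp add: power2_eq_square algebra_simps)
    qed simp
    have "(\<integral>z. ?L z \<partial>lebesgue_2pi) \<le> (\<integral>z. P z * (ln c - 1) + (P z)\<^sup>2 / c \<partial>lebesgue_2pi)"
      using Lint int int2 by (intro integral_mono tangent) auto
    also have "\<dots> = N * (ln c - 1) + (\<integral>z. (P z)\<^sup>2 \<partial>lebesgue_2pi) / c"
      using int int2 by simp
    also have "\<dots> \<le> N * (ln c - 1) + N\<^sup>2 / 2 ^ D / c"
      using int2_le c by (intro add_left_mono divide_right_mono) auto
    \<comment> \<open>By the choice of c the quotient equals N and cancels the -N contributed by the
      tangent.\<close>
    also have "\<dots> = N * ln c"
      using N by (simp add: c_def power2_eq_square algebra_simps)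
    also have "ln c = ln N - real D * ln 2"
      using N by (simp add: c_def ln_div ln_realpow)
    finally have "N * (real D * ln 2 - ln N) \<le> - (\<integral>z. ?L z \<partial>lebesgue_2pi)"
      by (simp add: algebra_simps)
    then show ?thesis
      unfolding E by simp
  qed
qed

lemma quat_L2_norm_power2:
  fixes f :: "'a::euclidean_space \<Rightarrow> quat"
  assumes "f \<in> quat_L2"
  shows "ennreal ((quat_L2_norm f)\<^sup>2) = (\<integral>\<^sup>+x. ennreal ((norm (f x))\<^sup>2) \<partial>lebesgue_2pi)"
  using assms by (simp add: quat_L2_def quat_L2_norm_def nn_integral_eq_integral)

theorem theorem10:
  fixes f g :: "(real^'d) \<times> (real^'d) \<Rightarrow> quat"
  assumes "g \<in> quat_L2" and "f \<in> quat_L2"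
    and "\<not> (AE y in lebesgue_2pi. f y = 0)" and "\<not> (AE y in lebesgue_2pi. g y = 0)"
  shows "entropy_2pi (\<lambda>z. (norm (qwft g f z))\<^sup>2) \<ge>
    ereal ((quat_L2_norm f)\<^sup>2 * (quat_L2_norm g)\<^sup>2 *
      (2 * real CARD('d) * ln 2 - ln ((quat_L2_norm f)\<^sup>2 * (quat_L2_norm g)\<^sup>2)))"
proof -
  have fm: "f \<in> borel_measurable lebesgue" and gm: "g \<in> borel_measurable lebesgue"
    using assms(1,2) by (simp_all add: quat_L2_def measurable_cong_sets[OF sets_lebesgue_2pi refl])
  obtain F where F [measurable]: "F \<in> borel_measurable borel" and fF: "AE y in lborel. f y = F y"
    using quat_measurable_borel_representative[OF fm] .
  obtain G where G [measurable]: "G \<in> borel_measurable borel" and gG: "AE y in lborel. g y = G y"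
    using quat_measurable_borel_representative[OF gm] .
  \<comment> \<open>The normalizing factor of the measure in dimension 2d. In dimension 4d it is
    k^2, and the Plancherel constant (2 \<pi>)^(2d) is 1/k^2.\<close>
  define k where "k = 1 / (2 * pi) ^ CARD('d)"
  have k: "k > 0"
    by (simp add: k_def)
  have k2: "1 / (2 * pi) powr (real DIM((real^'d) \<times> (real^'d)) / 2) = k"
    by (simp add: k_def powr_realpow)
  have k4: "1 / (2 * pi) powr (real DIM(((real^'d) \<times> (real^'d)) \<times> ((real^'d) \<times> (real^'d))) / 2) = k\<^sup>2"
  proof -
    have dim: "real DIM(((real^'d) \<times> (real^'d)) \<times> ((real^'d) \<times> (real^'d))) / 2 = real (CARD('d) * 2)"
      by simp
    have "(2 * pi) powr real (CARD('d) * 2) = ((2 * pi) ^ CARD('d))\<^sup>2"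
      unfolding power_mult[symmetric] by (rule powr_realpow) simp
    then show ?thesis
      unfolding dim by (simp only: k_def power_divide power_one)
  qed
  have conv2: "(\<integral>\<^sup>+x. h x \<partial>lebesgue_2pi) = ennreal k * (\<integral>\<^sup>+x. h x \<partial>lborel)"
    if "h \<in> borel_measurable lebesgue" for h :: "(real^'d) \<times> (real^'d) \<Rightarrow> ennreal"
    unfolding nn_integral_lebesgue_2pi[OF that] k2 ..
  have conv4: "(\<integral>\<^sup>+x. h x \<partial>lebesgue_2pi) = ennreal (k\<^sup>2) * (\<integral>\<^sup>+x. h x \<partial>lborel)"
    if "h \<in> borel_measurable lebesgue" for h :: "((real^'d) \<times> (real^'d)) \<times> ((real^'d) \<times> (real^'d)) \<Rightarrow> ennreal"
    unfolding nn_integral_lebesgue_2pi[OF that] k4 ..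
  define nf where "nf = (quat_L2_norm f)\<^sup>2"
  define ng where "ng = (quat_L2_norm g)\<^sup>2"
  have massF: "ennreal nf = ennreal k * L2_mass F"
  proof -
    have "(\<integral>\<^sup>+x. ennreal ((norm (f x))\<^sup>2) \<partial>lborel) = L2_mass F"
      by (rule nn_integral_cong_AE) (use fF in eventually_elim, simp)
    then show ?thesis
      unfolding nf_def quat_L2_norm_power2[OF assms(2)] using fm by (subst conv2) simp_all
  qed
  have massG: "ennreal ng = ennreal k * L2_mass G"
  proof -
    have "(\<integral>\<^sup>+x. ennreal ((norm (g x))\<^sup>2) \<partial>lborel) = L2_mass G"
      by (rule nn_integral_cong_AE) (use gG in eventually_elim, simp)
    then show ?thesis
      unfolding ng_def quat_L2_norm_power2[OF assms(1)] using gm by (subst conv2) simp_all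
  qed
  have L2_finite: "M < \<infinity>" if "ennreal a = ennreal k * M" for a M
  proof (rule ccontr)
    assume "\<not> M < \<infinity>"
    then have "ennreal k * M = \<top>"
      using k by (simp add: less_top[symmetric] ennreal_mult_top)
    with that show False
      by (metis ennreal_neq_top)
  qed
  note fin = L2_finite[OF massF] L2_finite[OF massG]
  have norm_pos: "(quat_L2_norm h)\<^sup>2 > 0" if "h \<in> quat_L2" "\<not> (AE y in lebesgue_2pi. h y = 0)"
    for h :: "(real^'d) \<times> (real^'d) \<Rightarrow> quat"
  proof (rule ccontr)
    assume "\<not> 0 < (quat_L2_norm h)\<^sup>2"
    then have "(\<integral>\<^sup>+x. ennreal ((norm (h x))\<^sup>2) \<partial>lebesgue_2pi) = 0"
      unfolding quat_L2_norm_power2[OF that(1), symmetric] by simp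
    moreover have "h \<in> borel_measurable lebesgue_2pi"
      using that(1) by (simp add: quat_L2_def)
    ultimately have "AE y in lebesgue_2pi. ennreal ((norm (h y))\<^sup>2) = 0"
      by (subst (asm) nn_integral_0_iff_AE) auto
    with that(2) show False
      by simp
  qed
  have N: "nf * ng > 0"
    using norm_pos[OF assms(2,3)] norm_pos[OF assms(1,4)] by (simp add: nf_def ng_def)
  have nn: "0 \<le> nf" "0 \<le> ng"
    by (simp_all add: nf_def ng_def)
  \<comment> \<open>For each fixed x the representatives change the integrand on a null set only, so
    the transforms agree at every point and not merely almost everywhere.\<close>
  have eq: "qwft g f z = k *\<^sub>R windowed_ft G F (fst z) (snd z)" for z
  proof -
    obtain x u v where z: "z = (x, (u, v))"
      by (metis surj_pair)
    let ?H = "\<lambda>y. exp (- ((fst y \<bullet> u) *\<^sub>R quat_i)) * F y * quat_cnj (G (y - x)) * exp (- ((snd y \<bullet> v) *\<^sub>R quat_j))"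
    have m: "?H \<in> borel_measurable borel"
      by measurable
    have ae: "AE y in lborel. (case y of (s, t) \<Rightarrow> exp (- ((s \<bullet> u) *\<^sub>R quat_i)) * f y * quat_cnj (g (y - x)) * exp (- ((t \<bullet> v) *\<^sub>R quat_j))) = ?H y"
      using fF AE_lborel_diff[OF gG, of x] by eventually_elim (simp add: split_beta')
    have "qwft g f z = (\<integral>y. ?H y \<partial>lebesgue_2pi)"
      unfolding z qwft_def prod.case
    proof (rule integral_cong_AE)
      show "?H \<in> borel_measurable lebesgue_2pi"
        using measurable_completion[of ?H lborel borel] m by (simp add: measurable_cong_sets[OF sets_lebesgue_2pi refl])
      show "(\<lambda>y. case y of (s, t) \<Rightarrow> exp (- ((s \<bullet> u) *\<^sub>R quat_i)) * f y * quat_cnj (g (y - x)) * exp (- ((t \<bullet> v) *\<^sub>R quat_j)))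
        \<in> borel_measurable lebesgue_2pi"
        unfolding measurable_cong_sets[OF sets_lebesgue_2pi refl]
        by (rule borel_measurable_lebesgue_AE[OF m ae])
    qed (use ae in \<open>simp add: AE_lebesgue_2pi_iff\<close>)
    also have "\<dots> = k *\<^sub>R (\<integral>y. ?H y \<partial>lborel)"
      unfolding integral_lebesgue_2pi[OF m] k2 ..
    finally show ?thesis
      by (simp add: windowed_ft_def z)
  qed
  have Q [measurable]: "(\<lambda>z. windowed_ft G F (fst z) (snd z)) \<in> borel_measurable borel"
    unfolding windowed_ft_def by measurable
  have Q' [measurable]: "(\<lambda>z. windowed_ft G F (fst z) (snd z)) \<in> borel_measurable lebesgue"
    using Q by (intro measurable_completion) simp
  have "ereal (nf * ng * (real (2 * CARD('d)) * ln 2 - ln (nf * ng))) \<le> entropy_2pi (\<lambda>z. (norm (qwft g f z))\<^sup>2)"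
  proof (rule entropy_2pi_ge_of_second_moment)
    show "(\<lambda>z. (norm (qwft g f z))\<^sup>2) \<in> borel_measurable borel"
      unfolding eq by measurable
    have "(\<integral>\<^sup>+z. ennreal ((norm (qwft g f z))\<^sup>2) \<partial>lebesgue_2pi)
      = ennreal (k\<^sup>2) * (ennreal (k\<^sup>2) * (\<integral>\<^sup>+z. ennreal ((norm (windowed_ft G F (fst z) (snd z)))\<^sup>2) \<partial>lborel))"
      unfolding eq by (subst conv4) (measurable, simp add: power_mult_distrib ennreal_mult nn_integral_cmult)
    \<comment> \<open>Two factors k come from the squared transform and two from the measure in
      dimension 4d. The Plancherel constant cancels two of them, and the others normalize the two
      masses.\<close>
    also have "\<dots> = ennreal (k * k * (k * k)) * ennreal ((2 * pi) ^ CARD('d) * (2 * pi) ^ CARD('d)) * (L2_mass F * L2_mass G)"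
      unfolding windowed_ft_second_moment[OF F G fin]
      using k by (simp add: power2_eq_square ennreal_mult power_add mult_ac)
    also have "ennreal (k * k * (k * k)) * ennreal ((2 * pi) ^ CARD('d) * (2 * pi) ^ CARD('d)) = ennreal k * ennreal k"
      using k by (simp add: ennreal_mult'[symmetric] k_def)
    also have "ennreal k * ennreal k * (L2_mass F * L2_mass G) = ennreal (nf * ng)"
      unfolding ennreal_mult[OF nn] massF massG by (simp only: mult_ac)
    finally show "(\<integral>\<^sup>+z. ennreal ((norm (qwft g f z))\<^sup>2) \<partial>lebesgue_2pi) = ennreal (nf * ng)" .
    have p4: "((norm (qwft g f z))\<^sup>2)\<^sup>2 = k ^ 4 * (norm (windowed_ft G F (fst z) (snd z))) ^ 4" for z
      using k by (simp add: eq power4_eq_xxxx power2_eq_square mult_ac)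
    have "(\<integral>\<^sup>+z. ennreal (((norm (qwft g f z))\<^sup>2)\<^sup>2) \<partial>lebesgue_2pi)
      = ennreal (k\<^sup>2) * (ennreal (k ^ 4) * (\<integral>\<^sup>+z. ennreal ((norm (windowed_ft G F (fst z) (snd z))) ^ 4) \<partial>lborel))"
      unfolding p4 using k by (subst conv4) (measurable, simp add: ennreal_mult nn_integral_cmult)
    also have "\<dots> \<le> ennreal (k\<^sup>2) * (ennreal (k ^ 4) * (ennreal (pi ^ DIM((real^'d) \<times> (real^'d))) * (L2_mass F)\<^sup>2 * (L2_mass G)\<^sup>2))"
      by (intro mult_left_mono windowed_ft_fourth_moment_le F G fin) auto
    \<comment> \<open>Of the six factors k, four normalize the squared masses. The other two combine
      with \<pi>^(2d) to 2^(-2d).\<close>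
    also have "\<dots> = ennreal (k\<^sup>2) * ennreal (pi ^ (2 * CARD('d))) * ((ennreal k * L2_mass F)\<^sup>2 * (ennreal k * L2_mass G)\<^sup>2)"
    proof -
      have "a\<^sup>2 * (a ^ 4 * (q * A\<^sup>2 * B\<^sup>2)) = a\<^sup>2 * q * ((a * A)\<^sup>2 * (a * B)\<^sup>2)" for a q A B :: ennreal
        by (simp add: power2_eq_square power4_eq_xxxx mult_ac)
      from this[of "ennreal k" "ennreal (pi ^ (2 * CARD('d)))" "L2_mass F" "L2_mass G"] show ?thesis
        using k by (simp add: ennreal_power mult_2)
    qed
    also have "\<dots> = ennreal (k\<^sup>2 * pi ^ (2 * CARD('d)) * (nf * ng)\<^sup>2)"
      using nn unfolding massF[symmetric] massG[symmetric]
      by (simp add: ennreal_mult ennreal_power power_mult_distrib)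
    also have "k\<^sup>2 * pi ^ (2 * CARD('d)) * (nf * ng)\<^sup>2 = (nf * ng)\<^sup>2 / 2 ^ (2 * CARD('d))"
    proof -
      have "k\<^sup>2 * pi ^ (2 * CARD('d)) = 1 / 2 ^ (2 * CARD('d))"
        unfolding k_def power_mult mult.commute[of 2 "CARD('d)"] by (simp add: power_mult_distrib power_divide)
      then show ?thesis
        by simp
    qed
    finally show "(\<integral>\<^sup>+z. ennreal (((norm (qwft g f z))\<^sup>2)\<^sup>2) \<partial>lebesgue_2pi) \<le> ennreal ((nf * ng)\<^sup>2 / 2 ^ (2 * CARD('d)))"
      by simp
  qed (use N in auto)
  then show ?thesis
    by (simp add: nf_def ng_def mult.assoc)
qed

end
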